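(* Let $(A,d_A,[\cdot,\cdot]_A)$ and $(B,d_B,[\cdot,\cdot]_B)$ be differential graded Lie algebras over a field of characteristic $0$, and let $i\colon A\to B$ and $p\colon B\to A$ be quasi-isomorphisms of cochain complexes and $h\colon B\to B$ a linear map of degree $-1$ such that $h d_B+d_B h=\mathrm{id}_B-i\circ p$, $p\circ i=\mathrm{id}_A$, $h^2=0$, $h\circ i=0$ and $p\circ h=0$. Assume that $p$ is a morphism of differential graded Lie algebras ($i$ being only a chain map). Then the coalgebra morphism $I\colon\mathrm{Sym}(A[1])\to\mathrm{Sym}(B[1])$ recursively defined by $I^1_1=i$ and, for $k\ge2$, $$I^1_k=h\circ L_{\infty,k},\qquad L_{\infty,k}=Q^1_{B,2}\circ I^2_k-I^1_{k-1}\circ Q^{k-1}_{A,k},$$ is an $L_\infty$-quasi-inverse of $p$. Moreover, one even has $I^1_k=h\circ Q^1_{B,2}\circ I^2_k$ for all $k\ge 2$.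
   Context: For a DGLA $(L,d,[\cdot,\cdot])$ let $Q$ be the degree $+1$ codifferential on the cocommutative coalgebra $\mathrm{Sym}(L[1])$ with structure maps $Q_1^1=-d$, $Q_2^1(x\vee y)=-(-1)^{|x|}[x,y]$ ($|x|$ the degree in $L[1]$) and $Q^1_n=0$ otherwise. $Q_n^j$ is the component of $Q$ from $\mathrm{Sym}^n(L[1])$ to $\mathrm{Sym}^j(L[1])$: $Q_n^j(x_1\vee\dots\vee x_n)=\sum_{\sigma\in \mathrm{Sh}(n+1-j,j-1)}\epsilon(\sigma)Q^1_{n+1-j}(x_{\sigma(1)}\vee\dots\vee x_{\sigma(n+1-j)})\vee x_{\sigma(n+2-j)}\vee\dots\vee x_{\sigma(n)}$, with $\epsilon(\sigma)$ the Koszul sign in $L[1]$. Indices $A,B$ refer to the two DGLAs. A coalgebra morphism $F\colon\mathrm{Sym}(L[1])\to\mathrm{Sym}(L'[1])$ of degree $0$ with $F(1)=1$ is uniquely determined by its structure maps $F^1_n\colon\mathrm{Sym}^n(L[1])\to L'[1]$, $n\ge1$; $F^j_n\colon\mathrm{Sym}^n(L[1])\to\mathrm{Sym}^j(L'[1])$ denotes its component, and $F^j_n$ depends only on $F^1_k$ with $k\le n-j+1$. $F$ is an $L_\infty$-morphism if $FQ=Q'F$, and an $L_\infty$-quasi-isomorphism if moreover $F^1_1$ is a quasi-isomorphism of complexes. An $L_\infty$-quasi-inverse of an $L_\infty$-quasi-isomorphism is an $L_\infty$-quasi-isomorphism in the opposite direction such that the first structure maps induce mutually inverse maps in cohomology.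 A DGLA morphism is viewed as an $L_\infty$-morphism with only the first structure map non-zero. *)

theory Defs
  imports "HOL-Library.Poly_Mapping" "HOL-Combinatorics.Combinatorics"
begin

section \<open>Graded vector spaces, cochain complexes, DGLAs\<close>

text \<open>A \<open>\<int>\<close>-graded vector space is a vector space that is the internal direct sum of
  subspaces \<open>grade V n\<close>.\<close>

record ('k, 'a) gspace =
  smul :: "'k \<Rightarrow> 'a \<Rightarrow> 'a"
  grade :: "int \<Rightarrow> 'a set"

record ('k, 'a) cplx = "('k, 'a) gspace" +
  diff :: "'a \<Rightarrow> 'a"

record ('k, 'a) dgla_data = "('k, 'a) cplx" +
  bracket :: "'a \<Rightarrow> 'a \<Rightarrow> 'a"

definition hom_decomp ::
  "('k, 'a::ab_group_add, 'm) gspace_scheme \<Rightarrow> 'a \<Rightarrow> (int \<Rightarrow> 'a) \<Rightarrow> bool" where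
  "hom_decomp V x f \<longleftrightarrow>
     (\<forall>n. f n \<in> grade V n) \<and> finite {n. f n \<noteq> 0} \<and> x = (\<Sum>n | f n \<noteq> 0. f n)"

locale graded_space =
  vector_space "smul V" for V :: "('k::field, 'a::ab_group_add, 'm) gspace_scheme" +
  assumes grade_subspace: "subspace (grade V n)"
    and ex1_hom_decomp: "\<exists>!f. hom_decomp V x f"

definition hcomp ::
  "('k, 'a::ab_group_add, 'm) gspace_scheme \<Rightarrow> int \<Rightarrow> 'a \<Rightarrow> 'a" where
  "hcomp V n x = (THE f. hom_decomp V x f) n"

definition linear_deg ::
  "('k::field, 'a::ab_group_add, 'm) gspace_scheme \<Rightarrow>
   ('k, 'b::ab_group_add, 'n) gspace_scheme \<Rightarrow> int \<Rightarrow> ('a \<Rightarrow> 'b) \<Rightarrow> bool" where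
  "linear_deg V W e f \<longleftrightarrow>
     Vector_Spaces.linear (smul V) (smul W) f \<and> (\<forall>n. f ` grade V n \<subseteq> grade W (n + e))"

locale cochain_complex = graded_space V
  for V :: "('k::field, 'a::ab_group_add, 'm) cplx_scheme" +
  assumes diff_linear_deg: "linear_deg V V 1 (diff V)"
    and diff_diff: "diff V (diff V x) = 0"

locale dgla = cochain_complex L
  for L :: "('k::field, 'a::ab_group_add, 'm) dgla_data_scheme" +
  assumes bracket_linear_left: "Vector_Spaces.linear (smul L) (smul L) (\<lambda>x. bracket L x y)"
    and bracket_linear_right: "Vector_Spaces.linear (smul L) (smul L) (bracket L x)"
    and bracket_grade:
      "x \<in> grade L m \<Longrightarrow> y \<in> grade L n \<Longrightarrow> bracket L x y \<in> grade L (m + n)"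
    and bracket_antisym:
      "x \<in> grade L m \<Longrightarrow> y \<in> grade L n \<Longrightarrow>
        bracket L x y = smul L (- ((-1) powi (m * n))) (bracket L y x)"
    and bracket_jacobi:
      "x \<in> grade L m \<Longrightarrow> y \<in> grade L n \<Longrightarrow> z \<in> grade L l \<Longrightarrow>
        bracket L x (bracket L y z) =
          bracket L (bracket L x y) z + smul L ((-1) powi (m * n)) (bracket L y (bracket L x z))"
    and diff_bracket:
      "x \<in> grade L m \<Longrightarrow>
        diff L (bracket L x y) =
          bracket L (diff L x) y + smul L ((-1) powi m) (bracket L x (diff L y))"

definition chain_map ::
  "('k::field, 'a::ab_group_add, 'm) cplx_scheme \<Rightarrow>
   ('k, 'b::ab_group_add, 'n) cplx_scheme \<Rightarrow> ('a \<Rightarrow> 'b) \<Rightarrow> bool" where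
  "chain_map V W f \<longleftrightarrow> linear_deg V W 0 f \<and> (\<forall>x. f (diff V x) = diff W (f x))"

definition dgla_morphism ::
  "('k::field, 'a::ab_group_add, 'm) dgla_data_scheme \<Rightarrow>
   ('k, 'b::ab_group_add, 'n) dgla_data_scheme \<Rightarrow> ('a \<Rightarrow> 'b) \<Rightarrow> bool" where
  "dgla_morphism L M f \<longleftrightarrow>
     chain_map L M f \<and> (\<forall>x y. f (bracket L x y) = bracket M (f x) (f y))"

subsection \<open>Cohomology\<close>

definition cocycles :: "('k, 'a::ab_group_add, 'm) cplx_scheme \<Rightarrow> int \<Rightarrow> 'a set" where
  "cocycles V n = {x \<in> grade V n. diff V x = 0}"

definition coboundaries :: "('k, 'a::ab_group_add, 'm) cplx_scheme \<Rightarrow> int \<Rightarrow> 'a set" where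
  "coboundaries V n = diff V ` grade V (n - 1)"

definition cohomologous ::
  "('k, 'a::ab_group_add, 'm) cplx_scheme \<Rightarrow> int \<Rightarrow> ('a \<times> 'a) set" where
  "cohomologous V n =
     {(x, y). x \<in> cocycles V n \<and> y \<in> cocycles V n \<and> x - y \<in> coboundaries V n}"

definition cohomology :: "('k, 'a::ab_group_add, 'm) cplx_scheme \<Rightarrow> int \<Rightarrow> 'a set set" where
  "cohomology V n = cocycles V n // cohomologous V n"

definition cohomology_map ::
  "('k, 'b::ab_group_add, 'n) cplx_scheme \<Rightarrow> int \<Rightarrow> ('a \<Rightarrow> 'b) \<Rightarrow> 'a set \<Rightarrow> 'b set" where
  "cohomology_map W n f c = (\<Union>x\<in>c. cohomologous W n `` {f x})"

definition quasi_iso ::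
  "('k::field, 'a::ab_group_add, 'm) cplx_scheme \<Rightarrow>
   ('k, 'b::ab_group_add, 'n) cplx_scheme \<Rightarrow> ('a \<Rightarrow> 'b) \<Rightarrow> bool" where
  "quasi_iso V W f \<longleftrightarrow>
     chain_map V W f \<and>
     (\<forall>n. bij_betw (cohomology_map W n f) (cohomology V n) (cohomology W n))"

text \<open>The shifted complex \<open>L[1]\<close>; its differential is \<open>Q\<^sup>1\<^sub>1 = -d\<close>.\<close>

definition shift :: "('k, 'a::ab_group_add, 'm) cplx_scheme \<Rightarrow> ('k, 'a) cplx" where
  "shift L = \<lparr>smul = smul L, grade = (\<lambda>n. grade L (n + 1)), diff = (\<lambda>x. - diff L x)\<rparr>"

section \<open>The graded symmetric coalgebra\<close>

text \<open>
  \<open>Sym(V)\<close> is the quotient of the free vector space \<open>'a list \<Rightarrow>\<^sub>0 'k\<close> on words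
  \<open>[x\<^sub>1, \<dots>, x\<^sub>n]\<close> (standing for \<open>x\<^sub>1 \<or> \<dots> \<or> x\<^sub>n\<close>; the empty word is \<open>1\<close>) by
  the subspace \<open>sym_rel V\<close> generated by multilinearity and graded commutativity. Since
  HOL has no types depending on \<open>V\<close>, the quotient is not formed as a type: equality in
  \<open>Sym(V)\<close> is \<open>sym_eq V\<close>, and a linear map \<open>Sym(V) \<rightarrow> Sym(W)\<close> is given by a linear map
  of the free spaces mapping \<open>sym_rel V\<close> into \<open>sym_rel W\<close> (every linear map of the
  quotients has such a lift), with equality of maps understood pointwise modulo
  \<open>sym_rel W\<close>.\<close>

definition fscale :: "'k::field \<Rightarrow> ('x \<Rightarrow>\<^sub>0 'k) \<Rightarrow> ('x \<Rightarrow>\<^sub>0 'k)" where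
  "fscale c = Poly_Mapping.map ((*) c)"

abbreviation mon :: "'x \<Rightarrow> ('x \<Rightarrow>\<^sub>0 'k::field)" where
  "mon x \<equiv> Poly_Mapping.single x 1"

definition lin_ext :: "('x \<Rightarrow> ('y \<Rightarrow>\<^sub>0 'k)) \<Rightarrow> ('x \<Rightarrow>\<^sub>0 'k::field) \<Rightarrow> ('y \<Rightarrow>\<^sub>0 'k)" where
  "lin_ext f t = (\<Sum>x\<in>Poly_Mapping.keys t. fscale (Poly_Mapping.lookup t x) (f x))"

definition sym_rel ::
  "('k::field, 'a::ab_group_add, 'm) gspace_scheme \<Rightarrow> ('a list \<Rightarrow>\<^sub>0 'k) set" where
  "sym_rel V = module.span fscale
     ({mon (us @ (x + y) # vs) - mon (us @ x # vs) - mon (us @ y # vs) | us x y vs. True} \<union>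
      {mon (us @ smul V c x # vs) - fscale c (mon (us @ x # vs)) | us c x vs. True} \<union>
      {mon (us @ x # y # vs) - fscale ((-1) powi (m * n)) (mon (us @ y # x # vs))
         | us x y vs m n. x \<in> grade V m \<and> y \<in> grade V n})"

definition sym_eq ::
  "('k::field, 'a::ab_group_add, 'm) gspace_scheme \<Rightarrow>
   ('a list \<Rightarrow>\<^sub>0 'k) \<Rightarrow> ('a list \<Rightarrow>\<^sub>0 'k) \<Rightarrow> bool" where
  "sym_eq V s t \<longleftrightarrow> s - t \<in> sym_rel V"

definition sym_linear ::
  "('k::field, 'a::ab_group_add, 'm) gspace_scheme \<Rightarrow>
   ('k, 'b::ab_group_add, 'n) gspace_scheme \<Rightarrow>
   (('a list \<Rightarrow>\<^sub>0 'k) \<Rightarrow> ('b list \<Rightarrow>\<^sub>0 'k)) \<Rightarrow> bool" where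
  "sym_linear V W F \<longleftrightarrow>
     Vector_Spaces.linear fscale fscale F \<and> F ` sym_rel V \<subseteq> sym_rel W"

text \<open>Preimage in the free space of the homogeneous elements of degree \<open>n\<close> of \<open>Sym(V)\<close>.\<close>

definition sym_grade ::
  "('k::field, 'a::ab_group_add, 'm) gspace_scheme \<Rightarrow> int \<Rightarrow> ('a list \<Rightarrow>\<^sub>0 'k) set" where
  "sym_grade V n = module.span fscale
     (sym_rel V \<union>
      {mon xs | xs ds. list_all2 (\<lambda>d x. x \<in> grade V d) ds xs \<and> sum_list ds = n})"

text \<open>
  Formulas involving Koszul signs are stated for homogeneous factors. \<open>hom_expand V f\<close>
  is the multilinear extension of such a formula \<open>f ds xs\<close> (\<open>ds\<close> the list of degrees of the
  homogeneous vectors \<open>xs\<close>) to words in arbitrary vectors.\<close>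

definition hom_expand ::
  "('k, 'a::ab_group_add, 'm) gspace_scheme \<Rightarrow>
   (int list \<Rightarrow> 'a list \<Rightarrow> 'c::comm_monoid_add) \<Rightarrow> 'a list \<Rightarrow> 'c" where
  "hom_expand V f xs =
     (\<Sum>ds\<in>listset (map (\<lambda>x. {n. hcomp V n x \<noteq> 0}) xs). f ds (map2 (hcomp V) ds xs))"

text \<open>Shuffles permute \<open>{0, \<dots>, p + q - 1}\<close>, positions in words being counted from \<open>0\<close>.\<close>

definition Sh :: "nat \<Rightarrow> nat \<Rightarrow> (nat \<Rightarrow> nat) set" where
  "Sh p q = {\<sigma>. \<sigma> permutes {..<p + q} \<and>
                strict_mono_on {..<p} \<sigma> \<and> strict_mono_on {p..<p + q} \<sigma>}"

text \<open>The sign with \<open>x\<^sub>\<sigma>\<^sub>(\<^sub>1\<^sub>) \<or> \<dots> \<or> x\<^sub>\<sigma>\<^sub>(\<^sub>n\<^sub>) = \<epsilon>(\<sigma>) x\<^sub>1 \<or> \<dots> \<or> x\<^sub>n\<close>, \<open>ds\<close> being the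
  degrees of \<open>x\<^sub>1, \<dots>, x\<^sub>n\<close>.\<close>

definition koszul_sign :: "int list \<Rightarrow> (nat \<Rightarrow> nat) \<Rightarrow> 'k::field" where
  "koszul_sign ds \<sigma> =
     (\<Prod>(i, j)\<in>{(i, j). i < j \<and> j < length ds \<and> \<sigma> j < \<sigma> i}.
        (-1) powi (ds ! \<sigma> i * ds ! \<sigma> j))"

subsection \<open>Comultiplication and coalgebra morphisms\<close>

text \<open>\<open>Sym(V) \<otimes> Sym(V)\<close> is likewise the free space on pairs of words modulo
  \<open>sym_rel2 V\<close>.\<close>

definition tens ::
  "('x \<Rightarrow>\<^sub>0 'k::field) \<Rightarrow> ('y \<Rightarrow>\<^sub>0 'k) \<Rightarrow> ('x \<times> 'y \<Rightarrow>\<^sub>0 'k)" where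
  "tens s t = lin_ext (\<lambda>x. lin_ext (\<lambda>y. mon (x, y)) t) s"

definition tens_map ::
  "(('x \<Rightarrow>\<^sub>0 'k) \<Rightarrow> ('z \<Rightarrow>\<^sub>0 'k)) \<Rightarrow> (('y \<Rightarrow>\<^sub>0 'k) \<Rightarrow> ('w \<Rightarrow>\<^sub>0 'k)) \<Rightarrow>
   ('x \<times> 'y \<Rightarrow>\<^sub>0 'k::field) \<Rightarrow> ('z \<times> 'w \<Rightarrow>\<^sub>0 'k)" where
  "tens_map F G = lin_ext (\<lambda>(x, y). tens (F (mon x)) (G (mon y)))"

definition sym_rel2 ::
  "('k::field, 'a::ab_group_add, 'm) gspace_scheme \<Rightarrow> ('a list \<times> 'a list \<Rightarrow>\<^sub>0 'k) set" where
  "sym_rel2 V = module.span fscale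
     ({tens r t | r t. r \<in> sym_rel V} \<union> {tens t r | r t. r \<in> sym_rel V})"

definition comult ::
  "('k::field, 'a::ab_group_add, 'm) gspace_scheme \<Rightarrow>
   ('a list \<Rightarrow>\<^sub>0 'k) \<Rightarrow> ('a list \<times> 'a list \<Rightarrow>\<^sub>0 'k)" where
  "comult V = lin_ext (hom_expand V (\<lambda>ds xs.
     \<Sum>k\<le>length xs. \<Sum>\<sigma>\<in>Sh k (length xs - k).
       fscale (koszul_sign ds \<sigma>)
         (mon (take k (permute_list \<sigma> xs), drop k (permute_list \<sigma> xs)))))"

definition counit :: "('a list \<Rightarrow>\<^sub>0 'k::field) \<Rightarrow> 'k" where
  "counit t = Poly_Mapping.lookup t []"

text \<open>Coalgebra morphisms \<open>Sym(V) \<rightarrow> Sym(W)\<close> of degree \<open>0\<close> with \<open>F(1) = 1\<close>. As \<open>F\<close> has degree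
  \<open>0\<close>, no sign enters in \<open>F \<otimes> F\<close>.\<close>

definition coalg_morphism ::
  "('k::field, 'a::ab_group_add, 'm) gspace_scheme \<Rightarrow>
   ('k, 'b::ab_group_add, 'n) gspace_scheme \<Rightarrow>
   (('a list \<Rightarrow>\<^sub>0 'k) \<Rightarrow> ('b list \<Rightarrow>\<^sub>0 'k)) \<Rightarrow> bool" where
  "coalg_morphism V W F \<longleftrightarrow>
     sym_linear V W F \<and>
     (\<forall>n. F ` sym_grade V n \<subseteq> sym_grade W n) \<and>
     (\<forall>t. comult W (F t) - tens_map F F (comult V t) \<in> sym_rel2 W) \<and>
     (\<forall>t. counit (F t) = counit t) \<and>
     sym_eq W (F (mon [])) (mon [])"

subsection \<open>Components and structure maps\<close>

definition sym_proj :: "nat \<Rightarrow> ('a list \<Rightarrow>\<^sub>0 'k::field) \<Rightarrow> ('a list \<Rightarrow>\<^sub>0 'k)" where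
  "sym_proj n = lin_ext (\<lambda>xs. if length xs = n then mon xs else 0)"

text \<open>The projection of \<open>Sym(V)\<close> onto \<open>Sym\<^sup>1(V) = V\<close>.\<close>

definition cogen ::
  "('k::field, 'a::ab_group_add, 'm) gspace_scheme \<Rightarrow> ('a list \<Rightarrow>\<^sub>0 'k) \<Rightarrow> 'a" where
  "cogen V t = (\<Sum>xs\<in>Poly_Mapping.keys t.
     case xs of [x] \<Rightarrow> smul V (Poly_Mapping.lookup t xs) x | _ \<Rightarrow> 0)"

text \<open>\<open>component F n j\<close> is \<open>F\<^sup>j\<^sub>n\<close>, extended by zero to all of \<open>Sym(V)\<close>, and
  \<open>str_map W F n\<close> is \<open>F\<^sup>1\<^sub>n\<close> with values in \<open>W\<close>.\<close>

definition component ::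
  "(('a list \<Rightarrow>\<^sub>0 'k::field) \<Rightarrow> ('b list \<Rightarrow>\<^sub>0 'k)) \<Rightarrow> nat \<Rightarrow> nat \<Rightarrow>
   ('a list \<Rightarrow>\<^sub>0 'k) \<Rightarrow> ('b list \<Rightarrow>\<^sub>0 'k)" where
  "component F n j t = sym_proj j (F (sym_proj n t))"

definition str_map ::
  "('k::field, 'b::ab_group_add, 'n) gspace_scheme \<Rightarrow>
   (('a list \<Rightarrow>\<^sub>0 'k) \<Rightarrow> ('b list \<Rightarrow>\<^sub>0 'k)) \<Rightarrow> nat \<Rightarrow> ('a list \<Rightarrow>\<^sub>0 'k) \<Rightarrow> 'b" where
  "str_map W F n t = cogen W (F (sym_proj n t))"

abbreviation first_map ::
  "('k::field, 'b::ab_group_add, 'n) gspace_scheme \<Rightarrow>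
   (('a list \<Rightarrow>\<^sub>0 'k) \<Rightarrow> ('b list \<Rightarrow>\<^sub>0 'k)) \<Rightarrow> 'a \<Rightarrow> 'b" where
  "first_map W F x \<equiv> str_map W F 1 (mon [x])"

section \<open>The codifferential of a DGLA and \<open>L\<^sub>\<infinity>\<close>-morphisms\<close>

text \<open>\<open>Q\<^sup>1\<^sub>n\<close> on homogeneous vectors; the \<open>ds\<close> are degrees in \<open>L[1]\<close>.\<close>

definition Q_str ::
  "('k::field, 'a::ab_group_add, 'm) dgla_data_scheme \<Rightarrow> int list \<Rightarrow> 'a list \<Rightarrow> 'a" where
  "Q_str L ds xs =
     (if length xs = 1 then - diff L (xs ! 0)
      else if length xs = 2 then smul L (- ((-1) powi (ds ! 0))) (bracket L (xs ! 0) (xs ! 1))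
      else 0)"

definition Q_comp ::
  "('k::field, 'a::ab_group_add, 'm) dgla_data_scheme \<Rightarrow> nat \<Rightarrow> nat \<Rightarrow>
   int list \<Rightarrow> 'a list \<Rightarrow> ('a list \<Rightarrow>\<^sub>0 'k)" where
  "Q_comp L n j ds xs =
     (\<Sum>\<sigma>\<in>Sh (n + 1 - j) (j - 1).
        let ds' = permute_list \<sigma> ds; xs' = permute_list \<sigma> xs; m = n + 1 - j in
        fscale (koszul_sign ds \<sigma>) (mon (Q_str L (take m ds') (take m xs') # drop m xs')))"

definition codiff ::
  "('k::field, 'a::ab_group_add, 'm) dgla_data_scheme \<Rightarrow>
   ('a list \<Rightarrow>\<^sub>0 'k) \<Rightarrow> ('a list \<Rightarrow>\<^sub>0 'k)" where
  "codiff L = lin_ext (hom_expand (shift L) (\<lambda>ds xs.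
     \<Sum>j = 1..length xs. Q_comp L (length xs) j ds xs))"

definition Linf_morphism ::
  "('k::field, 'a::ab_group_add, 'm) dgla_data_scheme \<Rightarrow>
   ('k, 'b::ab_group_add, 'n) dgla_data_scheme \<Rightarrow>
   (('a list \<Rightarrow>\<^sub>0 'k) \<Rightarrow> ('b list \<Rightarrow>\<^sub>0 'k)) \<Rightarrow> bool" where
  "Linf_morphism L M F \<longleftrightarrow>
     coalg_morphism (shift L) (shift M) F \<and>
     (\<forall>t. sym_eq (shift M) (F (codiff L t)) (codiff M (F t)))"

definition Linf_quasi_iso ::
  "('k::field, 'a::ab_group_add, 'm) dgla_data_scheme \<Rightarrow>
   ('k, 'b::ab_group_add, 'n) dgla_data_scheme \<Rightarrow>
   (('a list \<Rightarrow>\<^sub>0 'k) \<Rightarrow> ('b list \<Rightarrow>\<^sub>0 'k)) \<Rightarrow> bool" where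
  "Linf_quasi_iso L M F \<longleftrightarrow>
     Linf_morphism L M F \<and> quasi_iso (shift L) (shift M) (first_map (shift M) F)"

text \<open>\<open>G\<close> is an \<open>L\<^sub>\<infinity>\<close>-quasi-inverse of the \<open>L\<^sub>\<infinity>\<close>-quasi-isomorphism \<open>F\<close> from \<open>L\<close> to \<open>M\<close>.\<close>

definition Linf_quasi_inverse ::
  "('k::field, 'a::ab_group_add, 'm) dgla_data_scheme \<Rightarrow>
   ('k, 'b::ab_group_add, 'n) dgla_data_scheme \<Rightarrow>
   (('a list \<Rightarrow>\<^sub>0 'k) \<Rightarrow> ('b list \<Rightarrow>\<^sub>0 'k)) \<Rightarrow>
   (('b list \<Rightarrow>\<^sub>0 'k) \<Rightarrow> ('a list \<Rightarrow>\<^sub>0 'k)) \<Rightarrow> bool" where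
  "Linf_quasi_inverse L M F G \<longleftrightarrow>
     Linf_quasi_iso L M F \<and> Linf_quasi_iso M L G \<and>
     (\<forall>n. (\<forall>c\<in>cohomology (shift L) n.
             cohomology_map (shift L) n (first_map (shift L) G)
               (cohomology_map (shift M) n (first_map (shift M) F) c) = c) \<and>
          (\<forall>c\<in>cohomology (shift M) n.
             cohomology_map (shift M) n (first_map (shift M) F)
               (cohomology_map (shift L) n (first_map (shift L) G) c) = c))"

text \<open>The \<open>L\<^sub>\<infinity>\<close>-morphism \<open>x\<^sub>1 \<or> \<dots> \<or> x\<^sub>n \<mapsto> f x\<^sub>1 \<or> \<dots> \<or> f x\<^sub>n\<close> associated with a DGLA
  morphism \<open>f\<close>; by the lemmas below its first structure map is \<open>f\<close> and the others vanish.\<close>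

definition strict_Linf :: "('a \<Rightarrow> 'b) \<Rightarrow> ('a list \<Rightarrow>\<^sub>0 'k::field) \<Rightarrow> ('b list \<Rightarrow>\<^sub>0 'k)" where
  "strict_Linf f = lin_ext (\<lambda>xs. mon (map f xs))"

lemma lookup_fscale [simp]:
  "Poly_Mapping.lookup (fscale c t) x = c * Poly_Mapping.lookup t x"
  by (simp add: fscale_def map.rep_eq when_def)

lemma vector_space_fscale: "vector_space fscale"
  by unfold_locales (auto intro!: poly_mapping_eqI simp: lookup_add algebra_simps)

lemma lin_ext_mon [simp]: "lin_ext f (mon x) = f x"
  using vector_space.vector_space_assms(4)[OF vector_space_fscale] by (simp add: lin_ext_def)

lemma sym_proj_mon: "sym_proj n (mon xs) = (if length xs = n then mon xs else 0)"
  by (simp add: sym_proj_def)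

lemma str_map_strict_Linf_1:
  assumes "vector_space (smul W)"
  shows "str_map W (strict_Linf f) 1 (mon [x]) = f x"
  using vector_space.vector_space_assms(4)[OF assms]
  by (simp add: str_map_def sym_proj_mon strict_Linf_def cogen_def)

lemma str_map_strict_Linf_other:
  assumes "n \<noteq> 1"
  shows "str_map W (strict_Linf f) n (mon xs) = 0"
proof (cases "length xs = n")
  case True
  then have "str_map W (strict_Linf f) n (mon xs) = cogen W (mon (map f xs))"
    by (simp add: str_map_def sym_proj_mon strict_Linf_def)
  also have "\<dots> = 0"
    using True assms by (cases "map f xs" rule: remdups_adj.cases) (auto simp: cogen_def)
  finally show ?thesis .
next
  case False
  then show ?thesis
    by (simp add: str_map_def sym_proj_mon strict_Linf_def lin_ext_def cogen_def)
qed

section \<open>The recursion\<close>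

text \<open>\<open>Linf_defect A B I k\<close> is \<open>L\<^sub>\<infinity>\<^sub>,\<^sub>k = Q\<^sup>1\<^sub>B\<^sub>,\<^sub>2 \<circ> I\<^sup>2\<^sub>k - I\<^sup>1\<^sub>k\<^sub>-\<^sub>1 \<circ> Q\<^sup>k\<^sup>-\<^sup>1\<^sub>A\<^sub>,\<^sub>k\<close>.\<close>

definition Linf_defect ::
  "('k::field, 'a::ab_group_add, 'm) dgla_data_scheme \<Rightarrow>
   ('k, 'b::ab_group_add, 'n) dgla_data_scheme \<Rightarrow>
   (('a list \<Rightarrow>\<^sub>0 'k) \<Rightarrow> ('b list \<Rightarrow>\<^sub>0 'k)) \<Rightarrow> nat \<Rightarrow> ('a list \<Rightarrow>\<^sub>0 'k) \<Rightarrow> 'b" where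
  "Linf_defect A B I k t =
     str_map (shift B) (codiff B) 2 (component I k 2 t)
     - str_map (shift B) I (k - 1) (component (codiff A) k (k - 1) t)"

text \<open>\<open>I\<close> is a coalgebra morphism with \<open>I\<^sup>1\<^sub>1 = i\<close> and \<open>I\<^sup>1\<^sub>k = h \<circ> L\<^sub>\<infinity>\<^sub>,\<^sub>k\<close> for \<open>k \<ge> 2\<close>.\<close>

definition transferred ::
  "('k::field, 'a::ab_group_add, 'm) dgla_data_scheme \<Rightarrow>
   ('k, 'b::ab_group_add, 'n) dgla_data_scheme \<Rightarrow> ('a \<Rightarrow> 'b) \<Rightarrow> ('b \<Rightarrow> 'b) \<Rightarrow>
   (('a list \<Rightarrow>\<^sub>0 'k) \<Rightarrow> ('b list \<Rightarrow>\<^sub>0 'k)) \<Rightarrow> bool" where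
  "transferred A B i h I \<longleftrightarrow>
     coalg_morphism (shift A) (shift B) I \<and>
     (\<forall>x. first_map (shift B) I x = i x) \<and>
     (\<forall>k\<ge>2. \<forall>t. str_map (shift B) I k t = h (Linf_defect A B I k t))"

end

theory Submission
  imports Defs
begin

text \<open>
  A homogeneous word is a list of pairs (degree, vector); the unshuffle coproduct of words is
  the signed sum \<open>spsum w g\<close>, which is exactly coassociative and cocommutative before
  any relations of \<open>Sym(V)\<close> are imposed. Elements of \<open>Sym\<close> are only ever tested against functions
  of words that are multilinear and graded symmetric, so congruences become equations.

  Since \<open>h \<circ> h = 0\<close> and \<open>h \<circ> i = 0\<close>, the structure maps \<open>f\<close> of \<open>I\<close> solve \<open>f = i + h \<circ> S\<close> with
  \<open>S = \<onehalf> Q\<^sup>1\<^sub>2 \<circ> (f * f)\<close> (convolution product). That \<open>I\<close> is an \<open>L\<^sub>\<infinity>\<close>-morphism is the vanishing of the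
  curvature \<open>c = - d \<circ> f + S - f \<circ> Q\<close>, a Maurer-Cartan equation in the convolution DGLA. The side
  conditions give \<open>h \<circ> c = 0\<close>, and \<open>p \<circ> c = 0\<close> because \<open>p\<close> is strict, hence \<open>c = h \<circ> d \<circ> c\<close>. The
  Leibniz rule and the Jacobi identity (a Bianchi identity for \<open>c\<close>) turn the right-hand side
  into \<open>h\<close> of brackets \<open>[c(u), f(v)]\<close> with \<open>u\<close> shorter than the given word, so \<open>c = 0\<close> by induction on
  the length; \<open>Q \<circ> Q = 0\<close> is not used since \<open>h \<circ> f = 0\<close>.
\<close>

section \<open>Signs\<close>

text \<open>The proof rests on two separate bridges between words and maps on \<open>Sym\<close>.
  Existence: a morphism is assembled from its structure maps as a sum over set partitions with
  blocks ordered by their first letters, so no factor 1/j! appears and the identities reduce to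
  coassociativity and cocommutativity of unshuffles. Compatibility with \<open>Q\<close> then needs
  to be tested only after projection to the cogenerators, which is where the curvature
  \<open>c\<close> comes from. Uniqueness: an arbitrary lift comes with no such formula; its higher
  components are recovered from the comultiplication, at the price of dividing by integers. The
  other divisions are counting factors: 1/2 compensates for ordered pairs of blocks, and 1/3
  reflects that the three terms of the Jacobi identity have the same total sum. A recurrent obstacle
  is that the zero vector lies in every degree and that linearity only holds degree by degree; hence
  the degree labels in words, and the use of \<open>hcomp\<close> to make a map given on one graded
  piece linear everywhere.\<close>

definition sg :: "int \<Rightarrow> 'c::ab_group_add \<Rightarrow> 'c" where
  "sg n x = (if even n then x else - x)"

lemma sg_0 [simp]: "sg 0 x = x" and sg_zero [simp]: "sg n 0 = 0"
  and sg_sg [simp]: "sg m (sg n x) = sg (m + n) x"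
  and sg_add: "sg n (x + y) = sg n x + sg n y"
  and sg_eq_0_iff [simp]: "sg n x = 0 \<longleftrightarrow> x = 0"
  by (auto simp: sg_def)

lemma sg_parity: "(even m \<longleftrightarrow> even n) \<Longrightarrow> sg m x = sg n x"
  by (simp add: sg_def)

lemma sg_sum: "sg n (sum f S) = (\<Sum>x\<in>S. sg n (f x))"
  by (simp add: sg_def sum_negf)

lemma sg_commute_additive: "Modules.additive f \<Longrightarrow> f (sg n x) = sg n (f x)"
  by (simp add: sg_def Modules.additive.minus)

lemma scale_powi_minus_one: "vector_space s \<Longrightarrow> s ((-1) powi n) x = sg n x"
  by (cases "even n") (simp_all add: sg_def vector_space.vector_space_assms(4) module.scale_minus_left
      module_iff_vector_space power_int_minus_left)

lemma additive_linear: "Vector_Spaces.linear s1 s2 f \<Longrightarrow> Modules.additive f"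
  by (simp add: Modules.additive_def linear_iff_module_hom module_hom.add)

lemma linear_sg: "Vector_Spaces.linear s1 s2 f \<Longrightarrow> f (sg n x) = sg n (f x)"
  by (simp add: additive_linear sg_commute_additive)

section \<open>Signed sums over unshuffles\<close>

type_synonym 'a gword = "(int \<times> 'a) list"

definition wt :: "'a gword \<Rightarrow> int" where
  "wt w = sum_list (map fst w)"

lemma wt_simps [simp]: "wt [] = 0" "wt (x # w) = fst x + wt w" "wt (u @ v) = wt u + wt v"
  by (simp_all add: wt_def)

text \<open>The coproduct in continuation style: \<open>g\<close> receives both halves, so values
  may lie in any abelian group and no tensor product is formed. The leading letter stays left, or
  passes the whole left half \<open>u\<close> at the cost of the Koszul sign
  \<open>fst x * wt u\<close>.\<close>

primrec spsum :: "'a gword \<Rightarrow> ('a gword \<Rightarrow> 'a gword \<Rightarrow> 'c::ab_group_add) \<Rightarrow> 'c" where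
  "spsum [] g = g [] []"
| "spsum (x # w) g = spsum w (\<lambda>u v. g (x # u) v) + spsum w (\<lambda>u v. sg (fst x * wt u) (g u (x # v)))"

lemma spsum_cong_strong:
  assumes "\<And>u v. \<lbrakk>length u + length v = length w; wt u + wt v = wt w; set u \<union> set v = set w\<rbrakk> \<Longrightarrow> g u v = g' u v"
  shows "spsum w g = spsum w g'"
  using assms
proof (induction w arbitrary: g g')
  case (Cons x w)
  have "spsum w (\<lambda>u v. g (x # u) v) = spsum w (\<lambda>u v. g' (x # u) v)"
    by (rule Cons.IH) (auto intro!: Cons.prems)
  moreover have "spsum w (\<lambda>u v. sg (fst x * wt u) (g u (x # v))) = spsum w (\<lambda>u v. sg (fst x * wt u) (g' u (x # v)))"
    by (rule Cons.IH) (auto intro!: Cons.prems arg_cong[of _ _ "sg _"])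
  ultimately show ?case by simp
qed simp

text \<open>The length information reaches the termination proofs of \<open>esum\<close> and
  \<open>tree_map\<close>, which recurse on the halves inside \<open>spsum\<close>.\<close>

lemma spsum_cong [fundef_cong]:
  assumes "w = w'" "\<And>u v. length u + length v = length w' \<Longrightarrow> g u v = g' u v"
  shows "spsum w g = spsum w' g'"
  unfolding \<open>w = w'\<close> by (rule spsum_cong_strong) (use assms in auto)

lemma spsum_add: "spsum w (\<lambda>u v. g u v + g' u v) = spsum w g + spsum w g'"
  by (induction w arbitrary: g g') (simp_all add: sg_add algebra_simps)

lemma spsum_zero [simp]: "spsum w (\<lambda>u v. 0) = 0"
  by (induction w) simp_all

lemma additive_spsum:
  assumes "Modules.additive f"
  shows "f (spsum w g) = spsum w (\<lambda>u v. f (g u v))"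
  by (induction w arbitrary: g)
    (simp_all add: Modules.additive.add[OF assms] sg_commute_additive[OF assms])

lemma additive_sg: "Modules.additive (sg n)"
  by (simp add: Modules.additive_def sg_add)

lemma spsum_sg: "spsum w (\<lambda>u v. sg n (g u v)) = sg n (spsum w g)"
  by (simp add: additive_spsum[OF additive_sg])

lemma spsum_minus: "spsum w (\<lambda>u v. - g u v) = - spsum w g"
  using spsum_sg[of w 1 g] by (simp add: sg_def)

lemma spsum_diff: "spsum w (\<lambda>u v. g u v - g' u v) = spsum w g - spsum w g'"
  using spsum_add[of w g "\<lambda>u v. - g' u v"] by (simp add: spsum_minus)

text \<open>\<open>\<phi>\<close> only has to respect pointwise sums; compatibility with negation,
  hence with all signs, follows. This is the rule for exchanging \<open>spsum\<close> with a sum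
  over another variable.\<close>

lemma spsum_functional:
  assumes add: "\<And>a b. \<phi> (\<lambda>s. a s + b s) = \<phi> a + (\<phi> b :: 'c::ab_group_add)"
  shows "\<phi> (\<lambda>s. spsum w (g s)) = spsum w (\<lambda>u v. \<phi> (\<lambda>s. (g s u v :: 'd::ab_group_add)))"
proof -
  have z: "\<phi> (\<lambda>s. 0) = 0"
    using add[of "\<lambda>s. 0" "\<lambda>s. 0"] by simp
  have neg: "\<phi> (\<lambda>s. - a s) = - \<phi> a" for a
    using add[of a "\<lambda>s. - a s"] by (simp add: z eq_neg_iff_add_eq_0 add.commute)
  have sg: "\<phi> (\<lambda>s. sg n (a s)) = sg n (\<phi> a)" for a n
    by (simp add: sg_def neg)
  show ?thesis
    by (induction w arbitrary: g) (simp_all add: add sg)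
qed

lemma spsum_coassoc:
  "spsum w (\<lambda>s t. spsum s (\<lambda>u v. g u v t)) = spsum w (\<lambda>u s. spsum s (\<lambda>v t. g u v t))"
proof (induction w arbitrary: g)
  case (Cons x w)
  have "spsum (x # w) (\<lambda>s t. spsum s (\<lambda>u v. g u v t)) =
      spsum w (\<lambda>s t. spsum s (\<lambda>u v. g (x # u) v t)) +
      spsum w (\<lambda>s t. spsum s (\<lambda>u v. sg (fst x * wt u) (g u (x # v) t))) +
      spsum w (\<lambda>s t. spsum s (\<lambda>u v. sg (fst x * wt s) (g u v (x # t))))"
    by (simp add: spsum_add spsum_sg)
  \<comment> \<open>A letter that passes \<open>s\<close> passes both halves of \<open>s\<close>,
    whose weights add up to \<open>wt s\<close>.\<close>
  also have "spsum w (\<lambda>s t. spsum s (\<lambda>u v. sg (fst x * wt s) (g u v (x # t)))) =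
      spsum w (\<lambda>s t. spsum s (\<lambda>u v. sg (fst x * (wt u + wt v)) (g u v (x # t))))"
    by (rule spsum_cong_strong) (auto intro!: spsum_cong_strong)
  finally show ?case
    by (simp add: Cons.IH spsum_add sg_add algebra_simps flip: spsum_sg)
qed simp

lemma spsum_cocomm: "spsum w g = spsum w (\<lambda>u v. sg (wt u * wt v) (g v u))"
proof (induction w arbitrary: g)
  case (Cons x w)
  have "spsum (x # w) (\<lambda>u v. sg (wt u * wt v) (g v u)) =
     spsum w (\<lambda>u v. sg ((fst x + wt u) * wt v) (g v (x # u))) +
     spsum w (\<lambda>u v. sg (fst x * wt u + wt u * (fst x + wt v)) (g (x # v) u))"
    by simp
  also have "(\<lambda>u v. sg (fst x * wt u + wt u * (fst x + wt v)) (g (x # v) u)) =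
      (\<lambda>u v. sg (wt u * wt v) (g (x # v) u))"
    by (intro ext sg_parity) auto
  also have "spsum w (\<lambda>u v. sg ((fst x + wt u) * wt v) (g v (x # u))) =
      spsum w (\<lambda>u v. sg ((fst x + wt v) * wt u + wt u * wt v) (g u (x # v)))"
    by (subst Cons.IH) (simp add: algebra_simps)
  also have "(\<lambda>u v. sg ((fst x + wt v) * wt u + wt u * wt v) (g u (x # v))) = (\<lambda>u v. sg (fst x * wt u) (g u (x # v)))"
    by (intro ext sg_parity) auto
  finally show ?case
    using Cons.IH[of "\<lambda>u v. g (x # u) v"] by (simp add: add.commute)
qed simp

lemma spsum_swap_right:
  "spsum w (\<lambda>u s. spsum s (\<lambda>v t. g u v t)) =
     spsum w (\<lambda>u s. spsum s (\<lambda>v t. sg (wt v * wt t) (g u t v)))"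
  by (intro spsum_cong[OF refl] spsum_cocomm)

lemma spsum_swap_left:
  "spsum w (\<lambda>u s. spsum s (\<lambda>v t. g u v t)) =
     spsum w (\<lambda>u s. spsum s (\<lambda>v t. sg (wt u * wt v) (g v u t)))"
proof -
  have "spsum w (\<lambda>s t. spsum s (\<lambda>u v. g u v t)) =
      spsum w (\<lambda>s t. spsum s (\<lambda>u v. sg (wt u * wt v) (g v u t)))"
    by (intro spsum_cong[OF refl] spsum_cocomm)
  then show ?thesis
    by (simp only: spsum_coassoc)
qed

text \<open>Counit law: once a letter has gone right, the right half stays nonempty, so only the
  split with everything on the left survives.\<close>

lemma spsum_right_Nil: "spsum w (\<lambda>u v. if v = [] then g u else 0) = g w"
proof (induction w arbitrary: g)
  case (Cons x w)
  then show ?case by simp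
qed simp

lemma spsum_left_Nil: "spsum w (\<lambda>u v. if u = [] then g v else 0) = g w"
proof -
  have "spsum w (\<lambda>u v. if u = [] then g v else 0) =
      spsum w (\<lambda>u v. sg (wt u * wt v) (if v = [] then g u else 0))"
    by (rule spsum_cocomm)
  also have "\<dots> = spsum w (\<lambda>u v. if v = [] then g u else 0)"
    by (rule spsum_cong) simp_all
  finally show ?thesis
    by (simp only: spsum_right_Nil)
qed

lemma spsum_map:
  assumes "\<And>x. fst (\<phi> x) = fst x"
  shows "spsum (map \<phi> w) g = spsum w (\<lambda>u v. g (map \<phi> u) (map \<phi> v))"
proof -
  have "wt (map \<phi> u) = wt u" for u
    by (induction u) (simp_all add: assms)
  then show ?thesis
    by (induction w arbitrary: g) (simp_all add: assms)
qed

section \<open>Shuffles\<close>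

text \<open>A shuffle \<open>\<sigma>\<close> is encoded by the set \<open>S = \<sigma> ` {..<k}\<close> of the positions of the first \<open>k\<close> letters.\<close>

definition ksign :: "int list \<Rightarrow> nat set \<Rightarrow> int" where
  "ksign ds S = (\<Sum>(a, b)\<in>{(a, b). b < a \<and> a < length ds \<and> a \<in> S \<and> b \<notin> S}. ds ! a * ds ! b)"

lemma finite_pairs_below: "finite {(a, b). b < a \<and> a < (n::nat) \<and> P a b}"
  by (rule finite_subset[of _ "{..<n} \<times> {..<n}"]) auto

lemma ksign_Cons_in: "ksign (d # ds) (insert 0 (Suc ` T)) = ksign ds T"
proof -
  have "{(a, b). b < a \<and> a < length (d # ds) \<and> a \<in> insert 0 (Suc ` T) \<and> b \<notin> insert 0 (Suc ` T)} =
      map_prod Suc Suc ` {(a, b). b < a \<and> a < length ds \<and> a \<in> T \<and> b \<notin> T}"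
    (is "?L = ?R")
  proof
    show "?L \<subseteq> ?R"
    proof (rule subrelI)
      fix a b assume "(a, b) \<in> ?L"
      then show "(a, b) \<in> ?R"
        by (cases a; cases b) (auto intro: image_eqI[of _ _ "(a - 1, b - 1)"])
    qed
  qed auto
  then have "ksign (d # ds) (insert 0 (Suc ` T)) =
      (\<Sum>(a, b)\<in>map_prod Suc Suc ` {(a, b). b < a \<and> a < length ds \<and> a \<in> T \<and> b \<notin> T}. (d # ds) ! a * (d # ds) ! b)"
    by (simp add: ksign_def)
  also have "\<dots> = ksign ds T"
    unfolding ksign_def by (subst sum.reindex) (auto simp: inj_on_def case_prod_unfold)
  finally show ?thesis .
qed

text \<open>A leading letter outside the chosen set forms one inversion with every chosen position.
  Their total exponent is \<open>d\<close> times the degree of the chosen block, which is the sign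
  in the second branch of \<open>spsum\<close>.\<close>

lemma ksign_Cons_notin:
  assumes "T \<subseteq> {..<length ds}"
  shows "ksign (d # ds) (Suc ` T) = ksign ds T + d * (\<Sum>a\<in>T. ds ! a)"
proof -
  let ?P = "{(a, b). b < a \<and> a < length ds \<and> a \<in> T \<and> b \<notin> T}"
  let ?Q = "(\<lambda>a. (Suc a, 0::nat)) ` T"
  let ?h = "\<lambda>(a, b). (d # ds) ! a * (d # ds) ! b"
  have "{(a, b). b < a \<and> a < length (d # ds) \<and> a \<in> Suc ` T \<and> b \<notin> Suc ` T} = map_prod Suc Suc ` ?P \<union> ?Q" (is "?L = ?R")
  proof
    show "?L \<subseteq> ?R"
    proof clarify
      fix b a assume *: "b < Suc a" "Suc a < length (d # ds)" "a \<in> T" "b \<notin> Suc ` T" "(Suc a, b) \<notin> ?Q"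
      then obtain c where c: "b = Suc c" by (cases b) auto
      then have "(a, c) \<in> ?P" using * by auto
      then show "(Suc a, b) \<in> map_prod Suc Suc ` ?P" using c by (auto intro: image_eqI[of _ _ "(a, c)"])
    qed
  qed (use assms in auto)
  then have "ksign (d # ds) (Suc ` T) = sum ?h (map_prod Suc Suc ` ?P \<union> ?Q)"
    by (simp add: ksign_def)
  also have "\<dots> = sum ?h (map_prod Suc Suc ` ?P) + sum ?h ?Q"
    using finite_subset[OF assms] finite_pairs_below[of "length ds" "\<lambda>a b. a \<in> T \<and> b \<notin> T"]
    by (intro sum.union_disjoint) auto
  also have "sum ?h (map_prod Suc Suc ` ?P) = ksign ds T"
    unfolding ksign_def by (subst sum.reindex) (auto simp: inj_on_def case_prod_unfold)
  also have "sum ?h ?Q = d * (\<Sum>a\<in>T. ds ! a)"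
    by (subst sum.reindex) (auto simp: inj_on_def sum_distrib_left mult.commute)
  finally show ?thesis .
qed

lemma wt_nths: "wt (nths w T) = (\<Sum>a | a \<in> T \<and> a < length w. map fst w ! a)"
proof (induction w arbitrary: T)
  case (Cons x w)
  let ?T = "{j. Suc j \<in> T}"
  have "{a. a \<in> T \<and> a < length (x # w)} = (if 0 \<in> T then {0} else {}) \<union> Suc ` {a. a \<in> ?T \<and> a < length w}"
    (is "?L = ?R")
  proof (rule set_eqI)
    show "a \<in> ?L \<longleftrightarrow> a \<in> ?R" for a by (cases a) auto
  qed
  then have "(\<Sum>a | a \<in> T \<and> a < length (x # w). map fst (x # w) ! a) =
      (if 0 \<in> T then fst x else 0) + (\<Sum>a\<in>Suc ` {a. a \<in> ?T \<and> a < length w}. map fst (x # w) ! a)"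
    by (auto simp: sum.union_disjoint)
  also have "(\<Sum>a\<in>Suc ` {a. a \<in> ?T \<and> a < length w}. map fst (x # w) ! a) = (\<Sum>a | a \<in> ?T \<and> a < length w. map fst w ! a)"
    by (subst sum.reindex) auto
  finally show ?case
    by (simp add: Cons nths_Cons)
qed simp

lemma subset_Suc_cases:
  obtains T where "S = insert 0 (Suc ` T)" | T where "S = Suc ` T"
proof (cases "0 \<in> S")
  case True
  have "S = insert 0 (Suc ` {j. Suc j \<in> S})" (is "_ = ?R")
  proof (rule set_eqI)
    show "x \<in> S \<longleftrightarrow> x \<in> ?R" for x using True by (cases x) auto
  qed
  then show ?thesis by (rule that(1))
next
  case False
  have "S = Suc ` {j. Suc j \<in> S}" (is "_ = ?R")
  proof (rule set_eqI)
    show "x \<in> S \<longleftrightarrow> x \<in> ?R" for x using False by (cases x) auto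
  qed
  then show ?thesis by (rule that(2))
qed

lemma Pow_lessThan_Suc: "Pow {..<Suc n} = (\<lambda>T. insert 0 (Suc ` T)) ` Pow {..<n} \<union> (image Suc) ` Pow {..<n}"
proof (intro set_eqI iffI)
  fix S assume S: "S \<in> Pow {..<Suc n}"
  show "S \<in> (\<lambda>T. insert 0 (Suc ` T)) ` Pow {..<n} \<union> (image Suc) ` Pow {..<n}"
    by (rule subset_Suc_cases[of S]) (use S in \<open>auto simp: image_subset_iff\<close>)
qed auto

text \<open>Unfolding the recursion records, for each summand, the set of positions sent to the left
  half. This connects \<open>spsum\<close> with the sums over \<open>Sh\<close> in the definitions
  of the coproduct and the codifferential.\<close>

lemma spsum_subsets:
  "spsum w g = (\<Sum>S\<in>Pow {..<length w}. sg (ksign (map fst w) S) (g (nths w S) (nths w (- S))))"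
proof (induction w arbitrary: g)
  case Nil
  then show ?case by (simp add: ksign_def)
next
  case (Cons x w)
  let ?n = "length w"
  let ?F = "\<lambda>S. sg (ksign (map fst (x # w)) S) (g (nths (x # w) S) (nths (x # w) (- S)))"
  have inj: "inj_on (\<lambda>T. insert 0 (Suc ` T)) (Pow {..<?n})" "inj_on (image Suc) (Pow {..<?n})"
    by (intro inj_onI, simp add: insert_ident inj_image_eq_iff)+
  have 1: "?F (insert 0 (Suc ` T)) = sg (ksign (map fst w) T) (g (x # nths w T) (nths w (- T)))" for T
  proof -
    have "{j. Suc j \<notin> Suc ` T} = - T" "{j. Suc j \<in> Suc ` T} = T" by auto
    then show ?thesis using ksign_Cons_in[of "fst x" "map fst w" T] by (simp add: nths_Cons Compl_eq)
  qed
  have 2: "?F (Suc ` T) = sg (ksign (map fst w) T) (sg (fst x * wt (nths w T)) (g (nths w T) (x # nths w (- T))))"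
    if "T \<in> Pow {..<?n}" for T
  proof -
    have "{j. Suc j \<notin> Suc ` T} = - T" "{j. Suc j \<in> Suc ` T} = T" "{a. a \<in> T \<and> a < ?n} = T" using that by auto
    then show ?thesis using that ksign_Cons_notin[of T "map fst w" "fst x"]
      by (simp add: nths_Cons wt_nths Compl_eq)
  qed
  have "sum ?F (Pow {..<length (x # w)}) =
      sum ?F ((\<lambda>T. insert 0 (Suc ` T)) ` Pow {..<?n}) + sum ?F (image Suc ` Pow {..<?n})"
    unfolding length_Cons Pow_lessThan_Suc by (rule sum.union_disjoint) auto
  also have "sum ?F ((\<lambda>T. insert 0 (Suc ` T)) ` Pow {..<?n}) =
      spsum w (\<lambda>u v. g (x # u) v)"
    unfolding sum.reindex[OF inj(1)] Cons.IH by (simp add: 1 del: list.map nths_Cons)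
  also have "sum ?F (image Suc ` Pow {..<?n}) = spsum w (\<lambda>u v. sg (fst x * wt u) (g u (x # v)))"
    unfolding sum.reindex[OF inj(2)] Cons.IH by (intro sum.cong refl) (simp only: 2 o_def)
  finally show ?case by simp
qed


lemma nths_upt_eq_sorted_list:
  assumes "S \<subseteq> {..<n}"
  shows "nths [0..<n] S = sorted_list_of_set S"
proof -
  have "nths [0..<n] S = filter (\<lambda>i. i \<in> S) [0..<n]"
    by (induction n) (simp_all add: nths_append)
  moreover have "sorted_list_of_set (set (filter (\<lambda>i. i \<in> S) [0..<n])) = filter (\<lambda>i. i \<in> S) [0..<n]"
    by (rule sorted_list_of_set.idem_if_sorted_distinct) (simp_all add: sorted_filter[of "\<lambda>x. x", simplified])
  moreover have "set (filter (\<lambda>i. i \<in> S) [0..<n]) = S"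
    using assms by auto
  ultimately show ?thesis
    by simp
qed

lemma nths_eq_map_sorted_list:
  assumes "S \<subseteq> {..<length w}"
  shows "nths w S = map ((!) w) (sorted_list_of_set S)"
  using nths_map[of "(!) w" "[0..<length w]" S] by (simp add: map_nth nths_upt_eq_sorted_list[OF assms])

lemma map_upt_eq_sorted_list:
  assumes "strict_mono_on {a..<b} \<sigma>"
  shows "map \<sigma> [a..<b] = sorted_list_of_set (\<sigma> ` {a..<b})"
proof -
  have "sorted_wrt (\<lambda>x y. \<sigma> x < \<sigma> y) [a..<b]"
    by (rule sorted_wrt_mono_rel[OF _ sorted_wrt_upt]) (use assms in \<open>auto intro: strict_mono_onD\<close>)
  then have "sorted_list_of_set (set (map \<sigma> [a..<b])) = map \<sigma> [a..<b]"
    using strict_sorted_iff[of "map \<sigma> [a..<b]"]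
    by (intro sorted_list_of_set.idem_if_sorted_distinct) (simp_all add: sorted_wrt_map)
  then show ?thesis
    by simp
qed

lemma Sh_image_lessThan:
  assumes "\<sigma> \<in> Sh k m"
  shows "\<sigma> ` {..<k} \<subseteq> {..<k + m}" "card (\<sigma> ` {..<k}) = k" "\<sigma> ` {k..<k + m} = {..<k + m} - \<sigma> ` {..<k}"
proof -
  have p: "\<sigma> permutes {..<k + m}" using assms by (simp add: Sh_def)
  then have inj: "inj \<sigma>" by (rule permutes_inj)
  have "\<sigma> ` {..<k + m} = {..<k + m}" using p by (rule permutes_image)
  moreover have "{k..<k + m} = {..<k + m} - {..<k}" by auto
  ultimately show "\<sigma> ` {k..<k + m} = {..<k + m} - \<sigma> ` {..<k}"
    by (simp only: image_set_diff[OF inj])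
  show "\<sigma> ` {..<k} \<subseteq> {..<k + m}"
    using \<open>\<sigma> ` {..<k + m} = {..<k + m}\<close> by force
  show "card (\<sigma> ` {..<k}) = k"
    using inj by (simp add: card_image inj_on_def)
qed

lemma Sh_sorted_lists:
  assumes "\<sigma> \<in> Sh k m"
  shows "map \<sigma> [0..<k] = sorted_list_of_set (\<sigma> ` {..<k})"
    and "map \<sigma> [k..<k + m] = sorted_list_of_set ({..<k + m} - \<sigma> ` {..<k})"
  using map_upt_eq_sorted_list[of 0 k \<sigma>] map_upt_eq_sorted_list[of k "k + m" \<sigma>] assms
    Sh_image_lessThan(3)[OF assms]
  by (simp_all add: Sh_def lessThan_atLeast0)

lemma nths_Int_lessThan: "length w = n \<Longrightarrow> nths w ({..<n} - S) = nths w (- S)"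
  unfolding nths_def by (intro arg_cong[of _ _ "map fst"] filter_cong refl) (auto dest: set_zip_rightD)

lemma Sh_take_drop_permute_list:
  assumes "\<sigma> \<in> Sh k m" "length w = k + m"
  shows "take k (permute_list \<sigma> w) = nths w (\<sigma> ` {..<k})"
    and "drop k (permute_list \<sigma> w) = nths w (- \<sigma> ` {..<k})"
proof -
  have "nths w (- \<sigma> ` {..<k}) = nths w ({..<k + m} - \<sigma> ` {..<k})"
    by (simp add: nths_Int_lessThan assms(2))
  also have "\<dots> = map ((!) w) (sorted_list_of_set ({..<k + m} - \<sigma> ` {..<k}))"
    using assms(2) by (intro nths_eq_map_sorted_list) auto
  also have "\<dots> = drop k (permute_list \<sigma> w)"
    by (simp add: permute_list_def assms(2) Sh_sorted_lists(2)[OF assms(1), symmetric] drop_map)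
  finally show "drop k (permute_list \<sigma> w) = nths w (- \<sigma> ` {..<k})" by simp
  have "nths w (\<sigma> ` {..<k}) = map ((!) w) (sorted_list_of_set (\<sigma> ` {..<k}))"
    using assms(2) Sh_image_lessThan(1)[OF assms(1)] by (intro nths_eq_map_sorted_list) auto
  then show "take k (permute_list \<sigma> w) = nths w (\<sigma> ` {..<k})"
    by (simp add: permute_list_def assms(2) Sh_sorted_lists(1)[OF assms(1), symmetric] take_map)
qed

lemma prod_powi_minus_one:
  "finite S \<Longrightarrow> (\<Prod>x\<in>S. (-1 :: 'k::field) powi (e x)) = (-1) powi (\<Sum>x\<in>S. e x)"
  by (induction S rule: finite_induct) (simp_all add: power_int_add)

text \<open>A shuffle increases on each of its two blocks, so an inversion always pairs a position
  of the first block with one of the second. Applying \<open>\<sigma>\<close> to both entries turns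
  inversions into the pairs counted by \<open>ksign\<close>.\<close>

lemma koszul_sign_Sh:
  assumes "\<sigma> \<in> Sh k m" "length ds = k + m"
  shows "koszul_sign ds \<sigma> = (-1 :: 'k::field) powi ksign ds (\<sigma> ` {..<k})"
proof -
  let ?S = "\<sigma> ` {..<k}"
  let ?P = "{(i, j). i < j \<and> j < length ds \<and> \<sigma> j < \<sigma> i}"
  let ?Q = "{(a, b). b < a \<and> a < length ds \<and> a \<in> ?S \<and> b \<notin> ?S}"
  have p: "\<sigma> permutes {..<k + m}" and m1: "strict_mono_on {..<k} \<sigma>" and m2: "strict_mono_on {k..<k + m} \<sigma>"
    using assms(1) by (auto simp: Sh_def)
  have inj: "inj \<sigma>" using p by (rule permutes_inj)
  have split: "i < k \<and> k \<le> j" if "i < j" "j < k + m" "\<sigma> j < \<sigma> i" for i j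
  proof (rule ccontr)
    assume "\<not> (i < k \<and> k \<le> j)"
    then consider "j < k" | "k \<le> i" using that by linarith
    then have "\<sigma> i < \<sigma> j"
      using that m1 m2 by cases (auto simp: strict_mono_on_def)
    then show False using that by simp
  qed
  have less: "\<sigma> i < k + m" if "i < k + m" for i
    using permutes_in_image[OF p, of i] that by simp
  have "map_prod \<sigma> \<sigma> ` ?P = ?Q"
  proof (intro set_eqI iffI)
    fix z assume "z \<in> map_prod \<sigma> \<sigma> ` ?P"
    then obtain i j where z: "z = (\<sigma> i, \<sigma> j)" "i < j" "j < k + m" "\<sigma> j < \<sigma> i"
      using assms(2) by auto
    then have "i < k" "k \<le> j" using split by blast+
    then show "z \<in> ?Q"
      using z less[of i] assms(2) by (auto simp: inj_image_mem_iff[OF inj])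
  next
    fix z assume "z \<in> ?Q"
    then obtain i b where z: "z = (\<sigma> i, b)" "b < \<sigma> i" "i < k" "b \<notin> ?S" "\<sigma> i < k + m"
      using assms(2) by auto
    then have "b \<in> \<sigma> ` {k..<k + m}"
      using Sh_image_lessThan(3)[OF assms(1)] by auto
    then obtain j where "b = \<sigma> j" "k \<le> j" "j < k + m" by auto
    then show "z \<in> map_prod \<sigma> \<sigma> ` ?P"
      using z assms(2) by (intro image_eqI[of _ _ "(i, j)"]) auto
  qed
  moreover have "inj_on (map_prod \<sigma> \<sigma>) ?P"
    using inj by (auto simp: inj_on_def)
  ultimately have "(\<Prod>(a, b)\<in>?Q. (-1 :: 'k) powi (ds ! a * ds ! b)) = koszul_sign ds \<sigma>"
    unfolding koszul_sign_def by (intro prod.reindex_cong[of "map_prod \<sigma> \<sigma>"]) auto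
  moreover have "(\<Prod>(a, b)\<in>?Q. (-1 :: 'k) powi (ds ! a * ds ! b)) = (-1) powi ksign ds ?S"
    using prod_powi_minus_one[OF finite_pairs_below[of "length ds" "\<lambda>a b. a \<in> ?S \<and> b \<notin> ?S"],
        of "\<lambda>(a, b). ds ! a * ds ! b"]
    by (simp add: ksign_def case_prod_beta)
  ultimately show ?thesis by simp
qed

text \<open>A shuffle lists the image of each block in increasing order, hence is determined by the
  image of the first. Conversely, the sorted list of \<open>S\<close> followed by that of its
  complement, read as a function, is a shuffle.\<close>

lemma bij_betw_Sh: "bij_betw (\<lambda>\<sigma>. \<sigma> ` {..<k}) (Sh k m) {S. S \<subseteq> {..<k + m} \<and> card S = k}"
proof (rule bij_betw_imageI)
  show "inj_on (\<lambda>\<sigma>. \<sigma> ` {..<k}) (Sh k m)"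
  proof (intro inj_onI ext)
    fix \<sigma> \<tau> i assume *: "\<sigma> \<in> Sh k m" "\<tau> \<in> Sh k m" "\<sigma> ` {..<k} = \<tau> ` {..<k}"
    then have "map \<sigma> [0..<k] = map \<tau> [0..<k]" "map \<sigma> [k..<k + m] = map \<tau> [k..<k + m]"
      by (simp_all only: Sh_sorted_lists)
    then have "\<sigma> i = \<tau> i" if "i < k + m"
      using that by (cases "i < k") auto
    then show "\<sigma> i = \<tau> i"
      using * permutes_not_in[of \<sigma> "{..<k + m}" i] permutes_not_in[of \<tau> "{..<k + m}" i]
      by (cases "i < k + m") (auto simp: Sh_def)
  qed
  show "(\<lambda>\<sigma>. \<sigma> ` {..<k}) ` Sh k m = {S. S \<subseteq> {..<k + m} \<and> card S = k}"
  proof (intro set_eqI iffI)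
    fix S assume "S \<in> {S. S \<subseteq> {..<k + m} \<and> card S = k}"
    then have S: "S \<subseteq> {..<k + m}" "card S = k" "finite S"
      by (auto intro: finite_subset)
    let ?T = "{..<k + m} - S"
    define xs ys where "xs = sorted_list_of_set S" and "ys = sorted_list_of_set ?T"
    have T: "card ?T = m"
      using S by (simp add: card_Diff_subset)
    have len: "length xs = k" "length ys = m"
      using S T by (simp_all add: xs_def ys_def)
    have set: "set xs = S" "set ys = ?T"
      using S by (simp_all add: xs_def ys_def)
    have sorted: "sorted_wrt (<) xs" "sorted_wrt (<) ys"
      unfolding xs_def ys_def by (rule strict_sorted_list_of_set)+
    define \<sigma> where "\<sigma> i = (if i < k + m then (xs @ ys) ! i else i)" for i
    have d: "distinct (xs @ ys)" "set (xs @ ys) = {..<k + m}"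
      using S set by (auto simp: xs_def ys_def)
    have "bij_betw ((!) (xs @ ys)) {..<k + m} {..<k + m}"
      using bij_betw_nth[OF d(1)] d(2) len by simp
    then have "bij_betw \<sigma> {..<k + m} {..<k + m}"
      by (rule bij_betw_cong[THEN iffD1, rotated]) (simp add: \<sigma>_def)
    then have "\<sigma> permutes {..<k + m}"
      by (rule bij_imp_permutes) (simp add: \<sigma>_def)
    moreover have "strict_mono_on {..<k} \<sigma>" "strict_mono_on {k..<k + m} \<sigma>"
      using sorted len by (auto simp: strict_mono_on_def \<sigma>_def nth_append sorted_wrt_iff_nth_less)
    ultimately have "\<sigma> \<in> Sh k m"
      by (simp add: Sh_def)
    moreover have "\<sigma> ` {..<k} = S"
    proof -
      have "\<sigma> ` {..<k} = (!) xs ` {..<k}"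
        using len by (intro image_cong) (auto simp: \<sigma>_def nth_append)
      then show ?thesis using set len by (auto simp: set_conv_nth)
    qed
    ultimately show "S \<in> (\<lambda>\<sigma>. \<sigma> ` {..<k}) ` Sh k m" by blast
  next
    fix S assume "S \<in> (\<lambda>\<sigma>. \<sigma> ` {..<k}) ` Sh k m"
    then show "S \<in> {S. S \<subseteq> {..<k + m} \<and> card S = k}"
      using Sh_image_lessThan(1,2) by blast
  qed
qed

text \<open>Letters carry their degrees, so permuting \<open>w\<close> permutes degrees and vectors
  together, and shuffles of one type are the splits with a left half of fixed length.\<close>

lemma sum_Sh:
  assumes "vector_space (s :: 'k::field \<Rightarrow> 'c::ab_group_add \<Rightarrow> 'c)" "length w = k + m"
  shows "(\<Sum>\<sigma>\<in>Sh k m. s (koszul_sign (map fst w) \<sigma>) (g (take k (permute_list \<sigma> w)) (drop k (permute_list \<sigma> w)))) =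
     spsum w (\<lambda>u v. if length u = k then g u v else 0)"
proof -
  let ?h = "\<lambda>S. sg (ksign (map fst w) S) (g (nths w S) (nths w (- S)))"
  let ?X = "{S. S \<subseteq> {..<k + m} \<and> card S = k}"
  have len: "length (nths w S) = card S" if "S \<subseteq> {..<k + m}" for S
    using that assms(2) by (auto simp: length_nths intro!: arg_cong[of _ _ card])
  have "(\<Sum>\<sigma>\<in>Sh k m. s (koszul_sign (map fst w) \<sigma>) (g (take k (permute_list \<sigma> w)) (drop k (permute_list \<sigma> w)))) =
      (\<Sum>\<sigma>\<in>Sh k m. ?h (\<sigma> ` {..<k}))"
    by (intro sum.cong refl)
      (simp add: koszul_sign_Sh assms Sh_take_drop_permute_list scale_powi_minus_one)
  also have "\<dots> = sum ?h ?X"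
    by (rule sum.reindex_bij_betw[OF bij_betw_Sh])
  also have "\<dots> = (\<Sum>S\<in>Pow {..<k + m}. if card S = k then ?h S else 0)"
    by (simp add: sum.inter_filter[symmetric])
  also have "\<dots> = spsum w (\<lambda>u v. if length u = k then g u v else 0)"
    unfolding spsum_subsets assms(2) by (intro sum.cong refl) (auto simp: len)
  finally show ?thesis .
qed

section \<open>Graded multilinear functions of words\<close>

definition gword :: "('k, 'a::ab_group_add, 'm) gspace_scheme \<Rightarrow> 'a gword \<Rightarrow> bool" where
  "gword V w \<longleftrightarrow> (\<forall>x\<in>set w. snd x \<in> grade V (fst x))"

lemma gword_simps [simp]:
  "gword V []" "gword V (x # w) \<longleftrightarrow> snd x \<in> grade V (fst x) \<and> gword V w"
  "gword V (u @ v) \<longleftrightarrow> gword V u \<and> gword V v"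
  by (auto simp: gword_def)

lemma spsum_cong_gword:
  assumes "gword V w"
    and "\<And>u v. \<lbrakk>gword V u; gword V v; length u + length v = length w; wt u + wt v = wt w\<rbrakk> \<Longrightarrow> g u v = g' u v"
  shows "spsum w g = spsum w g'"
proof (rule spsum_cong_strong)
  fix u v assume "length u + length v = length w" "wt u + wt v = wt w" "set u \<union> set v = set w"
  moreover from this(3) assms(1) have "gword V u" "gword V v"
    unfolding gword_def by blast+
  ultimately show "g u v = g' u v"
    by (intro assms(2))
qed

text \<open>Linearity in a letter is demanded only inside one graded piece and with homogeneous
  neighbours, since a letter with a degree label has no meaning otherwise; \<open>hsum\<close>
  extends such functions to arbitrary words.\<close>

definition gmult ::
  "('k, 'a::ab_group_add, 'm) gspace_scheme \<Rightarrow> ('k \<Rightarrow> 'c \<Rightarrow> 'c::ab_group_add) \<Rightarrow> ('a gword \<Rightarrow> 'c) \<Rightarrow> bool" where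
  "gmult V s F \<longleftrightarrow> (\<forall>us d vs. gword V us \<longrightarrow> gword V vs \<longrightarrow>
     (\<forall>x\<in>grade V d. \<forall>y\<in>grade V d. F (us @ (d, x + y) # vs) = F (us @ (d, x) # vs) + F (us @ (d, y) # vs)) \<and>
     (\<forall>c. \<forall>x\<in>grade V d. F (us @ (d, smul V c x) # vs) = s c (F (us @ (d, x) # vs))))"

definition gsym :: "('k, 'a::ab_group_add, 'm) gspace_scheme \<Rightarrow> ('a gword \<Rightarrow> 'c::ab_group_add) \<Rightarrow> bool" where
  "gsym V F \<longleftrightarrow> (\<forall>us x y vs. gword V (us @ x # y # vs) \<longrightarrow>
     F (us @ x # y # vs) = sg (fst x * fst y) (F (us @ y # x # vs)))"

definition gmsym ::
  "('k, 'a::ab_group_add, 'm) gspace_scheme \<Rightarrow> ('k \<Rightarrow> 'c \<Rightarrow> 'c::ab_group_add) \<Rightarrow> ('a gword \<Rightarrow> 'c) \<Rightarrow> bool" where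
  "gmsym V s F \<longleftrightarrow> gmult V s F \<and> gsym V F"

text \<open>The property of an integrand \<open>G\<close> that makes \<open>spsum w G\<close> a
  function of the class of \<open>w\<close> in \<open>Sym\<close>.\<close>

definition gmsym2 ::
  "('k, 'a::ab_group_add, 'm) gspace_scheme \<Rightarrow> ('k \<Rightarrow> 'c \<Rightarrow> 'c::ab_group_add) \<Rightarrow> ('a gword \<Rightarrow> 'a gword \<Rightarrow> 'c) \<Rightarrow> bool" where
  "gmsym2 V s G \<longleftrightarrow> (\<forall>v. gword V v \<longrightarrow> gmsym V s (\<lambda>u. G u v)) \<and> (\<forall>u. gword V u \<longrightarrow> gmsym V s (G u))"

lemma gmult_add:
  "\<lbrakk>gmult V s F; gword V us; gword V vs; x \<in> grade V d; y \<in> grade V d\<rbrakk>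
    \<Longrightarrow> F (us @ (d, x + y) # vs) = F (us @ (d, x) # vs) + F (us @ (d, y) # vs)"
  unfolding gmult_def by blast

lemma gmult_scale:
  "\<lbrakk>gmult V s F; gword V us; gword V vs; x \<in> grade V d\<rbrakk>
    \<Longrightarrow> F (us @ (d, smul V c x) # vs) = s c (F (us @ (d, x) # vs))"
  unfolding gmult_def by blast

lemma gmultI:
  assumes "\<And>us d vs x y. \<lbrakk>gword V us; gword V vs; x \<in> grade V d; y \<in> grade V d\<rbrakk>
     \<Longrightarrow> F (us @ (d, x + y) # vs) = F (us @ (d, x) # vs) + F (us @ (d, y) # vs)"
   and "\<And>us d vs x c. \<lbrakk>gword V us; gword V vs; x \<in> grade V d\<rbrakk>
     \<Longrightarrow> F (us @ (d, smul V c x) # vs) = s c (F (us @ (d, x) # vs))"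
  shows "gmult V s F"
  unfolding gmult_def using assms by blast

lemma gsym_swap:
  "\<lbrakk>gsym V F; gword V us; gword V vs; snd x \<in> grade V (fst x); snd y \<in> grade V (fst y)\<rbrakk>
    \<Longrightarrow> F (us @ x # y # vs) = sg (fst x * fst y) (F (us @ y # x # vs))"
  by (rule gsym_def[THEN iffD1, rule_format]) simp_all

lemma gsymI:
  assumes "\<And>us x y vs. \<lbrakk>gword V us; gword V vs; snd x \<in> grade V (fst x); snd y \<in> grade V (fst y)\<rbrakk>
    \<Longrightarrow> F (us @ x # y # vs) = sg (fst x * fst y) (F (us @ y # x # vs))"
  shows "gsym V F"
  unfolding gsym_def by (intro allI impI, rule assms) auto

lemma gmult_Cons: "\<lbrakk>gmult V s F; snd x \<in> grade V (fst x)\<rbrakk> \<Longrightarrow> gmult V s (\<lambda>w. F (x # w))"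
  using gmult_add[of V s F "x # _"] gmult_scale[of V s F "x # _"]
  by (intro gmultI) (simp_all only: append_Cons gword_simps)

lemma gsym_Cons:
  assumes "gsym V F" "snd x \<in> grade V (fst x)"
  shows "gsym V (\<lambda>w. F (x # w))"
proof (rule gsymI)
  fix us y z vs
  assume "gword V us" "gword V vs" "snd y \<in> grade V (fst y)" "snd z \<in> grade V (fst z)"
  then show "F (x # us @ y # z # vs) = sg (fst y * fst z) (F (x # us @ z # y # vs))"
    using gsym_swap[OF assms(1), of "x # us" vs y z] assms(2) by (simp only: append_Cons gword_simps)
qed

lemma gmsym_Cons: "\<lbrakk>gmsym V s F; snd x \<in> grade V (fst x)\<rbrakk> \<Longrightarrow> gmsym V s (\<lambda>w. F (x # w))"
  by (simp add: gmsym_def gmult_Cons gsym_Cons)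

lemma gmsym2I:
  "\<lbrakk>\<And>v. gword V v \<Longrightarrow> gmsym V s (\<lambda>u. G u v); \<And>u. gword V u \<Longrightarrow> gmsym V s (G u)\<rbrakk> \<Longrightarrow> gmsym2 V s G"
  by (simp add: gmsym2_def)

lemma gmsym2D:
  assumes "gmsym2 V s G" "gword V w"
  shows "gmsym V s (\<lambda>u. G u w)" "gmsym V s (G w)"
  using assms by (simp_all add: gmsym2_def)

lemma gmsym2_Cons_left: "\<lbrakk>gmsym2 V s G; snd x \<in> grade V (fst x)\<rbrakk> \<Longrightarrow> gmsym2 V s (\<lambda>u v. G (x # u) v)"
  by (rule gmsym2I) (simp_all add: gmsym2D(2) gmsym_Cons[OF gmsym2D(1)])

lemma linear_sg_scale: "vector_space s \<Longrightarrow> s c (sg n x) = sg n (s c x)"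
  by (simp add: sg_def module.scale_minus_right module_iff_vector_space)

text \<open>The degree of the argument is invariant under the operations in the definition of \<open>gmsym\<close>,
  so signs depending on it are harmless.\<close>

lemma gmsym_sg_wt:
  assumes "vector_space s" "gmsym V s F"
  shows "gmsym V s (\<lambda>w. sg (n + d * wt w) (F w))"
proof -
  have F: "gmult V s F" "gsym V F"
    using assms(2) by (simp_all add: gmsym_def)
  have "gmult V s (\<lambda>w. sg (n + d * wt w) (F w))"
    by (intro gmultI) (simp_all add: gmult_add[OF F(1)] gmult_scale[OF F(1)] sg_add linear_sg_scale[OF assms(1)])
  moreover have "gsym V (\<lambda>w. sg (n + d * wt w) (F w))"
    proof (rule gsymI)
    fix us x y vs
    assume "gword V us" "gword V vs" "snd x \<in> grade V (fst x)" "snd y \<in> grade V (fst y)"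
    from gsym_swap[OF F(2) this]
    show "sg (n + d * wt (us @ x # y # vs)) (F (us @ x # y # vs)) =
        sg (fst x * fst y) (sg (n + d * wt (us @ y # x # vs)) (F (us @ y # x # vs)))"
      by (simp only:) (simp add: algebra_simps)
  qed
  ultimately show ?thesis
    by (simp add: gmsym_def)
qed

lemma gmsym2_Cons_right:
  assumes "vector_space s" "gmsym2 V s G" "snd x \<in> grade V (fst x)"
  shows "gmsym2 V s (\<lambda>u v. sg (d * wt u) (G u (x # v)))"
proof (rule gmsym2I)
  show "gmsym V s (\<lambda>u. sg (d * wt u) (G u (x # v)))" if "gword V v" for v
    using gmsym_sg_wt[OF assms(1) gmsym2D(1)[OF assms(2), of "x # v"], of 0 d] assms(3) that by simp
  show "gmsym V s (\<lambda>v. sg (d * wt u) (G u (x # v)))" if "gword V u" for u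
    using gmsym_sg_wt[OF assms(1) gmsym_Cons[OF gmsym2D(2)[OF assms(2) that] assms(3)], of "d * wt u" 0] by simp
qed

lemma gmsym_linear:
  assumes f: "Vector_Spaces.linear s s' f" and "gmsym V s F"
  shows "gmsym V s' (\<lambda>w. f (F w))"
proof -
  interpret f: Vector_Spaces.linear s s' f by fact
  have F: "gmult V s F" "gsym V F"
    using assms(2) by (simp_all add: gmsym_def)
  have "gmult V s' (\<lambda>w. f (F w))"
    by (intro gmultI) (simp_all add: gmult_add[OF F(1)] gmult_scale[OF F(1)] f.add f.scale)
  moreover have "gsym V (\<lambda>w. f (F w))"
    proof (rule gsymI)
    fix us x y vs
    assume "gword V us" "gword V vs" "snd x \<in> grade V (fst x)" "snd y \<in> grade V (fst y)"
    from gsym_swap[OF F(2) this]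
    show "f (F (us @ x # y # vs)) = sg (fst x * fst y) (f (F (us @ y # x # vs)))"
      by (simp only: linear_sg[OF f])
  qed
  ultimately show ?thesis
    by (simp add: gmsym_def)
qed

text \<open>The induction peels off the letters in front of the modified one. Both branches of
  \<open>spsum\<close> are again sums with a \<open>gmsym2\<close> integrand, the second one
  including its sign, so \<open>G\<close> is generalized. At the modified letter each branch uses
  linearity of \<open>G\<close> in one argument.\<close>

lemma gmult_spsum:
  fixes V :: "('k::field, 'a::ab_group_add, 'm) gspace_scheme"
  assumes s: "vector_space s"
  shows "gmsym2 V s G \<Longrightarrow> gmult V s (\<lambda>w. spsum w G)"
proof (rule gmultI)
  fix us vs :: "'a gword" and d x y
  assume "gmsym2 V s G" "gword V us" "gword V vs" "x \<in> grade V d" "y \<in> grade V d"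
  then show "spsum (us @ (d, x + y) # vs) G = spsum (us @ (d, x) # vs) G + spsum (us @ (d, y) # vs) G"
  proof (induction us arbitrary: G)
    case Nil
    have G: "gmult V s (\<lambda>u. G u w)" "gmult V s (G w)" if "gword V w" for w
      using gmsym2D[OF Nil(1) that] by (simp_all add: gmsym_def)
    have 1: "G ((d, x + y) # u) v = G ((d, x) # u) v + G ((d, y) # u) v"
      "G u ((d, x + y) # v) = G u ((d, x) # v) + G u ((d, y) # v)" if "gword V u" "gword V v" for u v
      using gmult_add[OF G(1)[of v], of "[]" u x d y] gmult_add[OF G(2)[of u], of "[]" v x d y] Nil(2-) that
      by simp_all
    have "spsum vs (\<lambda>u v. G ((d, x + y) # u) v) = spsum vs (\<lambda>u v. G ((d, x) # u) v + G ((d, y) # u) v)"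
      by (rule spsum_cong_gword[of V]) (use Nil in \<open>simp_all add: 1\<close>)
    moreover have "spsum vs (\<lambda>u v. sg (d * wt u) (G u ((d, x + y) # v))) =
        spsum vs (\<lambda>u v. sg (d * wt u) (G u ((d, x) # v)) + sg (d * wt u) (G u ((d, y) # v)))"
      by (rule spsum_cong_gword[of V]) (use Nil in \<open>simp_all add: 1 sg_add\<close>)
    ultimately show ?case by (simp add: spsum_add algebra_simps)
  next
    case (Cons z us)
    have z: "snd z \<in> grade V (fst z)" "gword V us"
      using Cons.prems by simp_all
    show ?case
      by (simp add: Cons.IH[OF gmsym2_Cons_left[OF Cons.prems(1) z(1)] z(2) Cons.prems(3-)]
        Cons.IH[OF gmsym2_Cons_right[OF s Cons.prems(1) z(1)] z(2) Cons.prems(3-)])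
  qed
next
  fix us vs :: "'a gword" and d x c
  assume "gmsym2 V s G" "gword V us" "gword V vs" "x \<in> grade V d"
  then show "spsum (us @ (d, smul V c x) # vs) G = s c (spsum (us @ (d, x) # vs) G)"
  proof (induction us arbitrary: G)
    case Nil
    have G: "gmult V s (\<lambda>u. G u w)" "gmult V s (G w)" if "gword V w" for w
      using gmsym2D[OF Nil(1) that] by (simp_all add: gmsym_def)
    have 1: "G ((d, smul V c x) # u) v = s c (G ((d, x) # u) v)"
      "G u ((d, smul V c x) # v) = s c (G u ((d, x) # v))" if "gword V u" "gword V v" for u v
      using gmult_scale[OF G(1)[of v], of "[]" u x d] gmult_scale[OF G(2)[of u], of "[]" v x d] Nil(2-) that
      by simp_all
    have a: "Modules.additive (s c)"
      using s by (simp add: Modules.additive_def vector_space_def)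
    have "spsum vs (\<lambda>u v. G ((d, smul V c x) # u) v) = spsum vs (\<lambda>u v. s c (G ((d, x) # u) v))"
      by (rule spsum_cong_gword[of V]) (use Nil in \<open>simp_all add: 1\<close>)
    moreover have "spsum vs (\<lambda>u v. sg (d * wt u) (G u ((d, smul V c x) # v))) =
        spsum vs (\<lambda>u v. s c (sg (d * wt u) (G u ((d, x) # v))))"
      by (rule spsum_cong_gword[of V]) (use Nil in \<open>simp_all add: 1 linear_sg_scale[OF s]\<close>)
    ultimately show ?case
      by (simp add: additive_spsum[OF a, symmetric] Modules.additive.add[OF a])
  next
    case (Cons z us)
    have z: "snd z \<in> grade V (fst z)" "gword V us"
      using Cons.prems by simp_all
    have "s c (a + b) = s c a + s c b" for a b
      using s by (simp add: vector_space_def)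
    then show ?case
      by (simp add: Cons.IH[OF gmsym2_Cons_left[OF Cons.prems(1) z(1)] z(2) Cons.prems(3-)]
        Cons.IH[OF gmsym2_Cons_right[OF s Cons.prems(1) z(1)] z(2) Cons.prems(3-)])
  qed
qed

text \<open>Four cases according to the halves receiving \<open>x\<close> and \<open>y\<close>. If
  they go to the same half, \<open>G\<close> is symmetric in that argument. If they are separated,
  the terms on the two sides of the equation match crosswise.\<close>

lemma gsym_spsum:
  assumes s: "vector_space s"
  shows "gmsym2 V s G \<Longrightarrow> gsym V (\<lambda>w. spsum w G)"
proof (rule gsymI)
  fix us x y vs
  assume "gmsym2 V s G" "gword V us" "gword V vs" "snd x \<in> grade V (fst x)" "snd y \<in> grade V (fst y)"
  then show "spsum (us @ x # y # vs) G = sg (fst x * fst y) (spsum (us @ y # x # vs) G)"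
  proof (induction us arbitrary: G)
    case Nil
    have G: "gsym V (\<lambda>u. G u w)" "gsym V (G w)" if "gword V w" for w
      using gmsym2D[OF Nil(1) that] by (simp_all add: gmsym_def)
    have 1: "G (x # y # u) v = sg (fst x * fst y) (G (y # x # u) v)"
      "G u (x # y # v) = sg (fst x * fst y) (G u (y # x # v))" if "gword V u" "gword V v" for u v
      using gsym_swap[OF G(1)[of v], of "[]" u x y] gsym_swap[OF G(2)[of u], of "[]" v x y] Nil(2-) that
      by (simp_all only: append_Nil gword_simps)
    have 2: "spsum vs (\<lambda>u v. G (x # y # u) v) = spsum vs (\<lambda>u v. sg (fst x * fst y) (G (y # x # u) v))"
      using Nil(3) 1(1) by (rule spsum_cong_gword)
    have 3: "spsum vs (\<lambda>u v. sg (fst y * wt u) (sg (fst x * wt u) (G u (x # y # v)))) =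
        spsum vs (\<lambda>u v. sg (fst x * fst y) (sg (fst x * wt u) (sg (fst y * wt u) (G u (y # x # v)))))"
      using Nil(3)
    proof (rule spsum_cong_gword)
      fix u v assume uv: "gword V u" "gword V v"
      show "sg (fst y * wt u) (sg (fst x * wt u) (G u (x # y # v))) =
          sg (fst x * fst y) (sg (fst x * wt u) (sg (fst y * wt u) (G u (y # x # v))))"
        unfolding 1(2)[OF uv] sg_sg by (rule sg_parity) auto
    qed
    \<comment> \<open>\<open>x\<close> moves right past \<open>y # u\<close>; the share of its sign
      that is due to \<open>y\<close> is exactly the sign of the transposition.\<close>
    have 4: "spsum vs (\<lambda>u v. sg (fst x * wt (y # u)) (G (y # u) (x # v))) =
        spsum vs (\<lambda>u v. sg (fst x * fst y) (sg (fst x * wt u) (G (y # u) (x # v))))"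
      by (rule spsum_cong) (auto intro: sg_parity)
    have 5: "spsum vs (\<lambda>u v. sg (fst y * wt u) (G (x # u) (y # v))) =
        spsum vs (\<lambda>u v. sg (fst x * fst y) (sg (fst y * wt (x # u)) (G (x # u) (y # v))))"
      unfolding sg_sg by (intro spsum_cong sg_parity) auto
    show ?case
      unfolding append_Nil spsum.simps sg_add spsum_sg[symmetric] spsum_add 2 3 4 5
      by (simp only: add_ac)
  next
    case (Cons z us)
    have z: "snd z \<in> grade V (fst z)" "gword V us"
      using Cons.prems by simp_all
    have "spsum ((z # us) @ x # y # vs) G = spsum (us @ x # y # vs) (\<lambda>u v. G (z # u) v) +
        spsum (us @ x # y # vs) (\<lambda>u v. sg (fst z * wt u) (G u (z # v)))"
      by simp
    also have "\<dots> = sg (fst x * fst y) (spsum ((z # us) @ y # x # vs) G)"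
      unfolding Cons.IH[OF gmsym2_Cons_left[OF Cons.prems(1) z(1)] z(2) Cons.prems(3-)]
        Cons.IH[OF gmsym2_Cons_right[OF s Cons.prems(1) z(1)] z(2) Cons.prems(3-)]
      by (simp add: sg_add)
    finally show ?case .
  qed
qed

lemma gmsym_spsum: "\<lbrakk>vector_space s; gmsym2 V s G\<rbrakk> \<Longrightarrow> gmsym V s (\<lambda>w. spsum w G)"
  by (simp add: gmsym_def gmult_spsum gsym_spsum)

section \<open>Homogeneous components\<close>

text \<open>A recursive form of \<open>hom_expand\<close> that keeps each homogeneous component
  together with its degree, as the functions of labelled words require.\<close>

primrec hsum ::
  "('k, 'a::ab_group_add, 'm) gspace_scheme \<Rightarrow> 'a list \<Rightarrow> ('a gword \<Rightarrow> 'c::comm_monoid_add) \<Rightarrow> 'c" where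
  "hsum V [] F = F []"
| "hsum V (x # xs) F = (\<Sum>d | hcomp V d x \<noteq> 0. hsum V xs (\<lambda>w. F ((d, hcomp V d x) # w)))"

lemma sum_set_Cons: "(\<Sum>z\<in>set_Cons S T. f z) = (\<Sum>x\<in>S. \<Sum>y\<in>T. f (x # y))"
proof -
  have "set_Cons S T = (\<lambda>(x, y). x # y) ` (S \<times> T)"
    by (auto simp: set_Cons_def)
  moreover have "inj_on (\<lambda>(x, y). x # y) (S \<times> T)"
    by (auto simp: inj_on_def)
  ultimately show ?thesis
    by (simp add: sum.reindex sum.cartesian_product o_def case_prod_unfold)
qed

lemma hom_expand_eq_hsum: "hom_expand V f xs = hsum V xs (\<lambda>w. f (map fst w) (map snd w))"
proof (induction xs arbitrary: f)
  case (Cons x xs)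
  have "hom_expand V f (x # xs) = (\<Sum>d | hcomp V d x \<noteq> 0. hom_expand V (\<lambda>ds ys. f (d # ds) (hcomp V d x # ys)) xs)"
    by (simp add: hom_expand_def sum_set_Cons)
  then show ?case
    by (simp add: Cons)
qed (simp add: hom_expand_def)

lemma additive_hsum: "Modules.additive f \<Longrightarrow> f (hsum V xs F) = hsum V xs (\<lambda>w. f (F w))"
  by (induction xs arbitrary: F) (simp_all add: Modules.additive.sum)

lemma hsum_add: "hsum V xs (\<lambda>w. F w + F' w) = hsum V xs F + (hsum V xs F' :: 'c::ab_group_add)"
  by (induction xs arbitrary: F F') (simp_all add: sum.distrib)

lemma hsum_zero [simp]: "hsum V xs (\<lambda>w. 0) = 0"
  by (induction xs) simp_all

context graded_space
begin

lemma grade_add: "x \<in> grade V n \<Longrightarrow> y \<in> grade V n \<Longrightarrow> x + y \<in> grade V n"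
  and grade_scale: "x \<in> grade V n \<Longrightarrow> smul V c x \<in> grade V n"
  and grade_0 [simp]: "0 \<in> grade V n"
  and grade_minus: "x \<in> grade V n \<Longrightarrow> - x \<in> grade V n"
  using grade_subspace[of n] by (simp_all add: subspace_add subspace_scale subspace_0 subspace_neg)

lemma grade_sg: "x \<in> grade V n \<Longrightarrow> sg m x \<in> grade V n"
  by (simp add: sg_def grade_minus)

lemma grade_spsum:
  "(\<And>u v. \<lbrakk>length u + length v = length w; wt u + wt v = wt w; set u \<union> set v = set w\<rbrakk> \<Longrightarrow> g u v \<in> grade V n)
    \<Longrightarrow> spsum w g \<in> grade V n"
proof (induction w arbitrary: g)
  case (Cons x w)
  show ?case
    unfolding spsum.simps by (intro grade_add Cons.IH grade_sg) (auto intro!: Cons.prems)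
qed simp

lemma hom_decomp_hcomp: "hom_decomp V x (\<lambda>n. hcomp V n x)"
  unfolding hcomp_def using theI'[OF ex1_hom_decomp[of x]] by simp

lemma hcomp_eqI:
  assumes "hom_decomp V x f"
  shows "hcomp V n x = f n"
proof -
  have "(\<lambda>n. hcomp V n x) = f"
    using ex1_hom_decomp[of x] hom_decomp_hcomp[of x] assms by blast
  then show ?thesis
    by (rule fun_cong)
qed

lemma hcomp_in_grade [simp]: "hcomp V n x \<in> grade V n"
  and finite_hcomp [simp]: "finite {n. hcomp V n x \<noteq> 0}"
  and sum_hcomp: "(\<Sum>n | hcomp V n x \<noteq> 0. hcomp V n x) = x"
  using hom_decomp_hcomp[of x] by (auto simp: hom_decomp_def)

lemma hom_decompI:
  assumes "\<And>n. f n \<in> grade V n" "finite S" "{n. f n \<noteq> 0} \<subseteq> S" "x = sum f S"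
  shows "hom_decomp V x f"
proof -
  have "sum f {n. f n \<noteq> 0} = sum f S"
    using assms(2,3) by (intro sum.mono_neutral_left) auto
  then show ?thesis
    unfolding hom_decomp_def using assms(1,4) finite_subset[OF assms(3,2)] by metis
qed

lemma sum_hcomp_superset: "finite S \<Longrightarrow> {n. hcomp V n x \<noteq> 0} \<subseteq> S \<Longrightarrow> (\<Sum>n\<in>S. hcomp V n x) = x"
  by (rule trans[OF sum.mono_neutral_right sum_hcomp]) auto

lemma hcomp_add: "hcomp V n (x + y) = hcomp V n x + hcomp V n y"
proof (rule hcomp_eqI[where f = "\<lambda>n. hcomp V n x + hcomp V n y"], rule hom_decompI)
  let ?S = "{n. hcomp V n x \<noteq> 0} \<union> {n. hcomp V n y \<noteq> 0}"
  show "finite ?S" by simp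
  then show "x + y = (\<Sum>n\<in>?S. hcomp V n x + hcomp V n y)"
    by (simp add: sum.distrib sum_hcomp_superset del: finite_Un)
qed (auto simp: grade_add)

lemma hcomp_scale: "hcomp V n (smul V c x) = smul V c (hcomp V n x)"
proof (rule hcomp_eqI[where f = "\<lambda>n. smul V c (hcomp V n x)"], rule hom_decompI)
  show "smul V c x = (\<Sum>n | hcomp V n x \<noteq> 0. smul V c (hcomp V n x))"
    by (simp only: scale_sum_right[symmetric] sum_hcomp)
qed (auto simp: grade_scale)

lemma hcomp_hom: "x \<in> grade V m \<Longrightarrow> hcomp V n x = (if n = m then x else 0)"
  by (rule hcomp_eqI[where f = "\<lambda>n. if n = m then x else 0"], rule hom_decompI[where S = "{m}"]) auto

lemma hcomp_0 [simp]: "hcomp V n 0 = 0"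
  using hcomp_hom[OF grade_0, of n n] by simp

lemma hsum_cong_hom:
  "(\<And>w. gword V w \<Longrightarrow> length w = length xs \<Longrightarrow> F w = F' w) \<Longrightarrow> hsum V xs F = hsum V xs F'"
proof (induction xs arbitrary: F F')
  case (Cons x xs)
  show ?case
    unfolding hsum.simps by (intro sum.cong refl Cons.IH) (auto intro!: Cons.prems)
qed simp

text \<open>A zero letter has no nonzero component, so its expansion is an empty sum. For
  multilinear \<open>F\<close> the value is zero there anyway, and the case distinction
  disappears.\<close>

lemma hsum_map_snd:
  "gword V w \<Longrightarrow> hsum V (map snd w) F = (if \<exists>x\<in>set w. snd x = 0 then 0 else F w)"
proof (induction w arbitrary: F)
  case (Cons x w)
  have "hcomp V d (snd x) = (if d = fst x then snd x else 0)" for d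
    using Cons.prems by (intro hcomp_hom) simp
  then have "{d. hcomp V d (snd x) \<noteq> 0} = (if snd x = 0 then {} else {fst x})"
    and "hcomp V (fst x) (snd x) = snd x"
    by auto
  then show ?case
    using Cons by auto
qed simp

lemma gmult_zero:
  assumes "gmult V s F" "gword V w" "\<exists>x\<in>set w. snd x = 0"
  shows "F w = 0"
proof -
  obtain x us vs where "w = us @ x # vs" "snd x = 0"
    using assms(3) by (auto dest: split_list)
  then show ?thesis
    using gmult_add[OF assms(1), of us vs 0 "fst x" 0] assms(2) by (cases x) auto
qed

lemma hsum_map_snd_gmult: "\<lbrakk>gmult V s F; gword V w\<rbrakk> \<Longrightarrow> hsum V (map snd w) F = F w"
  using gmult_zero by (auto simp: hsum_map_snd)

text \<open>The supports of \<open>x\<close>, \<open>y\<close> and \<open>x + y\<close> may differ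
  by cancellation. All three sums are therefore extended to the union of the supports of
  \<open>x\<close> and \<open>y\<close>, which is harmless because additivity forces
  \<open>\<phi> d 0 = 0\<close>.\<close>

lemma sum_hcomp_additive:
  fixes \<phi> :: "int \<Rightarrow> 'a \<Rightarrow> 'c::ab_group_add"
  assumes "\<And>d x y. x \<in> grade V d \<Longrightarrow> y \<in> grade V d \<Longrightarrow> \<phi> d (x + y) = \<phi> d x + \<phi> d y"
  shows "(\<Sum>d | hcomp V d (x + y) \<noteq> 0. \<phi> d (hcomp V d (x + y))) =
     (\<Sum>d | hcomp V d x \<noteq> 0. \<phi> d (hcomp V d x)) + (\<Sum>d | hcomp V d y \<noteq> 0. \<phi> d (hcomp V d y))"
proof -
  have z: "\<phi> d 0 = 0" for d
    using assms[of 0 d 0] by simp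
  let ?S = "{n. hcomp V n x \<noteq> 0} \<union> {n. hcomp V n y \<noteq> 0}"
  have *: "(\<Sum>d | hcomp V d t \<noteq> 0. \<phi> d (hcomp V d t)) = (\<Sum>d\<in>?S. \<phi> d (hcomp V d t))"
    if "{n. hcomp V n t \<noteq> 0} \<subseteq> ?S" for t
    by (rule sum.mono_neutral_left) (use that in \<open>auto simp: z\<close>)
  have "{n. hcomp V n (x + y) \<noteq> 0} \<subseteq> ?S"
    by (auto simp: hcomp_add)
  then have "(\<Sum>d | hcomp V d (x + y) \<noteq> 0. \<phi> d (hcomp V d (x + y))) = (\<Sum>d\<in>?S. \<phi> d (hcomp V d (x + y)))"
    by (rule *)
  also have "\<dots> = (\<Sum>d\<in>?S. \<phi> d (hcomp V d x)) + (\<Sum>d\<in>?S. \<phi> d (hcomp V d y))"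
    by (simp only: hcomp_add assms[OF hcomp_in_grade hcomp_in_grade] sum.distrib)
  finally show ?thesis
    by (simp only: *[of x] *[of y] Un_upper1 Un_upper2)
qed

lemma sum_hcomp_scale:
  fixes \<phi> :: "int \<Rightarrow> 'a \<Rightarrow> 'c::ab_group_add"
  assumes s: "vector_space s"
    and "\<And>d x. x \<in> grade V d \<Longrightarrow> \<phi> d (smul V c x) = s c (\<phi> d x)"
  shows "(\<Sum>d | hcomp V d (smul V c x) \<noteq> 0. \<phi> d (hcomp V d (smul V c x))) =
     s c (\<Sum>d | hcomp V d x \<noteq> 0. \<phi> d (hcomp V d x))"
proof -
  interpret s: vector_space s by fact
  show ?thesis
    by (cases "c = 0") (simp_all add: hcomp_scale assms(2) s.scale_sum_right)
qed

lemma hsum_letter_add: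
  assumes "gmult V s F"
  shows "hsum V (us @ (x + y) # vs) F = hsum V (us @ x # vs) F + hsum V (us @ y # vs) F"
  using assms
proof (induction us arbitrary: F)
  case Nil
  show ?case
    unfolding append_Nil hsum.simps
  proof (rule sum_hcomp_additive)
    fix d x y assume "x \<in> grade V d" "y \<in> grade V d"
    then have "hsum V vs (\<lambda>w. F ((d, x + y) # w)) = hsum V vs (\<lambda>w. F ((d, x) # w) + F ((d, y) # w))"
      using gmult_add[OF Nil, of "[]"] by (intro hsum_cong_hom) simp
    then show "hsum V vs (\<lambda>w. F ((d, x + y) # w)) = hsum V vs (\<lambda>w. F ((d, x) # w)) + hsum V vs (\<lambda>w. F ((d, y) # w))"
      by (simp add: hsum_add)
  qed
next
  case (Cons z us)
  have "gmult V s (\<lambda>w. F ((d, hcomp V d z) # w))" for d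
    by (rule gmult_Cons[OF Cons.prems]) simp
  then show ?case
    by (simp add: Cons.IH sum.distrib)
qed

lemma hsum_letter_scale:
  assumes "gmult V s F" and s: "vector_space s"
  shows "hsum V (us @ smul V c x # vs) F = s c (hsum V (us @ x # vs) F)"
  using assms(1)
proof (induction us arbitrary: F)
  case Nil
  interpret s: vector_space s by fact
  have a: "Modules.additive (s c)"
    by (simp add: Modules.additive_def s.scale_right_distrib)
  show ?case
    unfolding append_Nil hsum.simps
  proof (rule sum_hcomp_scale[OF s])
    fix d x assume "x \<in> grade V d"
    then have "hsum V vs (\<lambda>w. F ((d, smul V c x) # w)) = hsum V vs (\<lambda>w. s c (F ((d, x) # w)))"
      using gmult_scale[OF Nil, of "[]"] by (intro hsum_cong_hom) simp
    then show "hsum V vs (\<lambda>w. F ((d, smul V c x) # w)) = s c (hsum V vs (\<lambda>w. F ((d, x) # w)))"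
      by (simp add: additive_hsum[OF a])
  qed
next
  case (Cons z us)
  interpret s: vector_space s by fact
  have "gmult V s (\<lambda>w. F ((d, hcomp V d z) # w))" for d
    by (rule gmult_Cons[OF Cons.prems]) simp
  then show ?case
    by (simp add: Cons.IH s.scale_sum_right)
qed

lemma hsum_hom_Cons:
  assumes "gmult V s F" "x \<in> grade V d"
  shows "hsum V (x # vs) F = hsum V vs (\<lambda>w. F ((d, x) # w))"
proof -
  have "{e. hcomp V e x \<noteq> 0} = (if x = 0 then {} else {d})"
    using hcomp_hom[OF assms(2)] by auto
  moreover have "hsum V vs (\<lambda>w. F ((d, 0) # w)) = hsum V vs (\<lambda>w. 0)"
    using gmult_zero[OF assms(1)] by (intro hsum_cong_hom) simp
  ultimately show ?thesis
    using hcomp_hom[OF assms(2)] by auto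
qed

text \<open>With \<open>hsum_letter_add\<close> and \<open>hsum_letter_scale\<close> this covers the
  three kinds of generators of \<open>sym_rel\<close>. Only the two exchanged letters are
  homogeneous; the rest of the word is arbitrary.\<close>

lemma hsum_letter_swap:
  assumes "gmsym V s F" "x \<in> grade V m" "y \<in> grade V n"
  shows "hsum V (us @ x # y # vs) F = sg (m * n) (hsum V (us @ y # x # vs) F)"
  using assms(1)
proof (induction us arbitrary: F)
  case Nil
  have F: "gmult V s F" "gsym V F" using Nil by (simp_all add: gmsym_def)
  have 1: "gmult V s (\<lambda>w. F ((m, x) # w))" and 2: "gmult V s (\<lambda>w. F ((n, y) # w))"
    using gmult_Cons[OF F(1), of "(m, x)"] gmult_Cons[OF F(1), of "(n, y)"] assms(2,3) by auto
  have "hsum V vs (\<lambda>w. F ((m, x) # (n, y) # w)) = hsum V vs (\<lambda>w. sg (m * n) (F ((n, y) # (m, x) # w)))"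
    by (rule hsum_cong_hom) (use gsym_swap[OF F(2), of "[]" _ "(m, x)" "(n, y)"] assms(2,3) in auto)
  then show ?case
    unfolding append_Nil hsum_hom_Cons[OF F(1) assms(2)] hsum_hom_Cons[OF F(1) assms(3)]
      hsum_hom_Cons[OF 1 assms(3)] hsum_hom_Cons[OF 2 assms(2)]
    by (simp add: additive_hsum[OF additive_sg])
next
  case (Cons z us)
  have "gmsym V s (\<lambda>w. F ((d, hcomp V d z) # w))" for d
    by (rule gmsym_Cons[OF Cons.prems]) simp
  then show ?case
    by (simp add: Cons.IH sg_sum)
qed

end

section \<open>Linear maps on the free space\<close>

interpretation fscale: vector_space fscale
  by (rule vector_space_fscale)

lemma keys_sum_superset:
  assumes "vector_space s" "finite S" "Poly_Mapping.keys t \<subseteq> S"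
  shows "(\<Sum>x\<in>Poly_Mapping.keys t. s (Poly_Mapping.lookup t x) (f x)) = (\<Sum>x\<in>S. s (Poly_Mapping.lookup t x) (f x))"
proof -
  interpret s: vector_space s by fact
  show ?thesis
    using assms(2,3) by (intro sum.mono_neutral_left) (auto simp: in_keys_iff)
qed

lemma linear_keys_sum:
  fixes s :: "'k::field \<Rightarrow> 'b \<Rightarrow> 'b::ab_group_add" and f :: "'x \<Rightarrow> 'b"
  assumes "vector_space s"
  shows "Vector_Spaces.linear fscale s (\<lambda>t. \<Sum>x\<in>Poly_Mapping.keys t. s (Poly_Mapping.lookup t x) (f x))"
proof -
  interpret s: vector_space s by fact
  show ?thesis
    unfolding Vector_Spaces.linear_iff
  proof (intro conjI allI assms vector_space_fscale)
    fix t t' :: "'x \<Rightarrow>\<^sub>0 'k"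
    let ?S = "Poly_Mapping.keys t \<union> Poly_Mapping.keys t'"
    let ?sum = "\<lambda>S t. \<Sum>x\<in>S. s (Poly_Mapping.lookup t x) (f x)"
    have *: "?sum (Poly_Mapping.keys r) r = ?sum ?S r" if "Poly_Mapping.keys r \<subseteq> ?S" for r
      by (rule keys_sum_superset[OF assms _ that]) simp
    have "?sum ?S (t + t') = ?sum ?S t + ?sum ?S t'"
      by (simp only: lookup_add s.scale_left_distrib sum.distrib)
    then show "?sum (Poly_Mapping.keys (t + t')) (t + t') = ?sum (Poly_Mapping.keys t) t + ?sum (Poly_Mapping.keys t') t'"
      by (simp only: *[OF keys_add] *[OF Un_upper1] *[OF Un_upper2])
  next
    fix c and t :: "'x \<Rightarrow>\<^sub>0 'k"
    have "Poly_Mapping.keys (fscale c t) \<subseteq> Poly_Mapping.keys t"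
      by (auto simp: in_keys_iff)
    from keys_sum_superset[OF assms finite_keys this]
    show "(\<Sum>x\<in>Poly_Mapping.keys (fscale c t). s (Poly_Mapping.lookup (fscale c t) x) (f x)) =
        s c (\<Sum>x\<in>Poly_Mapping.keys t. s (Poly_Mapping.lookup t x) (f x))"
      by (simp add: s.scale_sum_right)
  qed
qed

lemma linear_lin_ext: "Vector_Spaces.linear fscale fscale (lin_ext f)"
  using linear_keys_sum[OF vector_space_fscale, of f] by (simp add: lin_ext_def[abs_def])

lemma lin_ext_add: "lin_ext f (s + t) = lin_ext f s + lin_ext f t"
  and lin_ext_scale: "lin_ext f (fscale c t) = fscale c (lin_ext f t)"
  using linear_lin_ext[of f] by (simp_all add: Vector_Spaces.linear_iff)

lemma linear_sym_proj: "Vector_Spaces.linear fscale fscale (sym_proj n)"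
  unfolding sym_proj_def by (rule linear_lin_ext)

lemma cogen_keys_sum:
  assumes "vector_space (smul V)"
  shows "cogen V = (\<lambda>t. \<Sum>xs\<in>Poly_Mapping.keys t. smul V (Poly_Mapping.lookup t xs) (case xs of [x] \<Rightarrow> x | _ \<Rightarrow> 0))"
proof -
  interpret s: vector_space "smul V" by fact
  show ?thesis
    by (auto simp: fun_eq_iff cogen_def intro!: sum.cong split: list.split)
qed

lemma linear_cogen:
  assumes "vector_space (smul V)"
  shows "Vector_Spaces.linear fscale (smul V) (cogen V)"
  unfolding cogen_keys_sum[OF assms] by (rule linear_keys_sum[OF assms])

lemma cogen_mon:
  assumes "vector_space (smul V)"
  shows "cogen V (mon xs) = (case xs of [x] \<Rightarrow> x | _ \<Rightarrow> 0)"
proof -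
  interpret s: vector_space "smul V" by fact
  show ?thesis
    by (simp add: cogen_keys_sum[OF assms])
qed

lemma free_expand: "(\<Sum>x\<in>Poly_Mapping.keys t. fscale (Poly_Mapping.lookup t x) (mon x)) = t"
proof (rule poly_mapping_eqI)
  fix y
  have "Poly_Mapping.lookup (\<Sum>x\<in>Poly_Mapping.keys t. fscale (Poly_Mapping.lookup t x) (mon x)) y =
      (\<Sum>x\<in>Poly_Mapping.keys t. if x = y then Poly_Mapping.lookup t x else 0)"
    unfolding lookup_sum by (intro sum.cong refl) (simp add: lookup_single when_def)
  then show "Poly_Mapping.lookup (\<Sum>x\<in>Poly_Mapping.keys t. fscale (Poly_Mapping.lookup t x) (mon x)) y = Poly_Mapping.lookup t y"
    by (simp add: in_keys_iff)
qed

lemma linear_keys_expand: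
  assumes "Vector_Spaces.linear fscale s \<Phi>"
  shows "\<Phi> t = (\<Sum>x\<in>Poly_Mapping.keys t. s (Poly_Mapping.lookup t x) (\<Phi> (mon x)))"
proof -
  interpret \<Phi>: Vector_Spaces.linear fscale s \<Phi> by fact
  have "\<Phi> t = \<Phi> (\<Sum>x\<in>Poly_Mapping.keys t. fscale (Poly_Mapping.lookup t x) (mon x))"
    by (simp only: free_expand)
  then show ?thesis
    by (simp only: \<Phi>.sum \<Phi>.scale)
qed

lemma linear_mon_eqI:
  assumes "Vector_Spaces.linear fscale s \<Phi>" "Vector_Spaces.linear fscale s \<Psi>"
    and "\<And>x. \<Phi> (mon x) = \<Psi> (mon x)"
  shows "\<Phi> t = \<Psi> t"
  by (simp only: linear_keys_expand[OF assms(1), of t] linear_keys_expand[OF assms(2), of t] assms(3))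

text \<open>Linear maps with kernel \<open>sym_rel V\<close> turn congruences modulo \<open>sym_rel V\<close> into equations.\<close>

definition quot_map :: "('x \<Rightarrow>\<^sub>0 'k::field) set \<Rightarrow> ('x \<Rightarrow>\<^sub>0 'k) \<Rightarrow> ('x \<Rightarrow>\<^sub>0 'k)" where
  "quot_map S = (SOME \<pi>. Vector_Spaces.linear fscale fscale \<pi> \<and> (\<forall>t. \<pi> t = 0 \<longleftrightarrow> t \<in> S))"

lemma quot_map:
  fixes S :: "('x \<Rightarrow>\<^sub>0 'k::field) set"
  assumes S: "module.subspace fscale S"
  shows "Vector_Spaces.linear fscale fscale (quot_map S)" "quot_map S t = 0 \<longleftrightarrow> t \<in> S"
proof -
  interpret vector_space_pair fscale fscale ..
  have "Vector_Spaces.linear fscale fscale (\<lambda>x. x)"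
    by (simp add: Vector_Spaces.linear_iff vector_space_fscale)
  then obtain g where g: "range g \<subseteq> S" "Vector_Spaces.linear fscale fscale g" "\<forall>v\<in>S. g v = v"
    using linear_exists_left_inverse_on[of "\<lambda>x. x" S] S by auto
  \<comment> \<open>\<open>g\<close> is a linear projection onto \<open>S\<close>, so the
    complementary projection has kernel exactly \<open>S\<close>.\<close>
  have "Vector_Spaces.linear fscale fscale (\<lambda>x. x - g x)"
    using g(2) by (simp add: Vector_Spaces.linear_iff fscale.scale_right_diff_distrib)
  moreover have "t - g t = 0 \<longleftrightarrow> t \<in> S" for t
  proof
    assume "t - g t = 0"
    then have "t = g t" by simp
    moreover have "g t \<in> S" using g(1) by blast
    ultimately show "t \<in> S" by (rule ssubst)
  qed (use g(3) in simp)
  ultimately have "\<exists>\<pi> :: ('x \<Rightarrow>\<^sub>0 'k) \<Rightarrow> ('x \<Rightarrow>\<^sub>0 'k). Vector_Spaces.linear fscale fscale \<pi> \<and> (\<forall>t. \<pi> t = 0 \<longleftrightarrow> t \<in> S)"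
    by (intro exI[of _ "\<lambda>x. x - g x"]) simp
  from someI_ex[OF this] show "Vector_Spaces.linear fscale fscale (quot_map S)" "quot_map S t = 0 \<longleftrightarrow> t \<in> S"
    by (simp_all add: quot_map_def)
qed

abbreviation "symq V \<equiv> quot_map (sym_rel V)"
abbreviation "symq2 V \<equiv> quot_map (sym_rel2 V)"

lemma subspace_sym_rel: "module.subspace fscale (sym_rel V)"
  and subspace_sym_rel2: "module.subspace fscale (sym_rel2 V)"
  and subspace_sym_grade: "module.subspace fscale (sym_grade V n)"
  by (simp_all add: sym_rel_def sym_rel2_def sym_grade_def)

lemmas linear_symq = quot_map(1)[OF subspace_sym_rel]
  and symq_eq_0 = quot_map(2)[OF subspace_sym_rel]
  and linear_symq2 = quot_map(1)[OF subspace_sym_rel2]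
  and symq2_eq_0 = quot_map(2)[OF subspace_sym_rel2]

lemma quot_map_eq_iff:
  assumes "module.subspace fscale S"
  shows "quot_map S s = quot_map S t \<longleftrightarrow> s - t \<in> S"
proof -
  interpret q: Vector_Spaces.linear fscale fscale "quot_map S"
    by (rule quot_map(1)[OF assms])
  have "quot_map S s = quot_map S t \<longleftrightarrow> quot_map S (s - t) = 0"
    by (simp add: q.diff)
  then show ?thesis
    by (simp only: quot_map(2)[OF assms])
qed

lemma sym_eq_iff: "sym_eq V s t \<longleftrightarrow> symq V s = symq V t"
  by (simp add: sym_eq_def quot_map_eq_iff[OF subspace_sym_rel])

lemma linear_compose_app:
  "Vector_Spaces.linear s1 s2 f \<Longrightarrow> Vector_Spaces.linear s2 s3 g \<Longrightarrow> Vector_Spaces.linear s1 s3 (\<lambda>x. g (f x))"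
  by (simp add: Vector_Spaces.linear_iff)

section \<open>Linear maps on the symmetric coalgebra\<close>

lemma sym_rel_add: "mon (us @ (x + y) # vs) - mon (us @ x # vs) - mon (us @ y # vs) \<in> sym_rel V"
  and sym_rel_scale: "mon (us @ smul V c x # vs) - fscale c (mon (us @ x # vs)) \<in> sym_rel V"
  unfolding sym_rel_def by (rule fscale.span_base, blast)+

lemma sym_rel_swap:
  "x \<in> grade V m \<Longrightarrow> y \<in> grade V n \<Longrightarrow>
    mon (us @ x # y # vs) - fscale ((-1) powi (m * n)) (mon (us @ y # x # vs)) \<in> sym_rel V"
  unfolding sym_rel_def by (rule fscale.span_base, blast)

lemma sym_rel_kernelI:
  assumes \<Phi>: "Vector_Spaces.linear fscale s \<Phi>"
    and add: "\<And>us x y vs. \<Phi> (mon (us @ (x + y) # vs)) = \<Phi> (mon (us @ x # vs)) + \<Phi> (mon (us @ y # vs))"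
    and scale: "\<And>us c x vs. \<Phi> (mon (us @ smul V c x # vs)) = s c (\<Phi> (mon (us @ x # vs)))"
    and swap: "\<And>us x y vs m n. x \<in> grade V m \<Longrightarrow> y \<in> grade V n \<Longrightarrow>
      \<Phi> (mon (us @ x # y # vs)) = sg (m * n) (\<Phi> (mon (us @ y # x # vs)))"
    and "t \<in> sym_rel V"
  shows "\<Phi> t = 0"
proof -
  interpret \<Phi>: Vector_Spaces.linear fscale s \<Phi> by fact
  have s: "vector_space s" ..
  show ?thesis
    using assms(5) unfolding sym_rel_def
  proof (rule \<Phi>.eq_0_on_span[rotated], elim UnE CollectE exE conjE)
    show "\<Phi> r = 0" if "r = mon (us @ (x + y) # vs) - mon (us @ x # vs) - mon (us @ y # vs)" for r us x y vs
      unfolding that \<Phi>.diff add by simp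
    show "\<Phi> r = 0" if "r = mon (us @ smul V c x # vs) - fscale c (mon (us @ x # vs))" for r us c x vs
      unfolding that \<Phi>.diff \<Phi>.scale scale by simp
    show "\<Phi> r = 0" if "r = mon (us @ x # y # vs) - fscale ((-1) powi (m * n)) (mon (us @ y # x # vs))"
      "x \<in> grade V m" "y \<in> grade V n" for r us x y vs m n
      unfolding that(1) \<Phi>.diff \<Phi>.scale swap[OF that(2,3)] by (simp add: scale_powi_minus_one[OF s])
  qed
qed

text \<open>Together with \<open>sym_rel_kernel\<close>, which goes the other way, this translates
  between linear maps vanishing on \<open>sym_rel\<close> and graded symmetric multilinear functions
  of homogeneous words.\<close>

lemma gmsym_mon:
  assumes \<Phi>: "Vector_Spaces.linear fscale s \<Phi>" and 0: "\<And>t. t \<in> sym_rel V \<Longrightarrow> \<Phi> t = 0"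
  shows "gmsym V s (\<lambda>w. \<Phi> (mon (map snd w)))"
proof -
  interpret \<Phi>: Vector_Spaces.linear fscale s \<Phi> by fact
  have "gmult V s (\<lambda>w. \<Phi> (mon (map snd w)))"
  proof (rule gmultI)
    fix us vs and d :: int and x y
    show "\<Phi> (mon (map snd (us @ (d, x + y) # vs))) =
        \<Phi> (mon (map snd (us @ (d, x) # vs))) + \<Phi> (mon (map snd (us @ (d, y) # vs)))"
      using 0[OF sym_rel_add[where us = "map snd us" and x = x and y = y and vs = "map snd vs"]]
      by (simp add: \<Phi>.diff diff_diff_eq \<Phi>.add)
    show "\<Phi> (mon (map snd (us @ (d, smul V c x) # vs))) = s c (\<Phi> (mon (map snd (us @ (d, x) # vs))))" for c
      using 0[OF sym_rel_scale[where us = "map snd us" and x = x and c = c and vs = "map snd vs"]]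
      by (simp add: \<Phi>.diff \<Phi>.scale)
  qed
  moreover have "gsym V (\<lambda>w. \<Phi> (mon (map snd w)))"
  proof (rule gsymI)
    fix us vs x y
    assume "snd x \<in> grade V (fst x)" "snd y \<in> grade V (fst y)"
    from 0[OF sym_rel_swap[OF this, of "map snd us" "map snd vs"]]
    show "\<Phi> (mon (map snd (us @ x # y # vs))) = sg (fst x * fst y) (\<Phi> (mon (map snd (us @ y # x # vs))))"
      by (simp add: \<Phi>.diff \<Phi>.scale scale_powi_minus_one[OF \<Phi>.vs2.vector_space_axioms])
  qed
  ultimately show ?thesis
    by (simp add: gmsym_def)
qed

lemma gmsym_symq: "gmsym V fscale (\<lambda>w. symq V (mon (map snd w)))"
  by (rule gmsym_mon[OF linear_symq]) (simp add: symq_eq_0)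

context graded_space
begin

lemma sym_rel_kernel:
  assumes \<Phi>: "Vector_Spaces.linear fscale s \<Phi>" and F: "gmsym V s F"
    and eq: "\<And>xs. \<Phi> (mon xs) = hsum V xs F" and "t \<in> sym_rel V"
  shows "\<Phi> t = 0"
proof (rule sym_rel_kernelI[OF \<Phi> _ _ _ assms(4)])
  have s: "vector_space s" using \<Phi> by (simp add: Vector_Spaces.linear_iff)
  have F': "gmult V s F" using F by (simp add: gmsym_def)
  show "\<Phi> (mon (us @ (x + y) # vs)) = \<Phi> (mon (us @ x # vs)) + \<Phi> (mon (us @ y # vs))" for us x y vs
    unfolding eq by (rule hsum_letter_add[OF F'])
  show "\<Phi> (mon (us @ smul V c x # vs)) = s c (\<Phi> (mon (us @ x # vs)))" for us c x vs
    unfolding eq by (rule hsum_letter_scale[OF F' s])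
  show "\<Phi> (mon (us @ x # y # vs)) = sg (m * n) (\<Phi> (mon (us @ y # x # vs)))"
    if "x \<in> grade V m" "y \<in> grade V n" for us x y vs m n
    unfolding eq by (rule hsum_letter_swap[OF F that])
qed

text \<open>A map that kills the relations is additive in each letter, so summing over homogeneous
  components restores the letter. The prefix \<open>us\<close> collects the letters already
  treated.\<close>

lemma hsum_mon:
  assumes \<Phi>: "Vector_Spaces.linear fscale s \<Phi>" and 0: "\<And>t. t \<in> sym_rel V \<Longrightarrow> \<Phi> t = 0"
  shows "hsum V xs (\<lambda>w. \<Phi> (mon (us @ map snd w))) = \<Phi> (mon (us @ xs))"
proof (induction xs arbitrary: us)
  case (Cons x xs)
  interpret \<Phi>: Vector_Spaces.linear fscale s \<Phi> by fact
  have add: "\<Phi> (mon (us @ (x + y) # xs)) = \<Phi> (mon (us @ x # xs)) + \<Phi> (mon (us @ y # xs))" for x y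
    using 0[OF sym_rel_add[where us = us and x = x and y = y and vs = xs]] by (simp add: \<Phi>.diff diff_diff_eq \<Phi>.add)
  then have "Modules.additive (\<lambda>x. \<Phi> (mon (us @ x # xs)))"
    by (simp add: Modules.additive_def)
  from Modules.additive.sum[OF this, of "\<lambda>d. hcomp V d x" "{d. hcomp V d x \<noteq> 0}"]
  have "(\<Sum>d | hcomp V d x \<noteq> 0. \<Phi> (mon (us @ hcomp V d x # xs))) = \<Phi> (mon (us @ x # xs))"
    by (simp add: sum_hcomp)
  then show ?case
    using Cons.IH[of "us @ [hcomp V _ x]"] by simp
qed simp


end

section \<open>Tensor products, comultiplication and codifferential\<close>

lemma tens_mon [simp]: "tens (mon x) (mon y) = mon (x, y)"
  by (simp add: tens_def)

lemma linear_tens_left: "Vector_Spaces.linear fscale fscale (\<lambda>s. tens s t)"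
  unfolding tens_def by (rule linear_lin_ext)

lemma linear_tens_right: "Vector_Spaces.linear fscale fscale (tens s)"
  unfolding Vector_Spaces.linear_iff tens_def lin_ext_def[of _ s] lin_ext_add lin_ext_scale
  by (simp add: vector_space_fscale fscale.scale_right_distrib sum.distrib fscale.scale_sum_right
      fscale.scale_left_commute[of c for c] mult.commute del: fscale.scale_scale)

lemma tens_sym_rel:
  "r \<in> sym_rel V \<Longrightarrow> tens r t \<in> sym_rel2 V" "r \<in> sym_rel V \<Longrightarrow> tens t r \<in> sym_rel2 V"
  unfolding sym_rel2_def by (rule fscale.span_base, blast)+

text \<open>\<open>\<Phi>\<close> depends only on the class of its argument, so it suffices that
  \<open>F\<close> is multilinear and symmetric modulo \<open>sym_rel W\<close>.\<close>

lemma gmsym_factor: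
  assumes \<Phi>: "Vector_Spaces.linear fscale s \<Phi>" and 0: "\<And>t. t \<in> sym_rel W \<Longrightarrow> \<Phi> t = 0"
    and F: "gmsym V fscale (\<lambda>u. symq W (F u))"
  shows "gmsym V s (\<lambda>u. \<Phi> (F u))"
proof -
  interpret \<Phi>: Vector_Spaces.linear fscale s \<Phi> by fact
  interpret q: Vector_Spaces.linear fscale fscale "symq W" by (rule linear_symq)
  have eq: "\<Phi> a = \<Phi> b" if "symq W a = symq W b" for a b
    using that 0[of "a - b"] by (simp add: quot_map_eq_iff[OF subspace_sym_rel] \<Phi>.diff)
  have F': "gmult V fscale (\<lambda>u. symq W (F u))" "gsym V (\<lambda>u. symq W (F u))"
    using F by (simp_all add: gmsym_def)
  have "gmult V s (\<lambda>u. \<Phi> (F u))"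
    unfolding \<Phi>.add[symmetric] \<Phi>.scale[symmetric]
  proof (rule gmultI)
    fix us d vs x y assume *: "gword V us" "gword V vs" "x \<in> grade V d" "y \<in> grade V d"
    show "\<Phi> (F (us @ (d, x + y) # vs)) = \<Phi> (F (us @ (d, x) # vs)) + \<Phi> (F (us @ (d, y) # vs))"
      unfolding \<Phi>.add[symmetric] by (rule eq) (simp only: gmult_add[OF F'(1) *] q.add)
  next
    fix us d vs x c assume *: "gword V us" "gword V vs" "x \<in> grade V d"
    show "\<Phi> (F (us @ (d, smul V c x) # vs)) = s c (\<Phi> (F (us @ (d, x) # vs)))"
      unfolding \<Phi>.scale[symmetric] by (rule eq) (simp only: gmult_scale[OF F'(1) *] q.scale)
  qed
  moreover have "gsym V (\<lambda>u. \<Phi> (F u))"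
  proof (rule gsymI)
    fix us x y vs
    assume *: "gword V us" "gword V vs" "snd x \<in> grade V (fst x)" "snd y \<in> grade V (fst y)"
    show "\<Phi> (F (us @ x # y # vs)) = sg (fst x * fst y) (\<Phi> (F (us @ y # x # vs)))"
      unfolding linear_sg[OF \<Phi>, symmetric] by (rule eq) (simp only: gsym_swap[OF F'(2) *] linear_sg[OF linear_symq])
  qed
  ultimately show ?thesis
    by (simp add: gmsym_def)
qed

lemma gmsym2_tens:
  assumes "gmsym V fscale (\<lambda>u. symq W (F u))"
  shows "gmsym2 V fscale (\<lambda>u v. symq2 W (tens (F u) (F v)))"
proof (rule gmsym2I)
  show "gmsym V fscale (\<lambda>u. symq2 W (tens (F u) (F v)))" for v
    by (rule gmsym_factor[OF linear_compose_app[OF linear_tens_left linear_symq2] _ assms])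
      (simp add: symq2_eq_0 tens_sym_rel)
  show "gmsym V fscale (\<lambda>v. symq2 W (tens (F u) (F v)))" for u
    by (rule gmsym_factor[OF linear_compose_app[OF linear_tens_right linear_symq2] _ assms])
      (simp add: symq2_eq_0 tens_sym_rel)
qed

lemma gmsym2_symq2: "gmsym2 V fscale (\<lambda>u v. symq2 V (mon (map snd u, map snd v)))"
  using gmsym2_tens[OF gmsym_symq, of V] by simp

text \<open>Used with \<open>m = 0\<close> for the comultiplication and with \<open>m = 1\<close>
  for the codifferential, which consumes at least one letter.\<close>

lemma sum_Sh_le:
  assumes "vector_space (s :: 'k::field \<Rightarrow> 'c::ab_group_add \<Rightarrow> 'c)"
  shows "(\<Sum>k\<in>{m..length w}. \<Sum>\<sigma>\<in>Sh k (length w - k).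
      s (koszul_sign (map fst w) \<sigma>) (g (take k (permute_list \<sigma> w)) (drop k (permute_list \<sigma> w)))) =
     spsum w (\<lambda>u v. if m \<le> length u then g u v else 0)"
proof -
  have sum: "spsum w (\<lambda>u v. \<Sum>k\<in>K. f k u v) = (\<Sum>k\<in>K. spsum w (f k))" if "finite K" for K and f :: "nat \<Rightarrow> _ \<Rightarrow> _ \<Rightarrow> 'c"
    using that by (induction K rule: finite_induct) (simp_all add: spsum_add)
  have "(\<Sum>k\<in>{m..length w}. \<Sum>\<sigma>\<in>Sh k (length w - k).
      s (koszul_sign (map fst w) \<sigma>) (g (take k (permute_list \<sigma> w)) (drop k (permute_list \<sigma> w)))) =
      (\<Sum>k\<in>{m..length w}. spsum w (\<lambda>u v. if length u = k then g u v else 0))"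
    by (intro sum.cong refl sum_Sh[OF assms]) simp
  also have "\<dots> = spsum w (\<lambda>u v. \<Sum>k\<in>{m..length w}. if length u = k then g u v else 0)"
    by (rule sum[symmetric]) simp
  also have "\<dots> = spsum w (\<lambda>u v. if m \<le> length u then g u v else 0)"
    by (rule spsum_cong) auto
  finally show ?thesis .
qed

lemma permute_list_map_Sh:
  "\<sigma> \<in> Sh k (length w - k) \<Longrightarrow> k \<le> length w \<Longrightarrow> permute_list \<sigma> (map f w) = map f (permute_list \<sigma> w)"
  by (rule permute_list_map) (simp add: Sh_def)

lemma comult_mon: "comult V (mon xs) = hsum V xs (\<lambda>w. spsum w (\<lambda>u v. mon (map snd u, map snd v)))"
proof -
  have "(\<Sum>k\<le>length w. \<Sum>\<sigma>\<in>Sh k (length w - k). fscale (koszul_sign (map fst w) \<sigma>)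
      (mon (take k (permute_list \<sigma> (map snd w)), drop k (permute_list \<sigma> (map snd w))))) =
      spsum w (\<lambda>u v. (mon (map snd u, map snd v) :: _ \<Rightarrow>\<^sub>0 'b))" for w :: "'a gword"
    unfolding atMost_atLeast0
    using sum_Sh_le[OF vector_space_fscale, where m = 0 and w = w and g = "\<lambda>u v. mon (map snd u, map snd v)"]
    by (simp add: permute_list_map_Sh take_map drop_map cong: sum.cong_simp)
  then show ?thesis
    by (simp add: comult_def hom_expand_eq_hsum)
qed

definition Qw :: "('k::field, 'a::ab_group_add, 'm) dgla_data_scheme \<Rightarrow> 'a gword \<Rightarrow> 'a" where
  "Qw L w = Q_str L (map fst w) (map snd w)"

lemma sum_Q_comp:
  "(\<Sum>j = 1..length w. Q_comp L (length w) j (map fst w) (map snd w)) =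
    spsum w (\<lambda>u v. if u = [] then 0 else mon (Qw L u # map snd v))"
proof -
  let ?n = "length w"
  have "(\<Sum>j = 1..?n. Q_comp L ?n j (map fst w) (map snd w)) =
      (\<Sum>k\<in>{1..?n}. \<Sum>\<sigma>\<in>Sh k (?n - k). fscale (koszul_sign (map fst w) \<sigma>)
        (mon (Qw L (take k (permute_list \<sigma> w)) # map snd (drop k (permute_list \<sigma> w)))))"
  \<comment> \<open>\<open>j\<close> is the length of the resulting word, so
    \<open>n + 1 - j\<close> letters are consumed to produce one new letter.\<close>
  proof (rule sum.reindex_bij_witness[of _ "\<lambda>k. ?n + 1 - k" "\<lambda>j. ?n + 1 - j"])
    fix j assume j: "j \<in> {1..?n}"
    let ?k = "?n + 1 - j"
    have k: "j - 1 = ?n - ?k" "?k \<le> ?n" using j by auto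
    show "(\<Sum>\<sigma>\<in>Sh ?k (?n - ?k). fscale (koszul_sign (map fst w) \<sigma>)
        (mon (Qw L (take ?k (permute_list \<sigma> w)) # map snd (drop ?k (permute_list \<sigma> w))))) =
        Q_comp L ?n j (map fst w) (map snd w)"
      unfolding Q_comp_def Let_def Qw_def k(1)
      by (intro sum.cong refl) (simp only: permute_list_map_Sh[OF _ k(2)] take_map drop_map)
  qed auto
  also have "\<dots> = spsum w (\<lambda>u v. if 1 \<le> length u then mon (Qw L u # map snd v) else 0)"
    by (rule sum_Sh_le[OF vector_space_fscale])
  also have "\<dots> = spsum w (\<lambda>u v. if u = [] then 0 else mon (Qw L u # map snd v))"
    by (rule spsum_cong) (auto simp: Suc_le_eq)
  finally show ?thesis .
qed

lemma codiff_mon: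
  "codiff L (mon xs) = hsum (shift L) xs (\<lambda>w. spsum w (\<lambda>u v. if u = [] then 0 else mon (Qw L u # map snd v)))"
  by (simp add: codiff_def hom_expand_eq_hsum flip: sum_Q_comp)

section \<open>Exponentials and coderivations\<close>

text \<open>\<open>esum f w g\<close> evaluates \<open>g\<close> on the image of \<open>w\<close> under the coalgebra morphism with structure
  maps \<open>f\<close>; the blocks of a partition of \<open>w\<close> are ordered by their first letters.\<close>

function esum :: "('a gword \<Rightarrow> 'b) \<Rightarrow> 'a gword \<Rightarrow> ('b gword \<Rightarrow> 'c::ab_group_add) \<Rightarrow> 'c" where
  "esum f [] g = g []"
| "esum f (x # w) g = spsum w (\<lambda>u v. esum f v (\<lambda>t. g ((wt (x # u), f (x # u)) # t)))"
  by pat_completeness auto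
termination by (relation "measure (\<lambda>(f, w, g). length w)") auto

text \<open>\<open>qsum q w g\<close> evaluates \<open>g\<close> on the image of \<open>w\<close> under the coderivation of degree \<open>1\<close> with
  structure maps \<open>q\<close>.\<close>

primrec qsum :: "('a gword \<Rightarrow> 'a) \<Rightarrow> 'a gword \<Rightarrow> ('a gword \<Rightarrow> 'c::ab_group_add) \<Rightarrow> 'c" where
  "qsum q [] g = 0"
| "qsum q (x # w) g = spsum w (\<lambda>u v. g ((wt (x # u) + 1, q (x # u)) # v)) + sg (fst x) (qsum q w (\<lambda>t. g (x # t)))"

lemma qsum_cong_strong:
  assumes "\<And>w. gword V w \<Longrightarrow> q w \<in> grade V (wt w + 1)"
    and "\<And>t. \<lbrakk>wt t = wt w + 1; gword V w \<Longrightarrow> gword V t\<rbrakk> \<Longrightarrow> g t = g' t"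
  shows "qsum q w g = qsum q w g'"
  using assms(2)
proof (induction w arbitrary: g g')
  case (Cons x w)
  have "spsum w (\<lambda>u v. g ((wt (x # u) + 1, q (x # u)) # v)) = spsum w (\<lambda>u v. g' ((wt (x # u) + 1, q (x # u)) # v))"
  proof (rule spsum_cong_strong, rule Cons.prems)
    fix u v assume uv: "wt u + wt v = wt w" "set u \<union> set v = set w"
    then show "wt ((wt (x # u) + 1, q (x # u)) # v) = wt (x # w) + 1" by simp
    assume "gword V (x # w)"
    then have "gword V (x # u)" "gword V v" using uv(2) by (auto simp: gword_def)
    then show "gword V ((wt (x # u) + 1, q (x # u)) # v)"
      using assms(1)[of "x # u"] by simp
  qed
  moreover have "qsum q w (\<lambda>t. g (x # t)) = qsum q w (\<lambda>t. g' (x # t))"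
    by (rule Cons.IH, rule Cons.prems) simp_all
  ultimately show ?case by simp
qed simp

text \<open>Homogeneity becomes void for the trivial grading in which every piece is the whole type;
  only the weight condition remains, for arbitrary \<open>q\<close>.\<close>

lemma qsum_cong_wt:
  fixes w :: "'a::ab_group_add gword"
  shows "(\<And>t. wt t = wt w + 1 \<Longrightarrow> g t = g' t) \<Longrightarrow> qsum q w g = qsum q w g'"
  by (rule qsum_cong_strong[of "\<lparr>smul = \<lambda>_ x. x, grade = \<lambda>_. UNIV\<rparr>"]) simp_all

lemma qsum_add: "qsum q w (\<lambda>t. g t + g' t) = qsum q w g + qsum q w g'"
  by (induction w arbitrary: g g') (simp_all add: spsum_add sg_add algebra_simps)

lemma additive_qsum: "Modules.additive f \<Longrightarrow> f (qsum q w g) = qsum q w (\<lambda>t. f (g t))"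
  by (induction w arbitrary: g)
    (simp_all add: additive_spsum Modules.additive.add Modules.additive.zero sg_commute_additive)

lemma qsum_sg: "qsum q w (\<lambda>t. sg n (g t)) = sg n (qsum q w g)"
  by (simp add: additive_qsum[OF additive_sg])

lemma qsum_zero: "qsum q w (\<lambda>t. 0) = (0 :: 'c::ab_group_add)"
  by (induction w) simp_all

lemma qsum_Nil: "qsum q w (\<lambda>t. if t = [] then z else 0) = (0 :: 'c::ab_group_add)"
  by (cases w) (simp_all add: qsum_zero)

text \<open>The identity Delta Q = (Q (x) 1 + 1 (x) Q) Delta evaluated on \<open>g\<close>; the sign
  \<open>sg (wt u)\<close> comes from moving the degree one map \<open>q\<close> past the left
  half.\<close>

lemma qsum_coderivation:
  fixes w :: "'a::ab_group_add gword"
  shows "qsum q w (\<lambda>t. spsum t g) = spsum w (\<lambda>u v. qsum q u (\<lambda>s. g s v) + sg (wt u) (qsum q v (\<lambda>t. g u t)))"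
proof (induction w arbitrary: g)
  case (Cons x w)
  let ?d = "fst x"
  let ?Q = "\<lambda>u. (wt (x # u) + 1, q (x # u))"
  \<comment> \<open>The case in which the produced letter goes right: the block consumed by
    \<open>q\<close> is exchanged with the left half. Since \<open>q\<close> has degree one, the
    produced letter is one degree higher than that block, which accounts for the extra
    \<open>sg (wt u)\<close>.\<close>
  have swap: "spsum w (\<lambda>u v. spsum v (\<lambda>a b. sg (wt (?Q u # []) * wt a) (g a (?Q u # b)))) =
      spsum w (\<lambda>u v. sg (?d * wt u) (sg (wt u) (spsum v (\<lambda>a b. g u (?Q a # b)))))"
  proof -
    have "spsum w (\<lambda>u v. sg (?d * wt u) (sg (wt u) (spsum v (\<lambda>a b. g u (?Q a # b))))) =
        spsum w (\<lambda>u v. spsum v (\<lambda>a b. sg (?d * wt u) (sg (wt u) (g u (?Q a # b)))))"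
      by (simp only: spsum_sg)
    also have "\<dots> = spsum w (\<lambda>u v. spsum v (\<lambda>a b. sg (wt u * wt a) (sg (?d * wt a) (sg (wt a) (g a (?Q u # b))))))"
      by (rule spsum_swap_left)
    also have "\<dots> = spsum w (\<lambda>u v. spsum v (\<lambda>a b. sg (wt (?Q u # []) * wt a) (g a (?Q u # b))))"
      unfolding sg_sg by (intro spsum_cong refl sg_parity) auto
    finally show ?thesis by (rule sym)
  qed
  have wt: "qsum q u (\<lambda>s. sg (?d * wt s) (g s (x # v))) = sg ?d (sg (?d * wt u) (qsum q u (\<lambda>s. g s (x # v))))" for u v
  proof -
    have "qsum q u (\<lambda>s. sg (?d * wt s) (g s (x # v))) = qsum q u (\<lambda>s. sg ?d (sg (?d * wt u) (g s (x # v))))"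
      unfolding sg_sg by (intro qsum_cong_wt sg_parity) auto
    then show ?thesis by (simp only: qsum_sg)
  qed
  have "qsum q (x # w) (\<lambda>t. spsum t g) =
      spsum w (\<lambda>u v. spsum v (\<lambda>a b. g (?Q u # a) b)) +
      spsum w (\<lambda>u v. spsum v (\<lambda>a b. sg (wt (?Q u # []) * wt a) (g a (?Q u # b)))) +
      sg ?d (qsum q w (\<lambda>t. spsum t (\<lambda>a b. g (x # a) b))) +
      sg ?d (qsum q w (\<lambda>t. spsum t (\<lambda>a b. sg (?d * wt a) (g a (x # b)))))"
    by (simp add: spsum_add qsum_add sg_add)
  also have "\<dots> = spsum w (\<lambda>s v. spsum s (\<lambda>u a. g (?Q u # a) v)) +
      spsum w (\<lambda>u v. sg (?d * wt u) (sg (wt u) (spsum v (\<lambda>a b. g u (?Q a # b))))) +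
      (spsum w (\<lambda>u v. sg ?d (qsum q u (\<lambda>s. g (x # s) v))) +
       spsum w (\<lambda>u v. sg ?d (sg (wt u) (qsum q v (\<lambda>t. g (x # u) t))))) +
      (spsum w (\<lambda>u v. sg ?d (sg ?d (sg (?d * wt u) (qsum q u (\<lambda>s. g s (x # v)))))) +
       spsum w (\<lambda>u v. sg ?d (sg (wt u) (sg (?d * wt u) (qsum q v (\<lambda>t. g u (x # t)))))))"
    unfolding swap Cons.IH spsum_coassoc[of w "\<lambda>u a v. g (?Q u # a) v"] by (simp only: spsum_add spsum_sg sg_add wt qsum_sg)
  also have "\<dots> = spsum (x # w) (\<lambda>u v. qsum q u (\<lambda>s. g s v) + sg (wt u) (qsum q v (\<lambda>t. g u t)))"
  proof -
    have 1: "sg ?d (sg (wt u) a) = sg (wt (x # u)) a" "sg ?d (sg ?d (sg (?d * wt u) a)) = sg (?d * wt u) a"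
      "sg (wt (x # u)) (sg (?d * wt u) a) = sg (?d * wt u) (sg (wt u) (sg ?d a))" for u :: "'a gword" and a :: 'b
      unfolding sg_sg by (auto intro!: sg_parity)
    show ?thesis
      unfolding 1 spsum.simps qsum.simps sg_add spsum_add by (simp only: add_ac)
  qed
  finally show ?case .
qed simp

lemma esum_add: "esum f w (\<lambda>t. g t + g' t) = esum f w g + esum f w g'"
proof (induction w arbitrary: g g' rule: length_induct)
  case (1 w)
  then show ?case
  proof (cases w)
    case (Cons x w')
    have "spsum w' (\<lambda>u v. esum f v (\<lambda>t. g ((wt (x # u), f (x # u)) # t) + g' ((wt (x # u), f (x # u)) # t))) =
       spsum w' (\<lambda>u v. esum f v (\<lambda>t. g ((wt (x # u), f (x # u)) # t)) + esum f v (\<lambda>t. g' ((wt (x # u), f (x # u)) # t)))"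
      by (rule spsum_cong) (use 1 Cons in auto)
    then show ?thesis by (simp only: Cons esum.simps spsum_add)
  qed simp
qed

lemma esum_zero [simp]: "esum f w (\<lambda>t. 0) = 0"
  using esum_add[of f w "\<lambda>t. 0" "\<lambda>t. 0"] by simp

lemma additive_esum:
  assumes "Modules.additive \<phi>"
  shows "\<phi> (esum f w g) = esum f w (\<lambda>t. \<phi> (g t))"
proof (induction w arbitrary: g rule: length_induct)
  case (1 w)
  then show ?case
  proof (cases w)
    case (Cons x w')
    have "spsum w' (\<lambda>u v. \<phi> (esum f v (\<lambda>t. g ((wt (x # u), f (x # u)) # t)))) =
       spsum w' (\<lambda>u v. esum f v (\<lambda>t. \<phi> (g ((wt (x # u), f (x # u)) # t))))"
      by (rule spsum_cong) (use 1 Cons in auto)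
    then show ?thesis by (simp only: Cons esum.simps additive_spsum[OF assms])
  qed simp
qed

lemma esum_sg: "esum f w (\<lambda>t. sg n (g t)) = sg n (esum f w g)"
  by (simp add: additive_esum[OF additive_sg])

lemma esum_cong_strong:
  assumes f: "\<And>w. gword V w \<Longrightarrow> f w \<in> grade W (wt w)"
    and g: "\<And>t. \<lbrakk>wt t = wt w; gword V w \<Longrightarrow> gword W t\<rbrakk> \<Longrightarrow> g t = g' t"
  shows "esum f w g = esum f w g'"
  using g
proof (induction w arbitrary: g g' rule: length_induct)
  case (1 w)
  show ?case
  proof (cases w)
    case Nil
    have "g [] = g' []"
      by (rule 1(2)) (simp_all add: Nil)
    then show ?thesis by (simp add: Nil)
  next
    case (Cons x w')
    have "spsum w' (\<lambda>u v. esum f v (\<lambda>t. g ((wt (x # u), f (x # u)) # t))) =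
       spsum w' (\<lambda>u v. esum f v (\<lambda>t. g' ((wt (x # u), f (x # u)) # t)))"
    proof (rule spsum_cong_strong)
      fix u v assume uv: "length u + length v = length w'" "wt u + wt v = wt w'" "set u \<union> set v = set w'"
      have "g ((wt (x # u), f (x # u)) # t) = g' ((wt (x # u), f (x # u)) # t)"
        if t: "wt t = wt v" "gword V v \<Longrightarrow> gword W t" for t
      proof (rule 1(2))
        show "wt ((wt (x # u), f (x # u)) # t) = wt w" using t(1) uv(2) Cons by simp
        assume "gword V w"
        then have "gword V (x # u)" "gword V v" using uv(3) Cons by (auto simp: gword_def)
        then show "gword W ((wt (x # u), f (x # u)) # t)" using f[of "x # u"] t(2) by simp
      qed
      with uv(1) Cons show "esum f v (\<lambda>t. g ((wt (x # u), f (x # u)) # t)) = esum f v (\<lambda>t. g' ((wt (x # u), f (x # u)) # t))"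
        by (intro 1(1)[rule_format]) simp_all
    qed
    then show ?thesis by (simp only: Cons esum.simps)
  qed
qed

lemma esum_cong_wt:
  fixes f :: "'a::ab_group_add gword \<Rightarrow> 'b::ab_group_add"
  shows "(\<And>t. wt t = wt w \<Longrightarrow> g t = g' t) \<Longrightarrow> esum f w g = esum f w g'"
  by (rule esum_cong_strong[where V = "\<lparr>smul = \<lambda>_ x. x, grade = \<lambda>_. UNIV\<rparr>" and W = "\<lparr>smul = \<lambda>_ x. x, grade = \<lambda>_. UNIV\<rparr>"])
    simp_all

lemma esum_spsum_commute: "esum f w (\<lambda>t. spsum z (g t)) = spsum z (\<lambda>a b. esum f w (\<lambda>t. g t a b))"
  by (rule spsum_functional) (rule esum_add)

text \<open>The identity Delta F = (F (x) F) Delta evaluated on \<open>g\<close>. The block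
  containing the first letter goes to the left half, where coassociativity suffices, or to the right
  half, where it must first be exchanged with the left one.\<close>

lemma esum_spsum:
  fixes f :: "'a::ab_group_add gword \<Rightarrow> 'b::ab_group_add" and g :: "'b gword \<Rightarrow> 'b gword \<Rightarrow> 'c::ab_group_add"
  shows "esum f w (\<lambda>t. spsum t g) = spsum w (\<lambda>u v. esum f u (\<lambda>s. esum f v (\<lambda>t. g s t)))"
proof (induction w arbitrary: g rule: length_induct)
  case (1 w0)
  show ?case
  proof (cases w0)
    case (Cons x w)
    let ?d = "fst x"
    let ?F = "\<lambda>u. (wt (x # u), f (x # u))"
    \<comment> \<open>\<open>b\<close> is the left half; \<open>u\<close> completes the block of
      \<open>x\<close> at the head of the right half, and \<open>c\<close> is the remainder of that
      half.\<close>
    define H where "H b u c = esum f b (\<lambda>a. esum f c (\<lambda>t. g a (?F u # t)))" for b u c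
    have IH: "esum f v (\<lambda>t. spsum t G) = spsum v (\<lambda>a b. esum f a (\<lambda>s. esum f b (\<lambda>t. G s t)))"
      if "length v \<le> length w" for v and G :: "'b gword \<Rightarrow> 'b gword \<Rightarrow> 'c"
      using 1[rule_format, of v G] Cons that by simp
    have H: "esum f a (\<lambda>s. esum f b (\<lambda>t. sg (wt (?F u # []) * wt s) (g s (?F u # t)))) =
        sg (wt u * wt a) (sg (?d * wt a) (H a u b))" for u a b
    proof -
      have "esum f a (\<lambda>s. esum f b (\<lambda>t. sg (wt (?F u # []) * wt s) (g s (?F u # t)))) =
          esum f a (\<lambda>s. sg (wt (?F u # []) * wt a) (esum f b (\<lambda>t. g s (?F u # t))))"
        by (rule esum_cong_wt) (simp add: esum_sg)
      also have "\<dots> = sg (wt (?F u # []) * wt a) (H a u b)"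
        by (simp only: esum_sg H_def)
      also have "\<dots> = sg (wt u * wt a) (sg (?d * wt a) (H a u b))"
        unfolding sg_sg by (rule sg_parity) auto
      finally show ?thesis .
    qed
    have "esum f w0 (\<lambda>t. spsum t g) = spsum w (\<lambda>u v. esum f v (\<lambda>t. spsum t (\<lambda>a b. g (?F u # a) b)) +
        esum f v (\<lambda>t. spsum t (\<lambda>a b. sg (wt (?F u # []) * wt a) (g a (?F u # b)))))"
      by (simp add: Cons esum_add)
    also have "\<dots> = spsum w (\<lambda>u v. spsum v (\<lambda>a b. esum f a (\<lambda>s. esum f b (\<lambda>t. g (?F u # s) t))) +
        spsum v (\<lambda>a b. sg (wt u * wt a) (sg (?d * wt a) (H a u b))))"
      by (rule spsum_cong[OF refl]) (simp only: IH H le_add2)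
    also have "\<dots> = spsum w (\<lambda>s v. spsum s (\<lambda>u a. esum f a (\<lambda>s. esum f v (\<lambda>t. g (?F u # s) t)))) +
        spsum w (\<lambda>u v. spsum v (\<lambda>a b. sg (?d * wt u) (H u a b)))"
      unfolding spsum_add spsum_coassoc spsum_swap_left[of w "\<lambda>u a b. sg (?d * wt u) (H u a b)"] by (rule refl)
    also have "\<dots> = spsum w0 (\<lambda>u v. esum f u (\<lambda>s. esum f v (\<lambda>t. g s t)))"
      unfolding H_def Cons spsum.simps esum.simps esum_spsum_commute[symmetric] spsum_sg
      by (simp only: esum_spsum_commute)
    finally show ?thesis .
  qed simp
qed

section \<open>Coalgebra morphisms with given structure maps\<close>

context graded_space
begin

lemma gmsym_cong:
  assumes "gmsym V s F" "\<And>w. gword V w \<Longrightarrow> F w = F' w"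
  shows "gmsym V s F'"
proof -
  have F: "gmult V s F" "gsym V F" using assms(1) by (simp_all add: gmsym_def)
  have "gmult V s F'"
  proof (rule gmultI)
    fix us vs d x y assume *: "gword V us" "gword V vs" "x \<in> grade V d" "y \<in> grade V d"
    show "F' (us @ (d, x + y) # vs) = F' (us @ (d, x) # vs) + F' (us @ (d, y) # vs)"
      using gmult_add[OF F(1) *] assms(2)[of "us @ (d, x + y) # vs"] assms(2)[of "us @ (d, x) # vs"]
        assms(2)[of "us @ (d, y) # vs"] * grade_add[OF *(3,4)] by simp
  next
    fix us vs d x c assume *: "gword V us" "gword V vs" "x \<in> grade V d"
    show "F' (us @ (d, smul V c x) # vs) = s c (F' (us @ (d, x) # vs))"
      using gmult_scale[OF F(1) *, of c] assms(2)[of "us @ (d, smul V c x) # vs"] assms(2)[of "us @ (d, x) # vs"]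
        * grade_scale[OF *(3)] by simp
  qed
  moreover have "gsym V F'"
  proof (rule gsymI)
    fix us vs x y assume *: "gword V us" "gword V vs" "snd x \<in> grade V (fst x)" "snd y \<in> grade V (fst y)"
    have "gword V (us @ x # y # vs)" "gword V (us @ y # x # vs)" using * by simp_all
    then show "F' (us @ x # y # vs) = sg (fst x * fst y) (F' (us @ y # x # vs))"
      using gsym_swap[OF F(2) *] by (simp only: assms(2))
  qed
  ultimately show ?thesis by (simp add: gmsym_def)
qed

end

text \<open>The label of a produced letter depends on the weight of the consumed block. As the
  weight is unchanged by the substitutions in \<open>gmsym\<close>, a statement for each fixed label
  suffices.\<close>

lemma gmsym_wt_param:
  assumes "\<And>n. gmsym V s (F n)"
  shows "gmsym V s (\<lambda>w. F (c + wt w) w)"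
proof -
  have F: "gmult V s (F n)" "gsym V (F n)" for n using assms[of n] by (simp_all add: gmsym_def)
  have "gmult V s (\<lambda>w. F (c + wt w) w)"
    by (rule gmultI) (simp_all add: gmult_add[OF F(1)] gmult_scale[OF F(1)])
  moreover have "gsym V (\<lambda>w. F (c + wt w) w)"
  proof (rule gsymI)
    fix us vs x y assume *: "gword V us" "gword V vs" "snd x \<in> grade V (fst x)" "snd y \<in> grade V (fst y)"
    have "wt (us @ y # x # vs) = wt (us @ x # y # vs)" by simp
    then show "F (c + wt (us @ x # y # vs)) (us @ x # y # vs) =
        sg (fst x * fst y) (F (c + wt (us @ y # x # vs)) (us @ y # x # vs))"
      using gsym_swap[OF F(2) *] by (simp only:)
  qed
  ultimately show ?thesis by (simp add: gmsym_def)
qed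

lemma gmsym_length:
  assumes "vector_space s" "P \<Longrightarrow> gmsym V s F" "\<And>w. \<not> P \<Longrightarrow> F w = 0"
  shows "gmsym V s F"
proof (cases P)
  case False
  interpret s: vector_space s by fact
  have "F = (\<lambda>w. 0)" using assms(3) False by auto
  then show ?thesis by (simp add: gmsym_def gmult_def gsym_def)
qed (use assms in blast)

lemma gmsym_truncate:
  assumes "vector_space s" "gmsym V s F"
  shows "gmsym V s (\<lambda>w. if length w \<le> n then F w else 0)"
proof -
  interpret s: vector_space s by fact
  have F: "gmult V s F" "gsym V F" using assms(2) by (simp_all add: gmsym_def)
  have "gmult V s (\<lambda>w. if length w \<le> n then F w else 0)"
    by (rule gmultI) (simp_all add: gmult_add[OF F(1)] gmult_scale[OF F(1)])
  moreover have "gsym V (\<lambda>w. if length w \<le> n then F w else 0)"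
  proof (rule gsymI)
    fix us vs x y assume *: "gword V us" "gword V vs" "snd x \<in> grade V (fst x)" "snd y \<in> grade V (fst y)"
    show "(if length (us @ x # y # vs) \<le> n then F (us @ x # y # vs) else 0) =
        sg (fst x * fst y) (if length (us @ y # x # vs) \<le> n then F (us @ y # x # vs) else 0)"
      using gsym_swap[OF F(2) *] by (cases "length (us @ x # y # vs) \<le> n") simp_all
  qed
  ultimately show ?thesis by (simp add: gmsym_def)
qed

text \<open>Each instance of multilinearity or symmetry compares words of one length, so a bound at
  least that large makes the truncation invisible.\<close>

lemma gmsym_truncateD:
  assumes "\<And>n. gmsym V s (\<lambda>w. if length w \<le> n then F w else 0)"
  shows "gmsym V s F"
proof -
  let ?E = "\<lambda>n w. if length w \<le> n then F w else 0"
  have E: "gmult V s (?E n)" "gsym V (?E n)" for n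
    using assms[of n] by (simp_all add: gmsym_def)
  have "gmult V s F"
  proof (rule gmultI)
    fix us d vs x y assume *: "gword V us" "gword V vs" "x \<in> grade V d" "y \<in> grade V d"
    show "F (us @ (d, x + y) # vs) = F (us @ (d, x) # vs) + F (us @ (d, y) # vs)"
      using gmult_add[OF E(1) *, of "length us + length vs + 1"] by simp
  next
    fix us d vs x c assume *: "gword V us" "gword V vs" "x \<in> grade V d"
    show "F (us @ (d, smul V c x) # vs) = s c (F (us @ (d, x) # vs))"
      using gmult_scale[OF E(1) *, of c "length us + length vs + 1"] by simp
  qed
  moreover have "gsym V F"
  proof (rule gsymI)
    fix us vs x y assume *: "gword V us" "gword V vs" "snd x \<in> grade V (fst x)" "snd y \<in> grade V (fst y)"
    show "F (us @ x # y # vs) = sg (fst x * fst y) (F (us @ y # x # vs))"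
      using gsym_swap[OF E(2) *, of "length us + length vs + 2"] by simp
  qed
  ultimately show ?thesis by (simp add: gmsym_def)
qed

locale structure_maps = V: graded_space V + W: graded_space W
  for V :: "('k::field, 'a::ab_group_add, 'm) gspace_scheme"
    and W :: "('k, 'b::ab_group_add, 'n) gspace_scheme" +
  fixes f :: "'a gword \<Rightarrow> 'b"
  assumes f_grade: "gword V w \<Longrightarrow> f w \<in> grade W (wt w)"
    and f_gmsym: "gmsym V (smul W) f"
    and f_Nil: "f [] = 0"
begin

lemma esum_cong: "gword V w \<Longrightarrow> (\<And>t. gword W t \<Longrightarrow> wt t = wt w \<Longrightarrow> g t = g' t) \<Longrightarrow> esum f w g = esum f w g'"
  by (rule esum_cong_strong[where V = V and W = W]) (simp_all add: f_grade)

text \<open>Projecting onto the component of degree \<open>n\<close> turns a function that is linear on \<open>grade W n\<close>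
  into a linear function.\<close>

lemma linear_esum_head:
  assumes s: "vector_space s" and g: "gmult W s g" and v: "gword V v"
  shows "Vector_Spaces.linear (smul W) s (\<lambda>y. esum f v (\<lambda>t. g ((n, hcomp W n y) # t)))"
  unfolding Vector_Spaces.linear_iff
proof (intro conjI allI s W.vector_space_axioms)
  fix x y c
  have "esum f v (\<lambda>t. g ((n, hcomp W n (x + y)) # t)) = esum f v (\<lambda>t. g ((n, hcomp W n x) # t) + g ((n, hcomp W n y) # t))"
    using gmult_add[OF g, of "[]"] by (intro esum_cong[OF v]) (simp add: W.hcomp_add)
  then show "esum f v (\<lambda>t. g ((n, hcomp W n (x + y)) # t)) =
      esum f v (\<lambda>t. g ((n, hcomp W n x) # t)) + esum f v (\<lambda>t. g ((n, hcomp W n y) # t))"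
    by (simp only: esum_add)
  interpret s: vector_space s by fact
  have a: "Modules.additive (s c)" by (simp add: Modules.additive_def s.scale_right_distrib)
  have "esum f v (\<lambda>t. g ((n, hcomp W n (smul W c x)) # t)) = esum f v (\<lambda>t. s c (g ((n, hcomp W n x) # t)))"
    using gmult_scale[OF g, of "[]"] by (intro esum_cong[OF v]) (simp add: W.hcomp_scale)
  then show "esum f v (\<lambda>t. g ((n, hcomp W n (smul W c x)) # t)) = s c (esum f v (\<lambda>t. g ((n, hcomp W n x) # t)))"
    by (simp only: additive_esum[OF a])
qed

lemma gmsym_esum_head:
  assumes s: "vector_space s" and g: "gmult W s g" and v: "gword V v" and z: "snd z \<in> grade V (fst z)"
  shows "gmsym V s (\<lambda>u. esum f v (\<lambda>t. g ((wt (z # u), f (z # u)) # t)))"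
proof (rule V.gmsym_cong)
  show "gmsym V s (\<lambda>u. esum f v (\<lambda>t. g ((fst z + wt u, hcomp W (fst z + wt u) (f (z # u))) # t)))"
    by (rule gmsym_wt_param, rule gmsym_linear[OF linear_esum_head[OF s g v] gmsym_Cons[OF f_gmsym z]])
  show "esum f v (\<lambda>t. g ((fst z + wt u, hcomp W (fst z + wt u) (f (z # u))) # t)) =
      esum f v (\<lambda>t. g ((wt (z # u), f (z # u)) # t))" if "gword V u" for u
    using W.hcomp_hom[OF f_grade[of "z # u"]] that z by simp
qed

text \<open>Either both leading letters lie in one block, and \<open>f\<close> is symmetric, or they
  head two different blocks. In the second case symmetry of \<open>g\<close> exchanges the blocks
  with the sign of their full degrees, and exchanging the remainders of the blocks corrects this to
  \<open>fst x * fst y\<close>.\<close>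

lemma esum_swap:
  assumes s: "vector_space s" and g: "gmsym W s g" and w: "gword V w"
    and x: "snd x \<in> grade V (fst x)" and y: "snd y \<in> grade V (fst y)"
  shows "esum f (x # y # w) g = sg (fst x * fst y) (esum f (y # x # w) g)"
proof -
  let ?F = "\<lambda>u. (wt u, f u)"
  define K where "K x u y a b = esum f b (\<lambda>t. g (?F (x # u) # ?F (y # a) # t))" for x u y a b
  have g': "gmult W s g" "gsym W g" using g by (simp_all add: gmsym_def)
  have exp: "esum f (x # y # w) g = spsum w (\<lambda>u v. esum f v (\<lambda>t. g (?F (x # y # u) # t))) +
      spsum w (\<lambda>u v. spsum v (\<lambda>a b. sg (fst y * wt u) (K x u y a b)))" for x y
    by (simp add: K_def spsum_sg)
  have 1: "spsum w (\<lambda>u v. esum f v (\<lambda>t. g (?F (x # y # u) # t))) =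
      spsum w (\<lambda>u v. sg (fst x * fst y) (esum f v (\<lambda>t. g (?F (y # x # u) # t))))"
    using w
  proof (rule spsum_cong_gword)
    fix u v assume u: "gword V u" and v: "gword V v"
    let ?\<phi> = "\<lambda>n y. esum f v (\<lambda>t. g ((n, hcomp W n y) # t))"
    have h: "hcomp W (wt z) (f z) = f z" if "gword V z" for z
      using W.hcomp_hom[OF f_grade[OF that]] by simp
    have xyu: "gword V (x # y # u)" "gword V (y # x # u)" "wt (x # y # u) = wt (y # x # u)" using u x y by simp_all
    have sw: "f (x # y # u) = sg (fst x * fst y) (f (y # x # u))"
      using gsym_swap[of V f "[]" u x y] f_gmsym u x y by (simp only: gmsym_def append_Nil gword_simps)
    have "esum f v (\<lambda>t. g (?F (x # y # u) # t)) = ?\<phi> (wt (x # y # u)) (f (x # y # u))"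
      by (simp only: h[OF xyu(1)])
    also have "\<dots> = sg (fst x * fst y) (?\<phi> (wt (x # y # u)) (f (y # x # u)))"
      unfolding sw by (rule linear_sg[OF linear_esum_head[OF s g'(1) v]])
    also have "\<dots> = sg (fst x * fst y) (esum f v (\<lambda>t. g (?F (y # x # u) # t)))"
      unfolding xyu(3) by (simp only: h[OF xyu(2)])
    finally show "esum f v (\<lambda>t. g (?F (x # y # u) # t)) = sg (fst x * fst y) (esum f v (\<lambda>t. g (?F (y # x # u) # t)))" .
  qed
  have K: "K x u y a b = sg ((fst x + wt u) * (fst y + wt a)) (K y a x u b)"
    if "gword V u" "gword V a" "gword V b" for u a b
  proof -
    have "snd (?F (x # u)) \<in> grade W (fst (?F (x # u)))" "snd (?F (y # a)) \<in> grade W (fst (?F (y # a)))"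
      using f_grade[of "x # u"] f_grade[of "y # a"] that x y by simp_all
    from gsym_swap[OF g'(2) _ _ this, of "[]"]
    have "esum f b (\<lambda>t. g (?F (x # u) # ?F (y # a) # t)) =
        esum f b (\<lambda>t. sg (wt (x # u) * wt (y # a)) (g (?F (y # a) # ?F (x # u) # t)))"
      by (intro esum_cong[OF that(3)]) simp
    then show ?thesis by (simp add: K_def esum_sg)
  qed
  have "spsum w (\<lambda>u v. spsum v (\<lambda>a b. sg (fst y * wt u) (K x u y a b))) =
      spsum w (\<lambda>u v. spsum v (\<lambda>a b. sg (fst y * wt u) (sg ((fst x + wt u) * (fst y + wt a)) (K y a x u b))))"
    by (rule spsum_cong_gword[OF w], rule spsum_cong_gword, assumption) (simp only: K)
  also have "\<dots> = spsum w (\<lambda>u v. spsum v (\<lambda>a b. sg (wt u * wt a)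
      (sg (fst y * wt a) (sg ((fst x + wt a) * (fst y + wt u)) (K y u x a b)))))"
    by (rule spsum_swap_left)
  also have "\<dots> = spsum w (\<lambda>u v. spsum v (\<lambda>a b. sg (fst x * fst y) (sg (fst x * wt u) (K y u x a b))))"
    unfolding sg_sg by (intro spsum_cong refl sg_parity) auto
  finally show ?thesis
    unfolding exp 1 by (simp only: spsum_sg sg_add)
qed

text \<open>The recursion evaluates \<open>esum f\<close> on shorter words only, whereas \<open>gmsym\<close> quantifies over words of
  all lengths; truncation lets the induction hypothesis apply inside \<open>spsum\<close>.\<close>

lemma gmsym_esum_truncate:
  assumes s: "vector_space s"
  shows "gmsym W s g \<Longrightarrow> gmsym V s (\<lambda>w. if length w \<le> n then esum f w g else 0)"
proof (induction n arbitrary: g)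
  case 0
  interpret s: vector_space s by fact
  show ?case
    by (simp add: gmsym_def gmult_def gsym_def)
next
  case (Suc n)
  interpret s: vector_space s by fact
  let ?E = "\<lambda>w. if length w \<le> Suc n then esum f w g else 0"
  let ?G = "\<lambda>z u v. if length v \<le> n then esum f v (\<lambda>t. g ((wt (z # u), f (z # u)) # t)) else 0"
  have g: "gmult W s g" using Suc.prems by (simp add: gmsym_def)
  have G: "gmsym2 V s (?G z)" if z: "snd z \<in> grade V (fst z)" for z
  proof (rule gmsym2I)
    fix u assume "gword V u"
    with z have "snd (wt (z # u), f (z # u)) \<in> grade W (fst (wt (z # u), f (z # u)))"
      using f_grade[of "z # u"] by simp
    then show "gmsym V s (?G z u)"
      using Suc.IH[OF gmsym_Cons[OF Suc.prems]] by blast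
  next
    fix v assume v: "gword V v"
    show "gmsym V s (\<lambda>u. ?G z u v)"
      by (rule gmsym_length[OF s, where P = "length v \<le> n"]) (simp_all add: gmsym_esum_head[OF s g v z, simplified])
  qed
  have E: "?E (z # w) = (if length w \<le> n then spsum w (?G z) else 0)" for z w
    by (auto intro: spsum_cong)
  have E': "gmult V s (\<lambda>w. ?E (z # w))" "gsym V (\<lambda>w. ?E (z # w))" if "snd z \<in> grade V (fst z)" for z
    using gmsym_truncate[OF s gmsym_spsum[OF s G[OF that]], of n] unfolding E gmsym_def by simp_all
  have head: "esum f ((d, x) # vs) g = spsum vs (\<lambda>u v. esum f v (\<lambda>t. g ((d + wt u, hcomp W (d + wt u) (f ((d, x) # u))) # t)))"
    if "gword V vs" "x \<in> grade V d" for d x vs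
    unfolding esum.simps using that(1)
  proof (rule spsum_cong_gword)
    fix u v assume "gword V u"
    then show "esum f v (\<lambda>t. g ((wt ((d, x) # u), f ((d, x) # u)) # t)) = esum f v (\<lambda>t. g ((d + wt u, hcomp W (d + wt u) (f ((d, x) # u))) # t))"
      using W.hcomp_hom[OF f_grade[of "(d, x) # u"], of "d + wt u"] that(2) by simp
  qed
  have fm: "gmult V (smul W) f" using f_gmsym by (simp add: gmsym_def)
  have "gmult V s ?E"
  proof (rule gmultI)
    fix us d vs x y
    assume *: "gword V us" "gword V vs" "x \<in> grade V d" "y \<in> grade V d"
    show "?E (us @ (d, x + y) # vs) = ?E (us @ (d, x) # vs) + ?E (us @ (d, y) # vs)"
    \<comment> \<open>The symmetry of \<open>spsum\<close> concerns letters behind the leading one.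
      A change of the leading letter itself enters only through the value of \<open>f\<close> on its
      block.\<close>
    proof (cases us)
      case Nil
      have "esum f ((d, x + y) # vs) g = esum f ((d, x) # vs) g + esum f ((d, y) # vs) g"
        unfolding head[OF *(2,3)] head[OF *(2,4)] head[OF *(2) V.grade_add[OF *(3,4)]] spsum_add[symmetric] using *(2)
      proof (rule spsum_cong_gword)
        fix u v assume u: "gword V u" and v: "gword V v"
        have "f ((d, x + y) # u) = f ((d, x) # u) + f ((d, y) # u)"
          using gmult_add[OF fm, of "[]" u x d y] * u by simp
        then show "esum f v (\<lambda>t. g ((d + wt u, hcomp W (d + wt u) (f ((d, x + y) # u))) # t)) =
            esum f v (\<lambda>t. g ((d + wt u, hcomp W (d + wt u) (f ((d, x) # u))) # t)) +
            esum f v (\<lambda>t. g ((d + wt u, hcomp W (d + wt u) (f ((d, y) # u))) # t))"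
          using linear_esum_head[OF s g v] by (simp add: Vector_Spaces.linear_iff)
      qed
      then show ?thesis using Nil by simp
    next
      case (Cons z us')
      then show ?thesis
        using gmult_add[OF E'(1), of z us' vs x d y] * by (simp only: append_Cons gword_simps)
    qed
  next
    fix us d vs x c
    assume *: "gword V us" "gword V vs" "x \<in> grade V d"
    show "?E (us @ (d, smul V c x) # vs) = s c (?E (us @ (d, x) # vs))"
    proof (cases us)
      case Nil
      have a: "Modules.additive (s c)" by (simp add: Modules.additive_def s.scale_right_distrib)
      have "esum f ((d, smul V c x) # vs) g = s c (esum f ((d, x) # vs) g)"
        unfolding head[OF *(2,3)] head[OF *(2) V.grade_scale[OF *(3)]] additive_spsum[OF a] using *(2)
      proof (rule spsum_cong_gword)
        fix u v assume u: "gword V u" and v: "gword V v"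
        have "f ((d, smul V c x) # u) = smul W c (f ((d, x) # u))"
          using gmult_scale[OF fm, of "[]" u x d c] * u by simp
        then show "esum f v (\<lambda>t. g ((d + wt u, hcomp W (d + wt u) (f ((d, smul V c x) # u))) # t)) =
            s c (esum f v (\<lambda>t. g ((d + wt u, hcomp W (d + wt u) (f ((d, x) # u))) # t)))"
          using linear_esum_head[OF s g v] by (simp add: Vector_Spaces.linear_iff)
      qed
      then show ?thesis using Nil by simp
    next
      case (Cons z us')
      then show ?thesis
        using gmult_scale[OF E'(1), of z us' vs x d c] * by (simp only: append_Cons gword_simps)
    qed
  qed
  moreover have "gsym V ?E"
  proof (rule gsymI)
    fix us vs x y assume *: "gword V us" "gword V vs" "snd x \<in> grade V (fst x)" "snd y \<in> grade V (fst y)"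
    show "?E (us @ x # y # vs) = sg (fst x * fst y) (?E (us @ y # x # vs))"
    proof (cases us)
      case Nil
      then show ?thesis
        using esum_swap[OF s Suc.prems *(2-)] by (cases "length vs < n") (simp_all del: esum.simps)
    next
      case (Cons z us')
      then show ?thesis
        using gsym_swap[OF E'(2), of z us' vs x y] * by (simp only: append_Cons gword_simps)
    qed
  qed
  ultimately show ?case by (simp add: gmsym_def)
qed

lemma gmsym_esum:
  assumes s: "vector_space s" and g: "gmsym W s g"
  shows "gmsym V s (\<lambda>w. esum f w g)"
  by (rule gmsym_truncateD) (rule gmsym_esum_truncate[OF s g])

end

lemma symq_add: "symq V (mon (us @ (x + y) # vs)) = symq V (mon (us @ x # vs)) + symq V (mon (us @ y # vs))"
  and symq_scale: "symq V (mon (us @ smul V c x # vs)) = fscale c (symq V (mon (us @ x # vs)))"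
  and symq_swap: "x \<in> grade V m \<Longrightarrow> y \<in> grade V n \<Longrightarrow>
      symq V (mon (us @ x # y # vs)) = sg (m * n) (symq V (mon (us @ y # x # vs)))"
proof -
  interpret q: Vector_Spaces.linear fscale fscale "symq V" by (rule linear_symq)
  have "symq V (mon (us @ (x + y) # vs) - mon (us @ x # vs) - mon (us @ y # vs)) = 0"
    by (simp only: symq_eq_0 sym_rel_add)
  then show "symq V (mon (us @ (x + y) # vs)) = symq V (mon (us @ x # vs)) + symq V (mon (us @ y # vs))"
    by (simp add: q.diff diff_diff_eq q.add)
  have "symq V (mon (us @ smul V c x # vs) - fscale c (mon (us @ x # vs))) = 0"
    by (simp only: symq_eq_0 sym_rel_scale)
  then show "symq V (mon (us @ smul V c x # vs)) = fscale c (symq V (mon (us @ x # vs)))"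
    by (simp add: q.diff q.scale)
  assume *: "x \<in> grade V m" "y \<in> grade V n"
  have "symq V (mon (us @ x # y # vs) - fscale ((-1) powi (m * n)) (mon (us @ y # x # vs))) = 0"
    by (simp only: symq_eq_0 sym_rel_swap[OF *])
  then show "symq V (mon (us @ x # y # vs)) = sg (m * n) (symq V (mon (us @ y # x # vs)))"
    by (simp add: q.diff scale_powi_minus_one[OF vector_space_fscale] linear_sg[OF linear_symq])
qed

lemma hsum_cong_len: "(\<And>w. length w = length xs \<Longrightarrow> F w = F' w) \<Longrightarrow> hsum V xs F = hsum V xs F'"
proof (induction xs arbitrary: F F')
  case (Cons x xs)
  show ?case
    unfolding hsum.simps by (intro sum.cong refl Cons.IH) (auto intro!: Cons.prems)
qed simp

definition exp_map ::
  "('k::field, 'a::ab_group_add, 'm) gspace_scheme \<Rightarrow> ('a gword \<Rightarrow> 'b) \<Rightarrow> ('a list \<Rightarrow>\<^sub>0 'k) \<Rightarrow> ('b list \<Rightarrow>\<^sub>0 'k)" where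
  "exp_map V f = lin_ext (\<lambda>xs. hsum V xs (\<lambda>w. esum f w (\<lambda>t. mon (map snd t))))"

lemma linear_exp_map: "Vector_Spaces.linear fscale fscale (exp_map V f)"
  unfolding exp_map_def by (rule linear_lin_ext)

lemma exp_map_eval:
  assumes "Vector_Spaces.linear fscale s \<Phi>"
  shows "\<Phi> (exp_map V f (mon xs)) = hsum V xs (\<lambda>w. esum f w (\<lambda>t. \<Phi> (mon (map snd t))))"
  using additive_linear[OF assms] by (simp add: exp_map_def additive_hsum additive_esum)

lemma comult_eval:
  assumes "Vector_Spaces.linear fscale s \<Phi>"
  shows "\<Phi> (comult V (mon xs)) = hsum V xs (\<lambda>w. spsum w (\<lambda>u v. \<Phi> (mon (map snd u, map snd v))))"
  using additive_linear[OF assms] by (simp add: comult_mon additive_hsum additive_spsum)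

lemma linear_comult: "Vector_Spaces.linear fscale fscale (comult V)"
  unfolding comult_def by (rule linear_lin_ext)

lemma linear_tens_map: "Vector_Spaces.linear fscale fscale (tens_map F G)"
  unfolding tens_map_def by (rule linear_lin_ext)

lemma tens_map_mon: "tens_map F G (mon (u, v)) = tens (F (mon u)) (G (mon v))"
  by (simp add: tens_map_def)

lemma vector_space_mult: "vector_space ((*) :: 'k::field \<Rightarrow> 'k \<Rightarrow> 'k)"
  by unfold_locales (simp_all add: algebra_simps)

lemma counit_add: "counit (s + t) = counit s + counit t"
  and counit_scale: "counit (fscale c t) = c * counit t"
  by (simp_all add: counit_def lookup_add)

lemma linear_counit: "Vector_Spaces.linear fscale (*) counit"
  unfolding Vector_Spaces.linear_iff
  by (simp add: counit_add counit_scale vector_space_fscale vector_space_mult)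

lemma counit_mon: "counit (mon xs) = (if xs = [] then 1 else 0)"
  by (simp add: counit_def lookup_single when_def)

lemma esum_Nil: "esum f w (\<lambda>t. if t = [] then c else 0) = (if w = [] then c else 0)"
  by (cases w) simp_all

text \<open>Projection to the cogenerators leaves only the partition into a single block, which
  recovers the structure map.\<close>

lemma esum_single:
  fixes f :: "'a gword \<Rightarrow> 'b::ab_group_add"
  shows "esum f w (\<lambda>t. case map snd t of [y] \<Rightarrow> y | _ \<Rightarrow> 0) = (if w = [] then 0 else f w)"
proof (cases w)
  case (Cons x w')
  have "(case map snd ((n, y) # t) of [y] \<Rightarrow> y | _ \<Rightarrow> 0) = (if t = [] then y else 0)" for n :: int and y :: 'b and t
    by (cases t) simp_all
  then have "esum f w (\<lambda>t. case map snd t of [y] \<Rightarrow> y | _ \<Rightarrow> 0) =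
      spsum w' (\<lambda>u v. if v = [] then f (x # u) else 0)"
    by (simp only: Cons esum.simps esum_Nil)
  then show ?thesis
    by (simp add: spsum_right_Nil Cons)
qed simp

lemma qsum_single: "qsum q w (\<lambda>t. case map snd t of [y] \<Rightarrow> y | _ \<Rightarrow> 0) = (if w = [] then 0 else (q w :: 'a::ab_group_add))"
proof (cases w)
  case (Cons x v)
  have e: "(case map snd (z # t) of [y] \<Rightarrow> y | _ \<Rightarrow> 0) = (if t = [] then snd z else 0)" for z :: "int \<times> 'a" and t
    by (cases t) simp_all
  show ?thesis
    unfolding Cons qsum.simps e qsum_Nil by (simp add: spsum_right_Nil)
qed simp

lemma coalg_morphism_iff:
  "coalg_morphism V W F \<longleftrightarrow> Vector_Spaces.linear fscale fscale F \<and>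
     (\<forall>r\<in>sym_rel V. symq W (F r) = 0) \<and>
     (\<forall>n. F ` sym_grade V n \<subseteq> sym_grade W n) \<and>
     (\<forall>t. symq2 W (comult W (F t)) = symq2 W (tens_map F F (comult V t))) \<and>
     (\<forall>t. counit (F t) = counit t) \<and> symq W (F (mon [])) = symq W (mon [])"
  by (auto simp: coalg_morphism_def sym_linear_def symq_eq_0 quot_map_eq_iff[OF subspace_sym_rel2] sym_eq_iff)

lemma sym_grade_image:
  assumes "Vector_Spaces.linear fscale fscale F" "\<And>r. r \<in> sym_rel V \<Longrightarrow> F r \<in> sym_rel W"
    and "\<And>w. gword V w \<Longrightarrow> F (mon (map snd w)) \<in> sym_grade W (wt w)"
  shows "F ` sym_grade V n \<subseteq> sym_grade W n"
proof -
  interpret F: Vector_Spaces.linear fscale fscale F by fact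
  let ?S = "sym_rel V \<union> {mon xs | xs ds. list_all2 (\<lambda>d x. x \<in> grade V d) ds xs \<and> sum_list ds = n}"
  have "F ` ?S \<subseteq> sym_grade W n"
  proof (intro subsetI, elim imageE UnE CollectE exE conjE)
    fix s r assume "s = F r" "r \<in> sym_rel V"
    then show "s \<in> sym_grade W n"
      using assms(2) fscale.span_base unfolding sym_grade_def by blast
  next
    fix s r xs ds assume *: "s = F r" "r = mon xs" "list_all2 (\<lambda>d x. x \<in> grade V d) ds xs" "sum_list ds = n"
    then have "gword V (zip ds xs)" "map snd (zip ds xs) = xs" "wt (zip ds xs) = n"
      by (auto simp: gword_def list_all2_iff wt_def)
    then show "s \<in> sym_grade W n"
      using assms(3) *(1,2) by metis
  qed
  then have "fscale.span (F ` ?S) \<subseteq> sym_grade W n"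
    by (rule fscale.span_minimal) (rule subspace_sym_grade)
  then show ?thesis
    by (simp add: sym_grade_def F.span_image)
qed

lemma mon_sym_grade:
  assumes "gword W t"
  shows "mon (map snd t) \<in> sym_grade W (wt t)"
proof -
  have "list_all2 (\<lambda>d x. x \<in> grade W d) (map fst t) (map snd t)"
    using assms by (auto simp: gword_def list_all2_conv_all_nth)
  then show ?thesis
    unfolding sym_grade_def wt_def by (intro fscale.span_base UnI2 CollectI exI conjI) auto
qed

context graded_space
begin

lemma symq2_comult_word:
  assumes "gword V w"
  shows "symq2 V (comult V (mon (map snd w))) = spsum w (\<lambda>u v. symq2 V (mon (map snd u, map snd v)))"
proof -
  have "gmult V fscale (\<lambda>w. spsum w (\<lambda>u v. symq2 V (mon (map snd u, map snd v))))"
    by (rule gmult_spsum[OF vector_space_fscale gmsym2_symq2])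
  from hsum_map_snd_gmult[OF this assms] show ?thesis
    by (simp only: comult_eval[OF linear_symq2])
qed

end

context structure_maps
begin

lemma exp_map_sym_rel: "r \<in> sym_rel V \<Longrightarrow> symq W (exp_map V f r) = 0"
  by (rule V.sym_rel_kernel[OF linear_compose_app[OF linear_exp_map linear_symq]
        gmsym_esum[OF vector_space_fscale gmsym_symq]])
    (simp_all add: exp_map_eval[OF linear_symq])

text \<open>On a homogeneous word the expansion into components collapses to one term. It is empty
  when some letter is zero, and then the right-hand side vanishes too, by multilinearity of the
  partition sum.\<close>

lemma exp_map_word:
  assumes \<Phi>: "Vector_Spaces.linear fscale s \<Phi>" and 0: "\<And>t. t \<in> sym_rel W \<Longrightarrow> \<Phi> t = 0" and w: "gword V w"
  shows "\<Phi> (exp_map V f (mon (map snd w))) = esum f w (\<lambda>t. \<Phi> (mon (map snd t)))"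
proof -
  have s: "vector_space s" using \<Phi> by (simp add: Vector_Spaces.linear_iff)
  have "gmult V s (\<lambda>w. esum f w (\<lambda>t. \<Phi> (mon (map snd t))))"
    using gmsym_esum[OF s gmsym_mon[OF \<Phi> 0]] by (simp add: gmsym_def)
  from V.hsum_map_snd_gmult[OF this w] show ?thesis
    by (simp only: exp_map_eval[OF \<Phi>])
qed

lemma exp_map_comult: "symq2 W (comult W (exp_map V f t)) = symq2 W (tens_map (exp_map V f) (exp_map V f) (comult V t))"
proof (rule linear_mon_eqI[where t = t])
  let ?E = "exp_map V f"
  let ?G = "\<lambda>s t. symq2 W (mon (map snd s, map snd t))"
  note E = linear_exp_map[of V f]
  have \<Phi>: "Vector_Spaces.linear fscale fscale (\<lambda>t. symq2 W (comult W t))"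
    by (rule linear_compose_app[OF linear_comult linear_symq2])
  have \<Psi>: "Vector_Spaces.linear fscale fscale (\<lambda>t. symq2 W (tens_map ?E ?E t))"
    by (rule linear_compose_app[OF linear_tens_map linear_symq2])
  show "Vector_Spaces.linear fscale fscale (\<lambda>t. symq2 W (comult W (?E t)))"
    by (rule linear_compose_app[OF E \<Phi>])
  show "Vector_Spaces.linear fscale fscale (\<lambda>t. symq2 W (tens_map ?E ?E (comult V t)))"
    by (rule linear_compose_app[OF linear_comult \<Psi>])
  fix xs
  have "symq2 W (comult W (?E (mon xs))) = hsum V xs (\<lambda>w. esum f w (\<lambda>t. symq2 W (comult W (mon (map snd t)))))"
    by (rule exp_map_eval[OF \<Phi>])
  also have "\<dots> = hsum V xs (\<lambda>w. esum f w (\<lambda>t. spsum t ?G))"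
    by (rule V.hsum_cong_hom, rule esum_cong) (simp_all only: W.symq2_comult_word)
  also have "\<dots> = hsum V xs (\<lambda>w. spsum w (\<lambda>u v. esum f u (\<lambda>s. esum f v (\<lambda>t. ?G s t))))"
    by (simp only: esum_spsum)
  also have "\<dots> = hsum V xs (\<lambda>w. spsum w (\<lambda>u v. symq2 W (tens (?E (mon (map snd u))) (?E (mon (map snd v))))))"
  proof (rule V.hsum_cong_hom, rule spsum_cong_gword, assumption)
    fix u v :: "'a gword" assume u: "gword V u" and v: "gword V v"
    have "symq2 W (tens (?E (mon (map snd u))) (?E (mon (map snd v)))) =
        esum f u (\<lambda>s. symq2 W (tens (mon (map snd s)) (?E (mon (map snd v)))))"
      by (rule exp_map_word[OF linear_compose_app[OF linear_tens_left linear_symq2] _ u])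
        (simp add: symq2_eq_0 tens_sym_rel)
    also have "\<dots> = esum f u (\<lambda>s. esum f v (\<lambda>t. symq2 W (tens (mon (map snd s)) (mon (map snd t)))))"
      by (rule arg_cong[of _ _ "esum f u"], rule ext,
          rule exp_map_word[OF linear_compose_app[OF linear_tens_right linear_symq2] _ v])
        (simp add: symq2_eq_0 tens_sym_rel)
    finally show "esum f u (\<lambda>s. esum f v (\<lambda>t. ?G s t)) = symq2 W (tens (?E (mon (map snd u))) (?E (mon (map snd v))))"
      by simp
  qed
  also have "\<dots> = symq2 W (tens_map ?E ?E (comult V (mon xs)))"
    by (simp only: comult_eval[OF \<Psi>] tens_map_mon)
  finally show "symq2 W (comult W (?E (mon xs))) = symq2 W (tens_map ?E ?E (comult V (mon xs)))" .
qed

lemma exp_map_grade: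
  assumes "gword V w"
  shows "exp_map V f (mon (map snd w)) \<in> sym_grade W (wt w)"
proof -
  \<comment> \<open>A linear map with this subspace as its kernel turns membership into vanishing,
    which can be checked on each summand of \<open>esum\<close>.\<close>
  let ?q = "quot_map (sym_grade W (wt w))"
  have q: "Vector_Spaces.linear fscale fscale ?q" "?q t = 0 \<longleftrightarrow> t \<in> sym_grade W (wt w)" for t
    by (rule quot_map[OF subspace_sym_grade])+
  have "?q (mon (map snd t)) = 0" if "gword W t" "wt t = wt w" for t
  proof -
    have "mon (map snd t) \<in> sym_grade W (wt w)"
      using mon_sym_grade[OF that(1)] that(2) by simp
    then show ?thesis by (simp only: q(2))
  qed
  then have "esum f w (\<lambda>t. ?q (mon (map snd t))) = esum f w (\<lambda>t. 0)"
    by (intro esum_cong[OF assms])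
  then have "?q (exp_map V f (mon (map snd w))) = 0"
    unfolding exp_map_eval[OF q(1)] V.hsum_map_snd[OF assms] by simp
  then show ?thesis by (simp only: q(2))
qed

lemma coalg_morphism_exp_map: "coalg_morphism V W (exp_map V f)"
  unfolding coalg_morphism_iff
proof (intro conjI ballI allI linear_exp_map exp_map_sym_rel exp_map_comult)
  show "exp_map V f ` sym_grade V n \<subseteq> sym_grade W n" for n
    by (rule sym_grade_image[OF linear_exp_map]) (simp_all add: exp_map_grade exp_map_sym_rel flip: symq_eq_0)
  show "counit (exp_map V f t) = counit t" for t
  proof (rule linear_mon_eqI[OF linear_compose_app[OF linear_exp_map linear_counit] linear_counit])
    fix xs :: "'a list"
    have "counit (exp_map V f (mon xs) :: _ \<Rightarrow>\<^sub>0 'k) = hsum V xs (\<lambda>w. if xs = [] then 1 else 0)"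
      unfolding exp_map_eval[OF linear_counit] counit_mon
      by (rule hsum_cong_len) (auto simp: esum_Nil)
    then show "counit (exp_map V f (mon xs) :: _ \<Rightarrow>\<^sub>0 'k) = counit (mon xs)"
      by (cases xs) (simp_all add: counit_mon)
  qed
  show "symq W (exp_map V f (mon [])) = symq W (mon [])"
    by (simp add: exp_map_def)
qed

lemma cogen_exp_map: "cogen W (exp_map V f (mon xs)) = hsum V xs f"
proof -
  have s: "vector_space (smul W)" ..
  have "cogen W (exp_map V f (mon xs)) = hsum V xs (\<lambda>w. if w = [] then 0 else f w)"
    by (simp only: exp_map_eval[OF linear_cogen[OF s]] cogen_mon[OF s] esum_single)
  also have "\<dots> = hsum V xs f"
    by (rule hsum_cong_len) (simp add: f_Nil)
  finally show ?thesis .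
qed

end

section \<open>Uniqueness of coalgebra morphisms\<close>

text \<open>In characteristic \<open>0\<close> the component in \<open>Sym\<^sup>j\<close> is recovered from the comultiplication:
  splitting off one factor and multiplying it back is multiplication by \<open>j\<close>.\<close>

definition split_mult :: "nat \<Rightarrow> ('a list \<times> 'a list \<Rightarrow>\<^sub>0 'k::field) \<Rightarrow> ('a list \<Rightarrow>\<^sub>0 'k)" where
  "split_mult j = lin_ext (\<lambda>(u, v). if length u = 1 \<and> length v + 1 = j then mon (u @ v) else 0)"

lemma linear_split_mult: "Vector_Spaces.linear fscale fscale (split_mult j)"
  unfolding split_mult_def by (rule linear_lin_ext)

lemma split_mult_mon: "split_mult j (mon (u, v)) = (if length u = 1 \<and> length v + 1 = j then mon (u @ v) else 0)"
  by (simp add: split_mult_def)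

lemma linear_symq_split_mult: "Vector_Spaces.linear fscale fscale (\<lambda>t. symq W (split_mult j t))"
  by (rule linear_compose_app[OF linear_split_mult linear_symq])

lemma symq_zero [simp]: "symq V 0 = 0"
  by (simp add: symq_eq_0 fscale.subspace_0[OF subspace_sym_rel])

text \<open>Multiplying the factors extends a relation in the right factor by the left word. In the
  left factor only words of length one survive, so additivity and scaling pass through and
  commutation relations, which involve two letters, are sent to zero.\<close>

lemma symq_split_mult_tens:
  assumes "r \<in> sym_rel W"
  shows "symq W (split_mult j (tens r t)) = 0" "symq W (split_mult j (tens t r)) = 0"
proof -
  note q = linear_symq_split_mult[of W j]
  have 0: "Vector_Spaces.linear fscale fscale (\<lambda>t. 0)"
    by (simp add: Vector_Spaces.linear_iff vector_space_fscale)
  have ql: "Vector_Spaces.linear fscale fscale (\<lambda>s. symq W (split_mult j (tens s t)))" for t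
    by (rule linear_compose_app[OF linear_tens_left q])
  have qr: "Vector_Spaces.linear fscale fscale (\<lambda>t. symq W (split_mult j (tens s t)))" for s
    by (rule linear_compose_app[OF linear_tens_right q])
  show "symq W (split_mult j (tens r t)) = 0"
  proof (rule linear_mon_eqI[OF qr 0])
    fix v
    show "symq W (split_mult j (tens r (mon v))) = 0"
    proof (rule sym_rel_kernelI[OF ql _ _ _ assms])
      show "symq W (split_mult j (tens (mon (us @ (x + y) # vs)) (mon v))) =
          symq W (split_mult j (tens (mon (us @ x # vs)) (mon v))) + symq W (split_mult j (tens (mon (us @ y # vs)) (mon v)))"
        for us x y vs
        using symq_add[of W us x y "vs @ v"] by (auto simp: split_mult_mon)
      show "symq W (split_mult j (tens (mon (us @ smul W c x # vs)) (mon v))) =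
          fscale c (symq W (split_mult j (tens (mon (us @ x # vs)) (mon v))))" for us c x vs
        using symq_scale[of W us c x "vs @ v"] by (auto simp: split_mult_mon)
    qed (simp add: split_mult_mon)
  qed
  show "symq W (split_mult j (tens t r)) = 0"
  proof (rule linear_mon_eqI[where t = t, OF ql 0])
    fix u
    show "symq W (split_mult j (tens (mon u) r)) = 0"
    proof (rule sym_rel_kernelI[OF qr _ _ _ assms])
      show "symq W (split_mult j (tens (mon u) (mon (us @ (x + y) # vs)))) =
          symq W (split_mult j (tens (mon u) (mon (us @ x # vs)))) + symq W (split_mult j (tens (mon u) (mon (us @ y # vs))))"
        for us x y vs
        using symq_add[of W "u @ us" x y vs] by (simp add: split_mult_mon)
      show "symq W (split_mult j (tens (mon u) (mon (us @ smul W c x # vs)))) =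
          fscale c (symq W (split_mult j (tens (mon u) (mon (us @ x # vs)))))" for us c x vs
        using symq_scale[of W "u @ us" c x vs] by (simp add: split_mult_mon)
      show "symq W (split_mult j (tens (mon u) (mon (us @ x # y # vs)))) =
          sg (m * n) (symq W (split_mult j (tens (mon u) (mon (us @ y # x # vs)))))"
        if "x \<in> grade W m" "y \<in> grade W n" for us x y vs m n
        using symq_swap[OF that, of "u @ us" vs] by (simp add: split_mult_mon)
    qed
  qed
qed

lemma symq_split_mult_tens_cong:
  assumes "symq W a = symq W a'" "symq W b = symq W b'"
  shows "symq W (split_mult j (tens a b)) = symq W (split_mult j (tens a' b'))"
proof -
  interpret l: Vector_Spaces.linear fscale fscale "\<lambda>s. symq W (split_mult j (tens s b))"
    by (rule linear_compose_app[OF linear_tens_left linear_symq_split_mult])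
  interpret r: Vector_Spaces.linear fscale fscale "\<lambda>t. symq W (split_mult j (tens a' t))"
    by (rule linear_compose_app[OF linear_tens_right linear_symq_split_mult])
  have "a - a' \<in> sym_rel W" "b - b' \<in> sym_rel W"
    using assms by (simp_all add: quot_map_eq_iff[OF subspace_sym_rel])
  then show ?thesis
    using l.diff[of a a'] r.diff[of b b'] by (simp add: symq_split_mult_tens)
qed

lemma symq_split_mult_sym_rel2:
  assumes "r \<in> sym_rel2 W"
  shows "symq W (split_mult j r) = 0"
proof -
  interpret q: Vector_Spaces.linear fscale fscale "\<lambda>t. symq W (split_mult j t)"
    by (rule linear_symq_split_mult)
  show ?thesis
    using assms unfolding sym_rel2_def
    by (rule q.eq_0_on_span[rotated]) (auto simp: symq_split_mult_tens)
qed

text \<open>Splitting off a letter and putting it back in front costs the Koszul sign twice, so each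
  of the \<open>length w\<close> letters contributes one copy of \<open>g w\<close>.\<close>

lemma spsum_split_first:
  assumes s: "vector_space (s :: 'k::field \<Rightarrow> 'c \<Rightarrow> 'c::ab_group_add)"
  shows "gsym V g \<Longrightarrow> gword V w \<Longrightarrow> spsum w (\<lambda>u v. if length u = 1 then g (u @ v) else 0) = s (of_nat (length w)) (g w)"
proof (induction w arbitrary: g)
  case Nil
  interpret s: vector_space s by fact
  show ?case by simp
next
  case (Cons x w)
  interpret s: vector_space s by fact
  have x: "snd x \<in> grade V (fst x)" and w: "gword V w" using Cons.prems by simp_all
  have "spsum w (\<lambda>u v. sg (fst x * wt u) (if length u = 1 then g (u @ x # v) else 0)) =
      spsum w (\<lambda>u v. if length u = 1 then g (x # u @ v) else 0)"
    using w
  proof (rule spsum_cong_gword)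
    fix u v assume uv: "gword V u" "gword V v"
    show "sg (fst x * wt u) (if length u = 1 then g (u @ x # v) else 0) = (if length u = 1 then g (x # u @ v) else 0)"
    proof (cases "length u = 1")
      case True
      then obtain y where y: "u = [y]" by (auto simp: length_Suc_conv)
      have "g ([] @ y # x # v) = sg (fst y * fst x) (g ([] @ x # y # v))"
        by (rule gsym_swap[OF Cons.prems(1)]) (use uv x y in simp_all)
      then have "sg (fst x * wt u) (g (u @ x # v)) = sg (fst x * fst y + fst y * fst x) (g (x # u @ v))"
        by (simp add: y)
      also have "\<dots> = sg 0 (g (x # u @ v))"
        by (rule sg_parity) simp
      finally show ?thesis using True by simp
    qed simp
  qed
  also have "\<dots> = s (of_nat (length w)) (g (x # w))"
    using Cons.IH[OF gsym_Cons[OF Cons.prems(1) x] w] by simp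
  finally have 2: "spsum w (\<lambda>u v. sg (fst x * wt u) (if length u = 1 then g (u @ x # v) else 0)) = s (of_nat (length w)) (g (x # w))" .
  have "spsum w (\<lambda>u v. if length (x # u) = 1 then g ((x # u) @ v) else 0) = spsum w (\<lambda>u v. if u = [] then g (x # v) else 0)"
    by (rule spsum_cong) simp_all
  then show ?case
    using 2 by (simp add: spsum_left_Nil s.scale_left_distrib)
qed

context graded_space
begin

lemma hsum_symq: "hsum V xs (\<lambda>w. symq V (mon (map snd w))) = symq V (mon xs)"
  using hsum_mon[OF linear_symq, where us = "[]"] by (simp add: symq_eq_0)

lemma symq_split_mult_comult:
  "symq V (split_mult j (comult V t)) = fscale (of_nat j) (symq V (sym_proj j t))"
proof (rule linear_mon_eqI[where t = t])
  show "Vector_Spaces.linear fscale fscale (\<lambda>t. symq V (split_mult j (comult V t)))"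
    by (rule linear_compose_app[OF linear_comult linear_symq_split_mult])
  have a: "Modules.additive (fscale (c::'k) :: ('a list \<Rightarrow>\<^sub>0 'k) \<Rightarrow> _)" for c
    by (simp add: Modules.additive_def fscale.scale_right_distrib)
  have "Vector_Spaces.linear fscale fscale (\<lambda>t. symq V (sym_proj j t))"
    by (rule linear_compose_app[OF linear_sym_proj linear_symq])
  then show "Vector_Spaces.linear fscale fscale (\<lambda>t. fscale (of_nat j) (symq V (sym_proj j t)))"
    by (simp add: Vector_Spaces.linear_iff fscale.scale_right_distrib mult.commute)
  fix xs :: "'a list"
  have "symq V (split_mult j (comult V (mon xs))) = hsum V xs (\<lambda>w. spsum w (\<lambda>u v. symq V (split_mult j (mon (map snd u, map snd v)))))"
    by (rule comult_eval[OF linear_symq_split_mult])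
  also have "\<dots> = hsum V xs (\<lambda>w. if length xs = j then fscale (of_nat j) (symq V (mon (map snd w))) else 0)"
  proof (rule hsum_cong_hom)
    fix w assume w: "gword V w" "length w = length xs"
    have "spsum w (\<lambda>u v. symq V (split_mult j (mon (map snd u, map snd v)))) =
        spsum w (\<lambda>u v. if length xs = j then (if length u = 1 then symq V (mon (map snd (u @ v))) else 0) else 0)"
      by (rule spsum_cong) (use w(2) in \<open>auto simp: split_mult_mon\<close>)
    also have "\<dots> = (if length xs = j then fscale (of_nat (length w)) (symq V (mon (map snd w))) else 0)"
      using spsum_split_first[OF vector_space_fscale conjunct2[OF gmsym_symq[unfolded gmsym_def]] w(1)]
      by simp
    finally show "spsum w (\<lambda>u v. symq V (split_mult j (mon (map snd u, map snd v)))) =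
        (if length xs = j then fscale (of_nat j) (symq V (mon (map snd w))) else 0)"
      using w(2) by simp
  qed
  also have "\<dots> = fscale (of_nat j) (symq V (sym_proj j (mon xs)))"
    by (simp add: sym_proj_mon additive_hsum[OF a, symmetric] hsum_symq)
  finally show "symq V (split_mult j (comult V (mon xs))) = fscale (of_nat j) (symq V (sym_proj j (mon xs)))" .
qed

end

text \<open>The comultiplication expresses the component in \<open>Sym^j\<close> through values on
  complementary halves of the word. For \<open>j \<ge> 2\<close> the splits with an empty half
  contribute nothing, and in all others both halves are shorter than \<open>xs\<close>.\<close>

lemma symq_comult_components_unique:
  fixes V :: "('k::field_char_0, 'a::ab_group_add, 'm) gspace_scheme" and W :: "('k, 'b::ab_group_add, 'n) gspace_scheme"
  assumes "graded_space V" "graded_space W" and F: "coalg_morphism V W F" and G: "coalg_morphism V W G"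
    and eq: "\<And>ys. length ys < length xs \<Longrightarrow> symq W (F (mon ys)) = symq W (G (mon ys))"
    and j: "j \<ge> 2"
  shows "symq W (sym_proj j (F (mon xs))) = symq W (sym_proj j (G (mon xs)))"
proof -
  interpret W: graded_space W by fact
  interpret V: graded_space V by fact
  have c: "fscale (of_nat j) (symq W (sym_proj j (H (mon xs)))) =
      hsum V xs (\<lambda>w. spsum w (\<lambda>u v. symq W (split_mult j (tens (H (mon (map snd u))) (H (mon (map snd v)))))))"
    if H: "coalg_morphism V W H" for H
  proof -
    have "comult W (H (mon xs)) - tens_map H H (comult V (mon xs)) \<in> sym_rel2 W"
      using H by (simp add: coalg_morphism_def)
    from symq_split_mult_sym_rel2[OF this, of j]
    have "symq W (split_mult j (comult W (H (mon xs)))) = symq W (split_mult j (tens_map H H (comult V (mon xs))))"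
      using module_hom.diff[OF linear_symq_split_mult[of W j, unfolded linear_iff_module_hom],
          of "comult W (H (mon xs))" "tens_map H H (comult V (mon xs))"] by simp
    then show ?thesis
      unfolding W.symq_split_mult_comult
        comult_eval[OF linear_compose_app[OF linear_tens_map linear_symq_split_mult]] tens_map_mon .
  qed
  have F0: "symq W (F (mon [])) = symq W (mon [])" and G0: "symq W (G (mon [])) = symq W (mon [])"
    using F G by (simp_all add: coalg_morphism_iff)
  \<comment> \<open>\<open>split_mult j\<close> keeps only a left factor of length 1 and a right
    factor of length \<open>j - 1\<close>, which is positive; an empty word on either side is
    therefore discarded.\<close>
  have lm: "symq W (split_mult j (tens a (mon []))) = 0" "symq W (split_mult j (tens (mon []) a)) = 0" for a :: "'b list \<Rightarrow>\<^sub>0 'k"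
  proof -
    have 0: "Vector_Spaces.linear fscale fscale (\<lambda>t. 0)"
      by (simp add: Vector_Spaces.linear_iff vector_space_fscale)
    show "symq W (split_mult j (tens a (mon []))) = 0"
      by (rule linear_mon_eqI[OF linear_compose_app[OF linear_tens_left linear_symq_split_mult] 0])
        (use j in \<open>simp add: split_mult_mon\<close>)
    show "symq W (split_mult j (tens (mon []) a)) = 0"
      by (rule linear_mon_eqI[OF linear_compose_app[OF linear_tens_right linear_symq_split_mult] 0])
        (simp add: split_mult_mon)
  qed
  have "fscale (of_nat j) (symq W (sym_proj j (F (mon xs)))) = fscale (of_nat j) (symq W (sym_proj j (G (mon xs))))"
    unfolding c[OF F] c[OF G]
  proof (rule hsum_cong_len, rule spsum_cong[OF refl])
    fix u v w :: "'a gword" assume len: "length w = length xs" "length u + length v = length w"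
    consider "u = []" | "v = []" | "length u < length xs" "length v < length xs"
      using len by (cases u; cases v) auto
    then show "symq W (split_mult j (tens (F (mon (map snd u))) (F (mon (map snd v))))) =
        symq W (split_mult j (tens (G (mon (map snd u))) (G (mon (map snd v)))))"
    proof cases
      case 1
      have "symq W (split_mult j (tens (F (mon [])) b)) = 0" "symq W (split_mult j (tens (G (mon [])) b)) = 0" for b
        using symq_split_mult_tens_cong[OF F0 refl, of j b] symq_split_mult_tens_cong[OF G0 refl, of j b] lm by simp_all
      then show ?thesis by (simp add: 1)
    next
      case 2
      have "symq W (split_mult j (tens b (F (mon [])))) = 0" "symq W (split_mult j (tens b (G (mon [])))) = 0" for b
        using symq_split_mult_tens_cong[OF refl F0, of j b] symq_split_mult_tens_cong[OF refl G0, of j b] lm by simp_all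
      then show ?thesis by (simp add: 2)
    next
      case 3
      then show ?thesis by (intro symq_split_mult_tens_cong eq) simp_all
    qed
  qed
  \<comment> \<open>\<open>of_nat j\<close> is invertible because the field has characteristic
    0.\<close>
  then show ?thesis using j by simp
qed

lemma linear_letter: "Vector_Spaces.linear (smul V) fscale (\<lambda>x. symq V (mon [x]))" if "vector_space (smul V)"
  using symq_add[of V "[]" _ _ "[]"] symq_scale[of V "[]" _ _ "[]"] that
  by (simp add: Vector_Spaces.linear_iff vector_space_fscale)

lemma symq_sym_proj_1:
  assumes "vector_space (smul V)"
  shows "symq V (sym_proj 1 t) = symq V (mon [cogen V t])"
proof (rule linear_mon_eqI[where t = t])
  show "Vector_Spaces.linear fscale fscale (\<lambda>t. symq V (sym_proj 1 t))"
    by (rule linear_compose_app[OF linear_sym_proj linear_symq])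
  show l: "Vector_Spaces.linear fscale fscale (\<lambda>t. symq V (mon [cogen V t]))"
    by (rule linear_compose_app[OF linear_cogen[OF assms] linear_letter[OF assms]])
  have "symq V (mon [0]) = 0"
    using linear_letter[OF assms] by (auto simp: linear_iff_module_hom dest: module_hom.zero)
  then show "symq V (sym_proj 1 (mon xs)) = symq V (mon [cogen V (mon xs)])" for xs
    by (cases xs rule: remdups_adj.cases) (simp_all add: sym_proj_mon cogen_mon[OF assms])
qed

lemma sym_proj_0: "sym_proj 0 t = fscale (counit t) (mon [])"
proof (rule linear_mon_eqI[OF linear_sym_proj, where t = t])
  show "Vector_Spaces.linear fscale fscale (\<lambda>t. fscale (counit t) (mon []))"
    by (simp add: Vector_Spaces.linear_iff counit_add counit_scale fscale.scale_left_distrib vector_space_fscale)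
qed (simp add: sym_proj_mon counit_mon)

lemma sum_sym_proj: "(\<Sum>j\<in>length ` Poly_Mapping.keys t. sym_proj j t) = t"
proof -
  let ?J = "length ` Poly_Mapping.keys t"
  have "(\<Sum>j\<in>?J. sym_proj j t) =
      (\<Sum>j\<in>?J. \<Sum>xs\<in>Poly_Mapping.keys t. fscale (Poly_Mapping.lookup t xs) (if length xs = j then mon xs else 0))"
    by (simp add: sym_proj_def lin_ext_def)
  also have "\<dots> = (\<Sum>xs\<in>Poly_Mapping.keys t. \<Sum>j\<in>?J. fscale (Poly_Mapping.lookup t xs) (if length xs = j then mon xs else 0))"
    by (rule sum.swap)
  also have "\<dots> = (\<Sum>xs\<in>Poly_Mapping.keys t. fscale (Poly_Mapping.lookup t xs) (mon xs))"
  proof (rule sum.cong[OF refl])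
    fix xs assume "xs \<in> Poly_Mapping.keys t"
    then have *: "length xs \<in> ?J" by simp
    have "(\<Sum>j\<in>?J. fscale (Poly_Mapping.lookup t xs) (if length xs = j then mon xs else 0)) =
        (\<Sum>j\<in>?J. if length xs = j then fscale (Poly_Mapping.lookup t xs) (mon xs) else 0)"
      by (rule sum.cong) auto
    then show "(\<Sum>j\<in>?J. fscale (Poly_Mapping.lookup t xs) (if length xs = j then mon xs else 0)) =
        fscale (Poly_Mapping.lookup t xs) (mon xs)"
      using * by simp
  qed
  finally show ?thesis by (simp only: free_expand)
qed

text \<open>An element has finite support, hence is the sum of its components by length. Those of
  length 0 and 1 are governed by \<open>counit\<close> and \<open>cogen\<close>.\<close>

lemma symq_eq_components:
  assumes "vector_space (smul V)" "counit s = counit t" "cogen V s = cogen V t"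
    and "\<And>j. j \<ge> 2 \<Longrightarrow> symq V (sym_proj j s) = symq V (sym_proj j t)"
  shows "symq V s = symq V t"
proof -
  interpret q: Vector_Spaces.linear fscale fscale "symq V" by (rule linear_symq)
  interpret p: Vector_Spaces.linear fscale fscale "sym_proj j" for j by (rule linear_sym_proj)
  have "symq V (sym_proj j s) = symq V (sym_proj j t)" for j
  proof -
    consider "j = 0" | "j = 1" | "j \<ge> 2" by linarith
    then show ?thesis
      by cases (simp_all add: sym_proj_0 symq_sym_proj_1[OF assms(1)] assms(2-) flip: One_nat_def)
  qed
  then have "symq V (sym_proj j (s - t)) = 0" for j
    by (simp add: p.diff q.diff)
  then have "symq V (\<Sum>j\<in>length ` Poly_Mapping.keys (s - t). sym_proj j (s - t)) = 0"
    by (simp add: q.sum)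
  then show ?thesis
    by (simp add: sum_sym_proj q.diff)
qed

lemma cogen_sym_rel:
  assumes s: "vector_space (smul V)" and "r \<in> sym_rel V"
  shows "cogen V r = 0"
proof (rule sym_rel_kernelI[OF linear_cogen[OF s] _ _ _ assms(2)])
  interpret s: vector_space "smul V" by fact
  have *: "cogen V (mon (us @ x # vs)) = (if us = [] \<and> vs = [] then x else 0)" for us x vs
    by (cases us; cases "tl us"; cases vs) (auto simp: cogen_mon[OF s] split: list.splits)
  show "cogen V (mon (us @ (x + y) # vs)) = cogen V (mon (us @ x # vs)) + cogen V (mon (us @ y # vs))" for us x y vs
    by (simp add: *)
  show "cogen V (mon (us @ smul V c x # vs)) = smul V c (cogen V (mon (us @ x # vs)))" for us c x vs
    by (simp add: *)
  show "cogen V (mon (us @ x # y # vs)) = sg (m * n) (cogen V (mon (us @ y # x # vs)))" for us x y vs m n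
    by (simp add: *)
qed

section \<open>The codifferential of a DGLA\<close>

lemma shift_simps [simp]:
  "smul (shift L) = smul L" "grade (shift L) n = grade L (n + 1)" "diff (shift L) x = - diff L x"
  by (simp_all add: shift_def)

lemma hom_decomp_shift: "hom_decomp (shift L) x f \<longleftrightarrow> hom_decomp L x (\<lambda>n. f (n - 1))"
proof -
  have bij: "bij_betw (\<lambda>n. n + 1) {n. f n \<noteq> 0} {n. f (n - 1) \<noteq> 0}"
    by (rule bij_betw_byWitness[where f' = "\<lambda>n. n - 1"]) auto
  have "(\<forall>n. f n \<in> grade L (n + 1)) \<longleftrightarrow> (\<forall>n. f (n - 1) \<in> grade L n)"
    by (metis add_diff_cancel diff_add_cancel)
  moreover have "(\<Sum>n | f (n - 1) \<noteq> 0. f (n - 1)) = (\<Sum>n | f n \<noteq> 0. f n)"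
    using sum.reindex_bij_betw[OF bij, of "\<lambda>n. f (n - 1)"] by simp
  ultimately show ?thesis
    using bij_betw_finite[OF bij] by (simp add: hom_decomp_def)
qed

lemma graded_space_shift:
  assumes "graded_space L"
  shows "graded_space (shift L)"
proof -
  interpret graded_space L by fact
  show ?thesis
  proof (intro graded_space.intro graded_space_axioms.intro)
    show "vector_space (smul (shift L))" by (simp add: vector_space_axioms)
    show "module.subspace (smul (shift L)) (grade (shift L) n)" for n by (simp add: grade_subspace)
    show "\<exists>!f. hom_decomp (shift L) x f" for x
    proof (rule ex1I)
      show *: "hom_decomp (shift L) x (\<lambda>n. hcomp L (n + 1) x)"
        using hom_decomp_hcomp[of x] by (simp add: hom_decomp_shift)
      fix f assume "hom_decomp (shift L) x f"
      then have "hcomp L n x = f (n - 1)" for n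
        by (intro hcomp_eqI) (simp add: hom_decomp_shift)
      then show "f = (\<lambda>n. hcomp L (n + 1) x)" by simp
    qed
  qed
qed

lemma gmsym_add:
  assumes s: "vector_space s" and "gmsym V s F" "gmsym V s G"
  shows "gmsym V s (\<lambda>w. F w + G w)"
proof -
  interpret s: vector_space s by fact
  have F: "gmult V s F" "gsym V F" and G: "gmult V s G" "gsym V G" using assms(2,3) by (simp_all add: gmsym_def)
  have "gmult V s (\<lambda>w. F w + G w)"
    by (rule gmultI) (simp_all add: gmult_add[OF F(1)] gmult_scale[OF F(1)] gmult_add[OF G(1)] gmult_scale[OF G(1)]
      s.scale_right_distrib algebra_simps)
  moreover have "gsym V (\<lambda>w. F w + G w)"
  proof (rule gsymI)
    fix us vs x y assume *: "gword V us" "gword V vs" "snd x \<in> grade V (fst x)" "snd y \<in> grade V (fst y)"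
    show "F (us @ x # y # vs) + G (us @ x # y # vs) = sg (fst x * fst y) (F (us @ y # x # vs) + G (us @ y # x # vs))"
      by (simp only: gsym_swap[OF F(2) *] gsym_swap[OF G(2) *] sg_add)
  qed
  ultimately show ?thesis by (simp add: gmsym_def)
qed

lemma gmsym_letter:
  assumes f: "Vector_Spaces.linear (smul V) s f"
  shows "gmsym V s (\<lambda>w. case w of [x] \<Rightarrow> f (snd x) | _ \<Rightarrow> 0)"
proof -
  interpret f: Vector_Spaces.linear "smul V" s f by fact
  have *: "(case us @ x # vs of [x] \<Rightarrow> f (snd x) | _ \<Rightarrow> 0) = (if us = [] \<and> vs = [] then f (snd x) else 0)" for us x vs
    by (cases us; cases "tl us"; cases vs) (auto split: list.splits)
  have "gmult V s (\<lambda>w. case w of [x] \<Rightarrow> f (snd x) | _ \<Rightarrow> 0)"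
    by (rule gmultI) (simp_all add: * f.add f.scale)
  moreover have "gsym V (\<lambda>w. case w of [x] \<Rightarrow> f (snd x) | _ \<Rightarrow> 0)"
    by (rule gsymI) (simp add: *)
  ultimately show ?thesis by (simp add: gmsym_def)
qed

text \<open>The structure map \<open>Q^1_2\<close> on the shifted space: \<open>d\<close> is the
  degree of \<open>x\<close> there, and the exponent \<open>d + 1\<close> encodes the sign
  -(-1)^d.\<close>

definition qbr :: "('k::field, 'a::ab_group_add, 'm) dgla_data_scheme \<Rightarrow> int \<Rightarrow> 'a \<Rightarrow> 'a \<Rightarrow> 'a" where
  "qbr L d x y = sg (d + 1) (bracket L x y)"

definition Qw2 :: "('k::field, 'a::ab_group_add, 'm) dgla_data_scheme \<Rightarrow> 'a gword \<Rightarrow> 'a" where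
  "Qw2 L w = (case w of [x, y] \<Rightarrow> qbr L (fst x) (snd x) (snd y) | _ \<Rightarrow> 0)"

context dgla
begin

abbreviation "V \<equiv> shift L"

sublocale V: graded_space V
  by (rule graded_space_shift) (rule graded_space_axioms)

lemma diff_linear: "Vector_Spaces.linear (smul L) (smul L) (diff L)"
  and diff_grade: "x \<in> grade L n \<Longrightarrow> diff L x \<in> grade L (n + 1)"
  using diff_linear_deg by (auto simp: linear_deg_def)

lemma qbr_linear_left: "Vector_Spaces.linear (smul L) (smul L) (\<lambda>x. qbr L d x y)"
  using bracket_linear_left[of y] by (simp add: qbr_def Vector_Spaces.linear_iff sg_add linear_sg_scale vector_space_axioms)

lemma qbr_linear_right: "Vector_Spaces.linear (smul L) (smul L) (qbr L d x)"
  using bracket_linear_right[of x] by (simp add: qbr_def Vector_Spaces.linear_iff sg_add linear_sg_scale vector_space_axioms)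

lemmas qbr_additive_left = additive_linear[OF qbr_linear_left]
  and qbr_additive_right = additive_linear[OF qbr_linear_right]
  and diff_additive = additive_linear[OF diff_linear]

lemma qbr_add_left: "qbr L d (x + x') y = qbr L d x y + qbr L d x' y"
  and qbr_add_right: "qbr L d x (y + y') = qbr L d x y + qbr L d x y'"
  and qbr_scale_left: "qbr L d (smul L c x) y = smul L c (qbr L d x y)"
  and qbr_scale_right: "qbr L d x (smul L c y) = smul L c (qbr L d x y)"
  and qbr_zero [simp]: "qbr L d 0 y = 0" "qbr L d x 0 = 0"
  using qbr_linear_left[of d y] qbr_linear_right[of d x] Modules.additive.zero[OF qbr_additive_left]
    Modules.additive.zero[OF qbr_additive_right]
  by (auto simp: Vector_Spaces.linear_iff)

lemma bracket_sg: "bracket L (sg n x) y = sg n (bracket L x y)" "bracket L x (sg n y) = sg n (bracket L x y)"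
  using linear_sg[OF bracket_linear_left[of y]] linear_sg[OF bracket_linear_right[of x]] by simp_all

lemma antisym_sg: "x \<in> grade L m \<Longrightarrow> y \<in> grade L n \<Longrightarrow> bracket L x y = sg (m * n + 1) (bracket L y x)"
  using bracket_antisym[of x m y n] by (simp add: scale_powi_minus_one[OF vector_space_axioms] sg_def)

text \<open>The shift raises both degrees by one. Modulo 2 the exponent of graded antisymmetry
  together with the signs of the two \<open>qbr\<close> leaves \<open>d * e\<close>, so the bracket
  becomes graded symmetric.\<close>

lemma qbr_sym:
  assumes "x \<in> grade V d" "y \<in> grade V e"
  shows "qbr L d x y = sg (d * e) (qbr L e y x)"
proof -
  have "bracket L x y = sg ((d + 1) * (e + 1) + 1) (bracket L y x)"
    using assms by (intro antisym_sg) simp_all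
  then show ?thesis
    unfolding qbr_def by (simp only: sg_sg) (rule sg_parity, auto)
qed

lemma qbr_grade: "x \<in> grade V d \<Longrightarrow> y \<in> grade V e \<Longrightarrow> qbr L c x y \<in> grade V (d + e + 1)"
  using bracket_grade[of x "d + 1" y "e + 1"] by (simp add: qbr_def grade_sg add_ac)

text \<open>Replacing \<open>x\<close> by \<open>diff L x\<close> raises its degree and so changes
  the sign inside \<open>qbr\<close>; this is the origin of the overall minus in the Leibniz
  rule.\<close>

lemma diff_qbr:
  assumes "x \<in> grade V d"
  shows "diff L (qbr L d x y) = - qbr L (d + 1) (diff L x) y - sg d (qbr L d x (diff L y))"
proof -
  have "diff L (bracket L x y) = bracket L (diff L x) y + sg (d + 1) (bracket L x (diff L y))"
    using diff_bracket[of x "d + 1" y] assms by (simp add: scale_powi_minus_one[OF vector_space_axioms])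
  then show ?thesis
    by (simp add: qbr_def linear_sg[OF diff_linear] sg_add) (simp add: sg_def)
qed

text \<open>The Jacobi identity in symmetric form: one nested bracket for each way of choosing the
  inner pair, with the Koszul sign of the corresponding unshuffle in the shifted space. After
  antisymmetry has moved all inner brackets to the left, only parities remain to be
  compared.\<close>

lemma qbr_jacobi:
  assumes x: "x \<in> grade V d" and y: "y \<in> grade V e" and z: "z \<in> grade V l"
  shows "qbr L (d + e + 1) (qbr L d x y) z + sg (e * l) (qbr L (d + l + 1) (qbr L d x z) y) +
    sg (d * e + d * l) (qbr L (e + l + 1) (qbr L e y z) x) = 0"
proof -
  have g: "x \<in> grade L (d + 1)" "y \<in> grade L (e + 1)" "z \<in> grade L (l + 1)" using assms by simp_all
  have "bracket L x (bracket L y z) =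
      bracket L (bracket L x y) z + sg ((d + 1) * (e + 1)) (bracket L y (bracket L x z))"
    using bracket_jacobi[OF g] by (simp add: scale_powi_minus_one[OF vector_space_axioms])
  moreover have "bracket L x (bracket L y z) = sg ((d + 1) * (e + 1 + (l + 1)) + 1) (bracket L (bracket L y z) x)"
    by (intro antisym_sg g bracket_grade)
  moreover have "bracket L y (bracket L x z) = sg ((e + 1) * (d + 1 + (l + 1)) + 1) (bracket L (bracket L x z) y)"
    by (intro antisym_sg g bracket_grade)
  ultimately have "bracket L (bracket L x y) z = sg ((d + 1) * (e + 1 + (l + 1)) + 1) (bracket L (bracket L y z) x) -
      sg ((d + 1) * (e + 1)) (sg ((e + 1) * (d + 1 + (l + 1)) + 1) (bracket L (bracket L x z) y))"
    by (simp only: eq_diff_eq)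
  then show ?thesis
    unfolding qbr_def bracket_sg by (cases "even d"; cases "even e"; cases "even l") (simp_all add: sg_def)
qed

lemma Qw_simps: "Qw L [] = 0" "Qw L [x] = - diff L (snd x)" "Qw L [x, y] = qbr L (fst x) (snd x) (snd y)"
    "Qw L (x # y # z # w) = 0"
  by (simp_all add: Qw_def Q_str_def qbr_def scale_powi_minus_one[OF vector_space_axioms] sg_def)

lemma Qw_eq: "Qw L w = (case w of [x] \<Rightarrow> - diff L (snd x) | _ \<Rightarrow> 0) + Qw2 L w"
  by (auto simp: Qw_simps Qw2_def split: list.split)

lemma Qw_grade: "gword V w \<Longrightarrow> Qw L w \<in> grade V (wt w + 1)"
  using diff_grade[of _ "_ + 1"] qbr_grade by (auto simp: Qw_eq Qw2_def grade_minus add_ac split: list.split)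

lemma gmsym_Qw2: "gmsym V (smul L) (Qw2 L)"
proof -
  have "gmult V (smul L) (Qw2 L)"
  proof (rule gmultI)
    fix us vs and d x y
    show "Qw2 L (us @ (d, x + y) # vs) = Qw2 L (us @ (d, x) # vs) + Qw2 L (us @ (d, y) # vs)"
      by (cases us; cases "tl us"; cases vs; cases "tl vs") (auto simp: Qw2_def qbr_add_left qbr_add_right split: list.splits)
    show "Qw2 L (us @ (d, smul V c x) # vs) = smul L c (Qw2 L (us @ (d, x) # vs))" for c
      by (cases us; cases "tl us"; cases vs; cases "tl vs") (auto simp: Qw2_def qbr_scale_left qbr_scale_right split: list.splits)
  qed
  moreover have "gsym V (Qw2 L)"
  proof (rule gsymI)
    fix us vs x y
    assume "snd x \<in> grade V (fst x)" "snd y \<in> grade V (fst y)"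
    from qbr_sym[OF this]
    show "Qw2 L (us @ x # y # vs) = sg (fst x * fst y) (Qw2 L (us @ y # x # vs))"
      by (cases us; cases vs) (auto simp: Qw2_def split: list.split)
  qed
  ultimately show ?thesis by (simp add: gmsym_def)
qed

lemma gmsym_Qw: "gmsym V (smul L) (Qw L)"
proof -
  have "Vector_Spaces.linear (smul V) (smul L) (\<lambda>x. - diff L x)"
    using diff_linear by (simp add: Vector_Spaces.linear_iff)
  from gmsym_add[OF vector_space_axioms gmsym_letter[OF this] gmsym_Qw2] show ?thesis
    by (simp add: Qw_eq[symmetric])
qed

text \<open>The two descriptions of the codifferential differ by the position of the letter that is
  produced.\<close>

lemma spsum_Qw_eq_qsum:
  "gsym V g \<Longrightarrow> gword V w \<Longrightarrow>
    spsum w (\<lambda>u v. if u = [] then 0 else g ((wt u + 1, Qw L u) # v)) = qsum (Qw L) w g"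
proof (induction w arbitrary: g)
  case (Cons x w)
  let ?Q = "\<lambda>u. (wt u + 1, Qw L u)"
  have x: "snd x \<in> grade V (fst x)" and w: "gword V w" using Cons.prems by simp_all
  have "spsum w (\<lambda>u v. sg (fst x * wt u) (if u = [] then 0 else g (?Q u # x # v))) =
      spsum w (\<lambda>u v. sg (fst x) (if u = [] then 0 else g (x # ?Q u # v)))"
    using w
  proof (rule spsum_cong_gword)
    fix u v assume uv: "gword V u" "gword V v"
    have "snd (?Q u) \<in> grade V (fst (?Q u))"
      using Qw_grade[OF uv(1)] by simp
    then have "g (?Q u # x # v) = sg ((wt u + 1) * fst x) (g (x # ?Q u # v))"
      using gsym_swap[OF Cons.prems(1), of "[]" v "?Q u" x] uv(2) x by simp
    then have "sg (fst x * wt u) (g (?Q u # x # v)) = sg (fst x) (g (x # ?Q u # v))"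
      by (simp only: sg_sg) (rule sg_parity, auto)
    then show "sg (fst x * wt u) (if u = [] then 0 else g (?Q u # x # v)) = sg (fst x) (if u = [] then 0 else g (x # ?Q u # v))"
      by simp
  qed
  also have "\<dots> = sg (fst x) (qsum (Qw L) w (\<lambda>t. g (x # t)))"
    using Cons.IH[OF gsym_Cons[OF Cons.prems(1) x] w] by (simp add: spsum_sg)
  finally show ?case by simp
qed simp

text \<open>Symmetry is not visible in the recursion for \<open>qsum\<close>, which treats the first
  letter separately. It is proved for the form with the produced letter in front, where
  \<open>gmsym_spsum\<close> applies.\<close>

lemma gmsym_qsum:
  assumes s': "vector_space s'" and g: "gmsym V s' g"
  shows "gmsym V s' (\<lambda>w. qsum (Qw L) w g)"
proof (rule V.gmsym_cong)
  have g': "gmult V s' g" "gsym V g" using g by (simp_all add: gmsym_def)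
  interpret s': vector_space s' by fact
  show "gmsym V s' (\<lambda>w. spsum w (\<lambda>u v. if u = [] then 0 else g ((wt u + 1, Qw L u) # v)))"
  proof (rule gmsym_spsum[OF s' gmsym2I])
    fix v assume v: "gword V v"
    let ?\<phi> = "\<lambda>n y. g ((n, hcomp V n y) # v)"
    have "Vector_Spaces.linear (smul L) s' (?\<phi> n)" for n
      unfolding Vector_Spaces.linear_iff
      using gmult_add[OF g'(1) gword_simps(1) v] gmult_scale[OF g'(1) gword_simps(1) v]
      by (simp add: vector_space_axioms s' V.hcomp_add V.hcomp_scale[unfolded shift_simps] del: shift_simps(2))
    then have "gmsym V s' (\<lambda>u. ?\<phi> (1 + wt u) (Qw L u))"
      by (intro gmsym_wt_param[where F = "\<lambda>n u. ?\<phi> n (Qw L u)"] gmsym_linear[OF _ gmsym_Qw])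
    then show "gmsym V s' (\<lambda>u. if u = [] then 0 else g ((wt u + 1, Qw L u) # v))"
    proof (rule V.gmsym_cong)
      fix u assume u: "gword V u"
      have "hcomp V (1 + wt u) (Qw L u) = Qw L u"
        using V.hcomp_hom[OF Qw_grade[OF u]] by (simp add: add.commute)
      \<comment> \<open>The default at \<open>u = []\<close>: there \<open>Qw L\<close> is 0 and the
        label is 1, so the unguarded expression agrees with the guarded one.\<close>
      moreover have "g ((1, 0) # v) = 0"
        by (rule V.gmult_zero[OF g'(1)]) (use v in simp_all)
      ultimately show "?\<phi> (1 + wt u) (Qw L u) = (if u = [] then 0 else g ((wt u + 1, Qw L u) # v))"
        by (simp add: Qw_simps add.commute)
    qed
  next
    fix u assume u: "gword V u"
    show "gmsym V s' (\<lambda>v. if u = [] then 0 else g ((wt u + 1, Qw L u) # v))"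
    proof (rule gmsym_length[OF s', where P = "u \<noteq> []"])
      have "snd (wt u + 1, Qw L u) \<in> grade V (fst (wt u + 1, Qw L u))"
        using Qw_grade[OF u] by simp
      from gmsym_Cons[OF g this] show "gmsym V s' (\<lambda>v. if u = [] then 0 else g ((wt u + 1, Qw L u) # v))" if "u \<noteq> []"
        using that by simp
    qed simp
  qed
  show "spsum w (\<lambda>u v. if u = [] then 0 else g ((wt u + 1, Qw L u) # v)) = qsum (Qw L) w g" if "gword V w" for w
    by (rule spsum_Qw_eq_qsum[OF g'(2) that])
qed

lemma linear_codiff: "Vector_Spaces.linear fscale fscale (codiff L)"
  unfolding codiff_def by (rule linear_lin_ext)

lemma codiff_eval:
  assumes \<Phi>: "Vector_Spaces.linear fscale s' \<Phi>" and 0: "\<And>t. t \<in> sym_rel V \<Longrightarrow> \<Phi> t = 0"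
  shows "\<Phi> (codiff L (mon xs)) = hsum V xs (\<lambda>w. qsum (Qw L) w (\<lambda>t. \<Phi> (mon (map snd t))))"
proof -
  have a: "Modules.additive \<Phi>" by (rule additive_linear[OF \<Phi>])
  have "\<Phi> (codiff L (mon xs)) =
      hsum V xs (\<lambda>w. spsum w (\<lambda>u v. if u = [] then 0 else \<Phi> (mon (map snd ((wt u + 1, Qw L u) # v)))))"
    by (simp add: codiff_mon additive_hsum[OF a] additive_spsum[OF a] if_distrib[of \<Phi>] Modules.additive.zero[OF a]
        cong: if_cong)
  also have "\<dots> = hsum V xs (\<lambda>w. qsum (Qw L) w (\<lambda>t. \<Phi> (mon (map snd t))))"
    using gmsym_mon[where V = V, OF \<Phi> 0] by (intro V.hsum_cong_hom spsum_Qw_eq_qsum) (simp_all add: gmsym_def)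
  finally show ?thesis .
qed

lemma codiff_word:
  assumes \<Phi>: "Vector_Spaces.linear fscale s' \<Phi>" and 0: "\<And>t. t \<in> sym_rel V \<Longrightarrow> \<Phi> t = 0" and w: "gword V w"
  shows "\<Phi> (codiff L (mon (map snd w))) = qsum (Qw L) w (\<lambda>t. \<Phi> (mon (map snd t)))"
proof -
  have s': "vector_space s'" using \<Phi> by (simp add: Vector_Spaces.linear_iff)
  have "gmult V s' (\<lambda>w. qsum (Qw L) w (\<lambda>t. \<Phi> (mon (map snd t))))"
    using gmsym_qsum[OF s' gmsym_mon[OF \<Phi> 0]] by (simp add: gmsym_def)
  from V.hsum_map_snd_gmult[OF this w] show ?thesis
    by (simp only: codiff_eval[OF \<Phi> 0])
qed

end

section \<open>Compatibility of exponentials with coderivations\<close>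

context structure_maps
begin

text \<open>F Q and Q' F are both coderivations along F, so agreement on cogenerators, which is
  \<open>main\<close>, implies agreement. Concretely, if \<open>q\<close> acts in the block of the
  first letter, \<open>main\<close> applies to that block; otherwise the induction hypothesis
  applies to the remaining word.\<close>

lemma esum_qsum:
  fixes g :: "'b gword \<Rightarrow> 'c::ab_group_add"
  assumes s: "vector_space s"
    and q: "\<And>w. gword V w \<Longrightarrow> q w \<in> grade V (wt w + 1)"
    and q': "\<And>w. gword W w \<Longrightarrow> q' w \<in> grade W (wt w + 1)"
    and main: "\<And>w. gword V w \<Longrightarrow> esum f w q' = qsum q w f"
  shows "gmult W s g \<Longrightarrow> gword V w \<Longrightarrow> qsum q w (\<lambda>t. esum f t g) = esum f w (\<lambda>t. qsum q' t g)"
proof (induction w arbitrary: g rule: length_induct)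
  case (1 w0)
  show ?case
  proof (cases w0)
    case (Cons x w)
    let ?d = "fst x"
    let ?Q = "\<lambda>u. (wt u + 1, q u)"
    let ?F = "\<lambda>u. (wt u, f u)"
    have x: "snd x \<in> grade V (fst x)" and w: "gword V w" using 1(3) Cons by simp_all
    \<comment> \<open>The terms in which the coderivation acts outside the block of the first
      letter; both sides produce the same \<open>R\<close>.\<close>
    define R where "R = spsum w (\<lambda>u v. sg (?d + wt u) (esum f v (\<lambda>t. qsum q' t (\<lambda>r. g (?F (x # u) # r)))))"
    have "sg ?d (qsum q w (\<lambda>t. esum f (x # t) g)) =
        sg ?d (spsum w (\<lambda>u v. qsum q u (\<lambda>s. esum f v (\<lambda>t. g (?F (x # s) # t))) +
          sg (wt u) (qsum q v (\<lambda>t. esum f t (\<lambda>r. g (?F (x # u) # r))))))"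
      by (simp only: esum.simps qsum_coderivation)
    also have "\<dots> = spsum w (\<lambda>u v. sg ?d (qsum q u (\<lambda>s. esum f v (\<lambda>t. g (?F (x # s) # t))))) +
        spsum w (\<lambda>u v. sg (?d + wt u) (qsum q v (\<lambda>t. esum f t (\<lambda>r. g (?F (x # u) # r)))))"
      by (simp only: spsum_sg[symmetric] sg_add spsum_add sg_sg)
    also have "spsum w (\<lambda>u v. sg (?d + wt u) (qsum q v (\<lambda>t. esum f t (\<lambda>r. g (?F (x # u) # r))))) = R"
      unfolding R_def using w
    proof (rule spsum_cong_gword)
      fix u v assume uv: "gword V u" "gword V v" "length u + length v = length w"
      have "snd (?F (x # u)) \<in> grade W (fst (?F (x # u)))"
        using f_grade[of "x # u"] uv x by simp
      from gmult_Cons[OF 1(2) this] uv(2,3) Cons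
      have "qsum q v (\<lambda>t. esum f t (\<lambda>r. g (?F (x # u) # r))) = esum f v (\<lambda>t. qsum q' t (\<lambda>r. g (?F (x # u) # r)))"
        by (intro 1(1)[rule_format]) simp_all
      then show "sg (?d + wt u) (qsum q v (\<lambda>t. esum f t (\<lambda>r. g (?F (x # u) # r)))) =
          sg (?d + wt u) (esum f v (\<lambda>t. qsum q' t (\<lambda>r. g (?F (x # u) # r))))"
        by (simp only:)
    qed
    finally have L2: "sg ?d (qsum q w (\<lambda>t. esum f (x # t) g)) =
        spsum w (\<lambda>u v. sg ?d (qsum q u (\<lambda>s. esum f v (\<lambda>t. g (?F (x # s) # t))))) + R" .
    have L1: "spsum w (\<lambda>u v. esum f (?Q (x # u) # v) g) =
        spsum w (\<lambda>u v. spsum u (\<lambda>a b. esum f v (\<lambda>t. g (?F (?Q (x # a) # b) # t))))"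
      by (simp only: esum.simps spsum_coassoc)
    have "qsum q w0 (\<lambda>t. esum f t g) = spsum w (\<lambda>u v. esum f (?Q (x # u) # v) g) + sg ?d (qsum q w (\<lambda>t. esum f (x # t) g))"
      by (simp only: Cons qsum.simps)
    also have "\<dots> = spsum w (\<lambda>u v. qsum q (x # u) (\<lambda>s. esum f v (\<lambda>t. g (?F s # t)))) + R"
      unfolding L1 L2 by (simp only: qsum.simps spsum_add add.assoc)
    also have "spsum w (\<lambda>u v. qsum q (x # u) (\<lambda>s. esum f v (\<lambda>t. g (?F s # t)))) =
        spsum w (\<lambda>u v. esum f (x # u) (\<lambda>s. esum f v (\<lambda>t. g ((wt s + 1, q' s) # t))))"
      using w
    proof (rule spsum_cong_gword)
      fix u v assume u: "gword V u" and v: "gword V v"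
      let ?n = "wt (x # u) + 1"
      \<comment> \<open>Projecting the head letter to degree \<open>?n\<close> makes its insertion
        additive on all of the target space, so it can be moved through \<open>qsum\<close> and
        \<open>esum\<close> to expose \<open>main\<close>.\<close>
      let ?\<phi> = "\<lambda>y. esum f v (\<lambda>t. g ((?n, hcomp W ?n y) # t))"
      have xu: "gword V (x # u)" using u x by simp
      have a: "Modules.additive ?\<phi>"
        by (rule additive_linear[OF linear_esum_head[OF s 1(2) v]])
      have "qsum q (x # u) (\<lambda>s. esum f v (\<lambda>t. g (?F s # t))) = qsum q (x # u) (\<lambda>s. ?\<phi> (f s))"
      proof (rule qsum_cong_strong[OF q])
        fix s assume "wt s = wt (x # u) + 1" "gword V (x # u) \<Longrightarrow> gword V s"
        then show "esum f v (\<lambda>t. g (?F s # t)) = ?\<phi> (f s)"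
          using W.hcomp_hom[OF f_grade[of s]] xu by simp
      qed
      also have "\<dots> = ?\<phi> (esum f (x # u) q')"
        by (simp only: additive_qsum[OF a, symmetric] main[OF xu])
      also have "\<dots> = esum f (x # u) (\<lambda>s. ?\<phi> (q' s))"
        by (rule additive_esum[OF a])
      also have "\<dots> = esum f (x # u) (\<lambda>s. esum f v (\<lambda>t. g ((wt s + 1, q' s) # t)))"
      proof (rule esum_cong[OF xu])
        fix s assume "gword W s" "wt s = wt (x # u)"
        then show "?\<phi> (q' s) = esum f v (\<lambda>t. g ((wt s + 1, q' s) # t))"
          using W.hcomp_hom[OF q'[of s]] by simp
      qed
      finally show "qsum q (x # u) (\<lambda>s. esum f v (\<lambda>t. g (?F s # t))) =
          esum f (x # u) (\<lambda>s. esum f v (\<lambda>t. g ((wt s + 1, q' s) # t)))" .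
    qed
    also have "\<dots> = spsum w (\<lambda>u v. spsum v (\<lambda>a b. esum f a (\<lambda>s. esum f b (\<lambda>t. g ((wt (?F (x # u) # s) + 1, q' (?F (x # u) # s)) # t)))))"
      by (simp only: esum.simps spsum_coassoc)
    also have "\<dots> + R = esum f w0 (\<lambda>t. qsum q' t g)"
      unfolding R_def by (simp add: Cons esum_spsum esum_add esum_sg spsum_add)
    finally show ?thesis .
  qed simp
qed

end

lemma Linf_morphism_exp_map:
  assumes "dgla A" "dgla B" and f: "structure_maps (shift A) (shift B) f"
    and main: "\<And>w. gword (shift A) w \<Longrightarrow> esum f w (Qw B) = qsum (Qw A) w f"
  shows "Linf_morphism A B (exp_map (shift A) f)"
proof -
  interpret A: dgla A by fact
  interpret B: dgla B by fact
  interpret f: structure_maps "shift A" "shift B" f by fact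
  let ?E = "exp_map (shift A) f"
  let ?g = "\<lambda>t. symq (shift B) (mon (map snd t))"
  have "symq (shift B) (?E (codiff A t)) = symq (shift B) (codiff B (?E t))" for t
  proof (rule linear_mon_eqI[where t = t])
    have E: "Vector_Spaces.linear fscale fscale (\<lambda>t. symq (shift B) (?E t))"
      by (rule linear_compose_app[OF linear_exp_map linear_symq])
    have Q: "Vector_Spaces.linear fscale fscale (\<lambda>t. symq (shift B) (codiff B t))"
      by (rule linear_compose_app[OF B.linear_codiff linear_symq])
    show "Vector_Spaces.linear fscale fscale (\<lambda>t. symq (shift B) (?E (codiff A t)))"
      by (rule linear_compose_app[OF A.linear_codiff E])
    show "Vector_Spaces.linear fscale fscale (\<lambda>t. symq (shift B) (codiff B (?E t)))"
      by (rule linear_compose_app[OF linear_exp_map Q])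
    fix xs
    have g: "gmult (shift B) fscale ?g" using gmsym_symq[of "shift B"] by (simp add: gmsym_def)
    have "symq (shift B) (?E (codiff A (mon xs))) =
        hsum (shift A) xs (\<lambda>w. qsum (Qw A) w (\<lambda>t. symq (shift B) (?E (mon (map snd t)))))"
      by (rule A.codiff_eval[OF E f.exp_map_sym_rel])
    also have "\<dots> = hsum (shift A) xs (\<lambda>w. esum f w (\<lambda>t. qsum (Qw B) t ?g))"
    proof (rule A.V.hsum_cong_hom)
      fix w assume w: "gword (shift A) w"
      have "qsum (Qw A) w (\<lambda>t. symq (shift B) (?E (mon (map snd t)))) = qsum (Qw A) w (\<lambda>t. esum f t ?g)"
        by (rule qsum_cong_strong[OF A.Qw_grade]) (simp_all add: w f.exp_map_word[OF linear_symq] symq_eq_0)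
      also have "\<dots> = esum f w (\<lambda>t. qsum (Qw B) t ?g)"
        by (rule f.esum_qsum[OF vector_space_fscale A.Qw_grade B.Qw_grade main g w])
      finally show "qsum (Qw A) w (\<lambda>t. symq (shift B) (?E (mon (map snd t)))) = esum f w (\<lambda>t. qsum (Qw B) t ?g)" .
    qed
    also have "\<dots> = hsum (shift A) xs (\<lambda>w. esum f w (\<lambda>t. symq (shift B) (codiff B (mon (map snd t)))))"
      by (rule A.V.hsum_cong_hom, rule f.esum_cong) (simp_all add: B.codiff_word[OF linear_symq] symq_eq_0)
    also have "\<dots> = symq (shift B) (codiff B (?E (mon xs)))"
      by (rule exp_map_eval[OF Q, symmetric])
    finally show "symq (shift B) (?E (codiff A (mon xs))) = symq (shift B) (codiff B (?E (mon xs)))" .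
  qed
  then show ?thesis
    by (simp add: Linf_morphism_def f.coalg_morphism_exp_map sym_eq_iff)
qed

section \<open>The recursion for the structure maps\<close>

function tree_map :: "('a \<Rightarrow> 'b::ab_group_add) \<Rightarrow> ('b \<Rightarrow> 'b) \<Rightarrow> (int \<Rightarrow> 'b \<Rightarrow> 'b \<Rightarrow> 'b) \<Rightarrow> 'a gword \<Rightarrow> 'b" where
  "tree_map i T \<beta> w =
     (if length w \<le> 1 then (case w of [x] \<Rightarrow> i (snd x) | _ \<Rightarrow> 0)
      else T (spsum w (\<lambda>u v. if u = [] \<or> v = [] then 0 else \<beta> (wt u) (tree_map i T \<beta> u) (tree_map i T \<beta> v))))"
  by pat_completeness auto
termination by (relation "measure (\<lambda>(i, T, \<beta>, w). length w)") (auto simp: neq_Nil_conv)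

declare tree_map.simps [simp del]

locale dgla_retract = A: dgla A + B: dgla B
  for A :: "('k::field_char_0, 'a::ab_group_add, 'm) dgla_data_scheme"
    and B :: "('k, 'b::ab_group_add, 'n) dgla_data_scheme" +
  fixes i :: "'a \<Rightarrow> 'b" and p :: "'b \<Rightarrow> 'a" and h :: "'b \<Rightarrow> 'b"
  assumes i: "chain_map A B i" and p: "dgla_morphism B A p" and h: "linear_deg B B (-1) h"
    and homotopy: "h (diff B x) + diff B (h x) = x - i (p x)"
    and p_i [simp]: "p (i y) = y" and h_h [simp]: "h (h x) = 0"
    and h_i [simp]: "h (i y) = 0" and p_h [simp]: "p (h x) = 0"
begin

lemma i_linear: "Vector_Spaces.linear (smul A) (smul B) i"
  and i_grade: "y \<in> grade A n \<Longrightarrow> i y \<in> grade B n"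
  and i_diff: "i (diff A y) = diff B (i y)"
  using i by (auto simp: chain_map_def linear_deg_def)

lemma p_linear: "Vector_Spaces.linear (smul B) (smul A) p"
  and p_grade: "x \<in> grade B n \<Longrightarrow> p x \<in> grade A n"
  and p_diff: "p (diff B x) = diff A (p x)"
  and p_bracket: "p (bracket B x x') = bracket A (p x) (p x')"
  using p by (auto simp: dgla_morphism_def chain_map_def linear_deg_def)

lemma h_linear: "Vector_Spaces.linear (smul B) (smul B) h"
  and h_grade: "x \<in> grade B (n + 1) \<Longrightarrow> h x \<in> grade B n"
proof -
  show "Vector_Spaces.linear (smul B) (smul B) h" using h by (simp add: linear_deg_def)
  have "h ` grade B (n + 1) \<subseteq> grade B (n + 1 + - 1)" using h unfolding linear_deg_def by blast
  then show "x \<in> grade B (n + 1) \<Longrightarrow> h x \<in> grade B n" by auto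
qed

sublocale i: Vector_Spaces.linear "smul A" "smul B" i by (rule i_linear)
sublocale p: Vector_Spaces.linear "smul B" "smul A" p by (rule p_linear)
sublocale h: Vector_Spaces.linear "smul B" "smul B" h by (rule h_linear)
sublocale dA: Vector_Spaces.linear "smul A" "smul A" "diff A" by (rule A.diff_linear)
sublocale dB: Vector_Spaces.linear "smul B" "smul B" "diff B" by (rule B.diff_linear)

text \<open>The homotopy identity at \<open>h x\<close>, where the terms with \<open>h (h x)\<close>
  and \<open>p (h x)\<close> vanish.\<close>

lemma h_diff_h: "h (diff B (h x)) = h x"
  using homotopy[of "h x"] by simp

definition f :: "'a gword \<Rightarrow> 'b" where
  "f = tree_map i (\<lambda>x. h (smul B (1/2) x)) (qbr B)"

text \<open>The factor 1/2 is needed because \<open>spsum\<close> runs over ordered splits, while a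
  word in \<open>Sym^2\<close> lists each unordered pair of blocks once. Splits with an empty half
  vanish since \<open>f [] = 0\<close>.\<close>

definition S :: "'a gword \<Rightarrow> 'b" where
  "S w = smul B (1/2) (spsum w (\<lambda>u v. qbr B (wt u) (f u) (f v)))"

lemma f_Nil [simp]: "f [] = 0" and f_letter [simp]: "f [x] = i (snd x)"
  by (simp_all add: f_def tree_map.simps)

lemma S_short: "length w \<le> 1 \<Longrightarrow> S w = 0"
  by (cases w) (auto simp: S_def)

lemma f_long:
  assumes "length w \<ge> 2"
  shows "f w = h (S w)"
proof -
  have "f w = h (smul B (1/2) (spsum w (\<lambda>u v. if u = [] \<or> v = [] then 0 else qbr B (wt u) (f u) (f v))))"
    unfolding f_def using assms by (subst tree_map.simps) simp
  also have "spsum w (\<lambda>u v. if u = [] \<or> v = [] then 0 else qbr B (wt u) (f u) (f v)) =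
      spsum w (\<lambda>u v. qbr B (wt u) (f u) (f v))"
    by (rule spsum_cong) auto
  finally show ?thesis by (simp only: S_def)
qed

text \<open>As \<open>S\<close> vanishes on words of at most one letter, start and recursion merge
  into one equation, to which \<open>h\<close>, \<open>p\<close> and \<open>diff B\<close> can be
  applied uniformly.\<close>

lemma f_rec: "f w = (case w of [x] \<Rightarrow> i (snd x) | _ \<Rightarrow> 0) + h (S w)"
proof (cases "length w \<le> 1")
  case True
  then show ?thesis by (cases w) (auto simp: S_short)
next
  case False
  then show ?thesis by (cases w; cases "tl w") (auto simp: f_long)
qed

lemma half_add: "smul B (1/2) (x + x) = x"
  by (simp add: B.scale_right_distrib flip: B.scale_left_distrib)

lemma S_grade:
  assumes "gword (shift A) w" "\<And>u. gword (shift A) u \<Longrightarrow> length u < length w \<Longrightarrow> f u \<in> grade (shift B) (wt u)"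
  shows "S w \<in> grade (shift B) (wt w + 1)"
  unfolding S_def
proof (rule B.V.grade_scale[unfolded shift_simps(1)], rule B.V.grade_spsum)
  fix u v assume uv: "length u + length v = length w" "wt u + wt v = wt w" "set u \<union> set v = set w"
  then have g: "gword (shift A) u" "gword (shift A) v" using assms(1) by (auto simp: gword_def)
  show "qbr B (wt u) (f u) (f v) \<in> grade (shift B) (wt w + 1)"
  proof (cases "u = [] \<or> v = []")
    case True
    then show ?thesis using B.V.grade_0[of "wt w + 1"] by auto
  next
    case False
    then have "length u < length w" "length v < length w" using uv(1) by (auto simp: length_greater_0_conv[symmetric] simp del: length_greater_0_conv)
    then show ?thesis using B.qbr_grade[OF assms(2) assms(2), of u v "wt u"] g uv(2) by simp
  qed
qed

lemma f_grade: "gword (shift A) w \<Longrightarrow> f w \<in> grade (shift B) (wt w)"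
proof (induction w rule: length_induct)
  case (1 w)
  have "S w \<in> grade (shift B) (wt w + 1)"
    by (rule S_grade) (use 1 in auto)
  then have "h (S w) \<in> grade (shift B) (wt w)"
    using h_grade[of "S w" "wt w + 1"] by simp
  moreover have "(case w of [x] \<Rightarrow> i (snd x) | _ \<Rightarrow> 0) \<in> grade (shift B) (wt w)"
    using 1(2) i_grade B.V.grade_0[of "wt w"] by (auto split: list.split)
  ultimately show ?case
    using B.V.grade_add unfolding f_rec[of w] by blast
qed

lemma gmsym2_qbr:
  assumes "gmsym (shift A) (smul B) F"
  shows "gmsym2 (shift A) (smul B) (\<lambda>u v. qbr B (wt u) (F u) (F v))"
proof (rule gmsym2I)
  show "gmsym (shift A) (smul B) (\<lambda>u. qbr B (wt u) (F u) (F v))" for v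
    using gmsym_wt_param[of "shift A" "smul B" "\<lambda>n u. qbr B n (F u) (F v)" 0]
      gmsym_linear[OF B.qbr_linear_left assms] by simp
  show "gmsym (shift A) (smul B) (\<lambda>v. qbr B (wt u) (F u) (F v))" for u
    by (rule gmsym_linear[OF B.qbr_linear_right assms])
qed

text \<open>Values on words of length at most \<open>n + 1\<close> are given by the recursion with
  \<open>f\<close> truncated at length \<open>n\<close>, because a split with a half of full length
  has \<open>f [] = 0\<close> as its other factor.\<close>

lemma gmsym_f: "gmsym (shift A) (smul B) f"
proof (rule gmsym_truncateD)
  fix n show "gmsym (shift A) (smul B) (\<lambda>w. if length w \<le> n then f w else 0)"
  proof (induction n)
    case 0
    show ?case by (simp add: gmsym_def gmult_def gsym_def)
  next
    case (Suc n)
    let ?f = "\<lambda>w. if length w \<le> n then f w else 0"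
    let ?g = "\<lambda>w. (case w of [x] \<Rightarrow> i (snd x) | _ \<Rightarrow> 0) + h (smul B (1/2) (spsum w (\<lambda>u v. qbr B (wt u) (?f u) (?f v))))"
    have "Vector_Spaces.linear (smul B) (smul B) (\<lambda>x. h (smul B (1/2) x))"
      using h_linear by (simp add: Vector_Spaces.linear_iff B.scale_right_distrib mult.commute)
    from gmsym_linear[OF this gmsym_spsum[OF B.vector_space_axioms gmsym2_qbr[OF Suc.IH]]]
    have "gmsym (shift A) (smul B) ?g"
      using i_linear by (intro gmsym_add B.vector_space_axioms gmsym_letter) simp_all
    from gmsym_truncate[OF B.vector_space_axioms this, of "Suc n"]
    have "gmsym (shift A) (smul B) (\<lambda>w. if length w \<le> Suc n then ?g w else 0)" .
    then show ?case
    proof (rule A.V.gmsym_cong)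
      fix w
      have "spsum w (\<lambda>u v. qbr B (wt u) (?f u) (?f v)) = spsum w (\<lambda>u v. qbr B (wt u) (f u) (f v))"
        if "length w \<le> Suc n"
      proof (rule spsum_cong[OF refl])
        fix u v :: "'a gword" assume "length u + length v = length w"
        then show "qbr B (wt u) (?f u) (?f v) = qbr B (wt u) (f u) (f v)"
          using that by (cases "u = [] \<or> v = []") (auto simp: Suc_le_eq neq_Nil_conv)
      qed
      then show "(if length w \<le> Suc n then ?g w else 0) = (if length w \<le> Suc n then f w else 0)"
        by (simp add: f_rec[of w] S_def)
    qed
  qed
qed

sublocale f: structure_maps "shift A" "shift B" f
  by unfold_locales (use f_grade gmsym_f in simp_all)

text \<open>\<open>esum\<close> lists a pair of blocks with the block of the first letter in front.
  The other ordered split gives the same value by symmetry of \<open>qbr\<close>, so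
  \<open>spsum\<close> is twice this sum and the factor 1/2 cancels.\<close>

lemma esum_Qw2: "gword (shift A) w \<Longrightarrow> esum f w (Qw2 B) = S w"
proof (cases w)
  case Nil
  then show ?thesis by (simp add: S_def Qw2_def)
next
  case (Cons x w')
  assume "gword (shift A) w"
  with Cons have x: "snd x \<in> grade (shift A) (fst x)" and w': "gword (shift A) w'" by simp_all
  let ?T = "spsum w' (\<lambda>u v. qbr B (wt (x # u)) (f (x # u)) (f v))"
  have q: "Qw2 B ((n, y) # t) = qbr B n y (case map snd t of [z] \<Rightarrow> z | _ \<Rightarrow> 0)" for n y t
    by (cases t) (auto simp: Qw2_def split: list.split)
  have "esum f v (\<lambda>t. qbr B n y (case map snd t of [z] \<Rightarrow> z | _ \<Rightarrow> 0)) = qbr B n y (f v)" for n y v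
    by (simp add: additive_esum[OF B.qbr_additive_right, symmetric] esum_single)
  then have "esum f w (Qw2 B) = ?T"
    by (simp only: Cons esum.simps q)
  moreover have "spsum w' (\<lambda>u v. sg (fst x * wt u) (qbr B (wt u) (f u) (f (x # v)))) = ?T"
  proof -
    have "spsum w' (\<lambda>u v. sg (fst x * wt u) (qbr B (wt u) (f u) (f (x # v)))) =
        spsum w' (\<lambda>u v. sg (wt u * wt v) (sg (fst x * wt v) (qbr B (wt v) (f v) (f (x # u)))))"
      by (rule spsum_cocomm)
    also have "\<dots> = ?T"
      using w'
    proof (rule spsum_cong_gword)
      fix u v assume u: "gword (shift A) u" and v: "gword (shift A) v"
      have xu: "gword (shift A) (x # u)" using x u by simp
      have "sg (wt u * wt v) (sg (fst x * wt v) (qbr B (wt v) (f v) (f (x # u)))) =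
          sg 0 (qbr B (wt (x # u)) (f (x # u)) (f v))"
        unfolding B.qbr_sym[OF f_grade[OF v] f_grade[OF xu]] sg_sg by (rule sg_parity) auto
      then show "sg (wt u * wt v) (sg (fst x * wt v) (qbr B (wt v) (f v) (f (x # u)))) =
          qbr B (wt (x # u)) (f (x # u)) (f v)" by simp
    qed
    finally show ?thesis .
  qed
  ultimately show ?thesis
    by (simp add: S_def Cons half_add)
qed

lemma esum_Qw: "gword (shift A) w \<Longrightarrow> esum f w (Qw B) = S w - diff B (f w)"
proof -
  assume w: "gword (shift A) w"
  have a: "Modules.additive (\<lambda>x. - diff B x)"
    by (simp add: Modules.additive_def dB.add)
  have "Qw B = (\<lambda>t. - diff B (case map snd t of [y] \<Rightarrow> y | _ \<Rightarrow> 0) + Qw2 B t)"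
    by (rule ext) (simp add: B.Qw_eq split: list.split)
  then have "esum f w (Qw B) = esum f w (\<lambda>t. - diff B (case map snd t of [y] \<Rightarrow> y | _ \<Rightarrow> 0)) + esum f w (Qw2 B)"
    by (simp only: esum_add)
  also have "\<dots> = - diff B (f w) + S w"
    using w by (simp add: esum_Qw2 additive_esum[OF a, symmetric] esum_single)
  finally show ?thesis by simp
qed

section \<open>The Maurer-Cartan equation\<close>

definition c :: "'a gword \<Rightarrow> 'b" where
  "c w = S w - diff B (f w) - qsum (Qw A) w f"

lemma h_f [simp]: "h (f w) = 0"
  unfolding f_rec[of w] by (auto simp: h.add split: list.split)

lemma h_qsum_f [simp]: "h (qsum (Qw A) w f) = 0"
  by (simp add: additive_qsum[OF additive_linear[OF h_linear]] qsum_zero)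

text \<open>On the part \<open>i\<close> the map \<open>i\<close> commutes with the differentials
  and is killed by \<open>h\<close>; on the part \<open>h \<circ> S\<close> the identity
  \<open>h \<circ> d \<circ> h = h\<close> applies.\<close>

lemma h_diff_f: "h (diff B (f w)) = h (S w)"
  unfolding f_rec[of w] by (auto simp: dB.add h.add h_diff_h i_diff[symmetric] split: list.split)

lemma h_c: "h (c w) = 0"
  by (simp add: c_def h.diff h_diff_f)

text \<open>\<open>p\<close> kills everything except the leading term: on structure maps,
  \<open>p\<close> after \<open>f\<close> is the identity morphism of \<open>A\<close>.\<close>

lemma p_f: "p (f w) = (case w of [x] \<Rightarrow> snd x | _ \<Rightarrow> 0)"
  unfolding f_rec[of w] by (auto simp: p.add split: list.split)

lemma p_qbr: "p (qbr B d x y) = qbr A d (p x) (p y)"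
  by (simp add: qbr_def linear_sg[OF p_linear] p_bracket)

text \<open>Strictness of \<open>p\<close> turns \<open>p \<circ> c\<close> into the curvature of
  the identity morphism of \<open>A\<close>, with structure maps \<open>?e\<close>. On one letter
  the two differentials cancel; on two letters the two ordered splits halved give the bracket in
  \<open>Qw A\<close>; on longer words every term is zero.\<close>

lemma p_c:
  assumes "gword (shift A) w"
  shows "p (c w) = 0"
proof -
  let ?e = "\<lambda>w. case w of [x] \<Rightarrow> snd x | _ \<Rightarrow> (0::'a)"
  have pS: "p (S w) = smul A (1/2) (spsum w (\<lambda>u v. qbr A (wt u) (?e u) (?e v)))"
    by (simp add: S_def p.scale additive_spsum[OF additive_linear[OF p_linear]] p_qbr p_f)
  have pQ: "p (qsum (Qw A) w f) = qsum (Qw A) w ?e"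
    by (simp add: additive_qsum[OF additive_linear[OF p_linear]] p_f)
  have e: "?e (x # t) = (if t = [] then snd x else 0)" for x t
    by (cases t) simp_all
  have Q: "qsum (Qw A) (x # v) ?e = Qw A (x # v)" for x v
    unfolding qsum.simps e qsum_Nil by (simp add: spsum_right_Nil)
  have pc: "p (c w) = smul A (1/2) (spsum w (\<lambda>u v. qbr A (wt u) (?e u) (?e v))) - diff A (?e w) - qsum (Qw A) w ?e"
    by (simp only: c_def p.diff pS pQ p_diff p_f)
  have "smul A (1/2) (spsum w (\<lambda>u v. qbr A (wt u) (?e u) (?e v))) - diff A (?e w) - qsum (Qw A) w ?e = 0"
  proof (cases w)
    case Nil
    then show ?thesis by (simp add: dA.zero)
  next
    case (Cons x v)
    show ?thesis
    proof (cases v)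
      case Nil
      then show ?thesis using Cons Q[of x "[]"] by (simp add: A.Qw_simps del: qsum.simps)
    next
      case v: (Cons y v')
      show ?thesis
      proof (cases v')
        case Nil
        have "qbr A (fst y) (snd y) (snd x) = sg (fst y * fst x) (qbr A (fst x) (snd x) (snd y))"
          using assms by (intro A.qbr_sym) (simp_all add: Cons v)
        then have "sg (fst x * fst y) (qbr A (fst y) (snd y) (snd x)) = sg (fst x * fst y + fst y * fst x) (qbr A (fst x) (snd x) (snd y))"
          by simp
        also have "\<dots> = sg 0 (qbr A (fst x) (snd x) (snd y))"
          by (rule sg_parity) simp
        finally have "spsum w (\<lambda>u v. qbr A (wt u) (?e u) (?e v)) = qbr A (fst x) (snd x) (snd y) + qbr A (fst x) (snd x) (snd y)"
          by (simp add: Cons v Nil)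
        then show ?thesis
          using Q[of x v] by (simp add: Cons v Nil A.Qw_simps A.scale_right_distrib
            del: qsum.simps spsum.simps flip: A.scale_left_distrib)
      next
        case v': (Cons z v'')
        have "spsum w (\<lambda>u v. qbr A (wt u) (?e u) (?e v)) = spsum w (\<lambda>u v. 0)"
        proof (rule spsum_cong[OF refl])
          fix u t :: "'a gword" assume "length u + length t = length w"
          then have "length u \<noteq> 1 \<or> length t \<noteq> 1" by (auto simp: Cons v v')
          moreover have "?e u = 0" if "length u \<noteq> 1" for u :: "'a gword"
            using that by (auto split: list.split)
          ultimately show "qbr A (wt u) (?e u) (?e t) = 0" by auto
        qed
        then show ?thesis
          using Q[of x v] by (simp add: Cons v v' A.Qw_simps del: qsum.simps spsum.simps)
      qed
    qed
  qed
  then show ?thesis by (simp only: pc)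
qed

text \<open>Cocommutativity exchanges the halves and symmetry of \<open>qbr\<close> exchanges the
  arguments. The signs cancel because \<open>X\<close> has degree one, which is what the factor
  \<open>sg (wt u)\<close> anticipates.\<close>

lemma spsum_qbr_flip:
  assumes X: "\<And>u. gword (shift A) u \<Longrightarrow> X u \<in> grade (shift B) (wt u + 1)" and w: "gword (shift A) w"
  shows "spsum w (\<lambda>u v. sg (wt u) (qbr B (wt u) (f u) (X v))) = spsum w (\<lambda>u v. qbr B (wt u + 1) (X u) (f v))"
proof -
  have "spsum w (\<lambda>u v. sg (wt u) (qbr B (wt u) (f u) (X v))) =
      spsum w (\<lambda>u v. sg (wt u * wt v) (sg (wt v) (qbr B (wt v) (f v) (X u))))"
    by (rule spsum_cocomm)
  also have "\<dots> = spsum w (\<lambda>u v. qbr B (wt u + 1) (X u) (f v))"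
    using w
  proof (rule spsum_cong_gword)
    fix u v assume u: "gword (shift A) u" and v: "gword (shift A) v"
    have "sg (wt u * wt v) (sg (wt v) (qbr B (wt v) (f v) (X u))) = sg 0 (qbr B (wt u + 1) (X u) (f v))"
      unfolding B.qbr_sym[OF f_grade[OF v] X[OF u]] sg_sg by (rule sg_parity) auto
    then show "sg (wt u * wt v) (sg (wt v) (qbr B (wt v) (f v) (X u))) = qbr B (wt u + 1) (X u) (f v)" by simp
  qed
  finally show ?thesis .
qed

text \<open>The Leibniz rule yields a sum with the differential on the left factor and one with it
  on the right. They agree by \<open>spsum_qbr_flip\<close>, which cancels the factor 1/2.\<close>

lemma diff_S:
  assumes w: "gword (shift A) w"
  shows "diff B (S w) = - spsum w (\<lambda>u v. qbr B (wt u + 1) (diff B (f u)) (f v))"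
proof -
  let ?T = "spsum w (\<lambda>u v. qbr B (wt u + 1) (diff B (f u)) (f v))"
  have D: "diff B (f u) \<in> grade (shift B) (wt u + 1)" if "gword (shift A) u" for u
    using B.diff_grade[of "f u" "wt u + 1"] f_grade[OF that] by simp
  have "diff B (S w) = smul B (1/2) (spsum w (\<lambda>u v. diff B (qbr B (wt u) (f u) (f v))))"
    by (simp add: S_def dB.scale additive_spsum[OF B.diff_additive])
  also have "spsum w (\<lambda>u v. diff B (qbr B (wt u) (f u) (f v))) =
      spsum w (\<lambda>u v. - qbr B (wt u + 1) (diff B (f u)) (f v) - sg (wt u) (qbr B (wt u) (f u) (diff B (f v))))"
    by (rule spsum_cong_gword[OF w]) (rule B.diff_qbr[OF f_grade])
  also have "\<dots> = - ?T - ?T"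
    using spsum_qbr_flip[of "\<lambda>u. diff B (f u)", OF D w] by (simp only: spsum_diff spsum_minus)
  also have "smul B (1/2) (- ?T - ?T) = - ?T"
    using half_add[of "- ?T"] by simp
  finally show ?thesis .
qed

text \<open>Membership in a graded piece is tested by the projection \<open>hcomp\<close>, which is
  additive and hence passes through \<open>qsum\<close>.\<close>

lemma qsum_f_grade: "gword (shift A) w \<Longrightarrow> qsum (Qw A) w f \<in> grade (shift B) (wt w + 1)"
proof -
  assume w: "gword (shift A) w"
  let ?n = "wt w + 1"
  have a: "Modules.additive (hcomp (shift B) ?n)"
    by (simp add: Modules.additive_def B.V.hcomp_add)
  have "hcomp (shift B) ?n (qsum (Qw A) w f) = qsum (Qw A) w f"
    unfolding additive_qsum[OF a]
  proof (rule qsum_cong_strong[OF A.Qw_grade])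
    fix t assume "wt t = ?n" "gword (shift A) w \<Longrightarrow> gword (shift A) t"
    then show "hcomp (shift B) ?n (f t) = f t"
      using B.V.hcomp_hom[OF f_grade[of t], of ?n] w by simp
  qed
  then show ?thesis
    using B.V.hcomp_in_grade[of ?n "qsum (Qw A) w f"] by simp
qed

text \<open>The same pattern as for \<open>diff_S\<close>, with the coderivation property in place
  of the Leibniz rule.\<close>

lemma qsum_S:
  assumes w: "gword (shift A) w"
  shows "qsum (Qw A) w S = spsum w (\<lambda>u v. qbr B (wt u + 1) (qsum (Qw A) u f) (f v))"
proof -
  let ?X = "\<lambda>u. qsum (Qw A) u f"
  let ?T = "spsum w (\<lambda>u v. qbr B (wt u + 1) (?X u) (f v))"
  have half: "Modules.additive (smul B (1/2))"
    by (simp add: Modules.additive_def B.scale_right_distrib)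
  have "qsum (Qw A) w S = smul B (1/2) (qsum (Qw A) w (\<lambda>t. spsum t (\<lambda>u v. qbr B (wt u) (f u) (f v))))"
    unfolding S_def by (simp only: additive_qsum[OF half])
  also have "qsum (Qw A) w (\<lambda>t. spsum t (\<lambda>u v. qbr B (wt u) (f u) (f v))) =
      spsum w (\<lambda>u v. qsum (Qw A) u (\<lambda>s. qbr B (wt s) (f s) (f v)) + sg (wt u) (qsum (Qw A) v (\<lambda>t. qbr B (wt u) (f u) (f t))))"
    by (rule qsum_coderivation)
  also have "\<dots> = spsum w (\<lambda>u v. qbr B (wt u + 1) (?X u) (f v) + sg (wt u) (qbr B (wt u) (f u) (?X v)))"
  proof (rule spsum_cong[OF refl])
    fix u v :: "'a gword"
    have "qsum (Qw A) u (\<lambda>s. qbr B (wt s) (f s) (f v)) = qsum (Qw A) u (\<lambda>s. qbr B (wt u + 1) (f s) (f v))"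
      by (rule qsum_cong_wt) simp
    then show "qsum (Qw A) u (\<lambda>s. qbr B (wt s) (f s) (f v)) + sg (wt u) (qsum (Qw A) v (\<lambda>t. qbr B (wt u) (f u) (f t))) =
        qbr B (wt u + 1) (?X u) (f v) + sg (wt u) (qbr B (wt u) (f u) (?X v))"
      by (simp only: additive_qsum[OF B.qbr_additive_left] additive_qsum[OF B.qbr_additive_right])
  qed
  also have "\<dots> = ?T + ?T"
    using spsum_qbr_flip[of ?X, OF qsum_f_grade w] by (simp only: spsum_add)
  finally show ?thesis by (simp only: half_add)
qed

text \<open>In the convolution algebra this is half of [[f, f], f]. Permuting the three blocks of a
  triple split does not change the total \<open>?T\<close>, so three copies of \<open>?T\<close> can
  be combined into a sum whose terms vanish by the Jacobi identity, and 3 is invertible.\<close>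

lemma spsum_qbr_S:
  assumes w: "gword (shift A) w"
  shows "spsum w (\<lambda>u v. qbr B (wt u + 1) (S u) (f v)) = 0"
proof -
  define \<tau> where "\<tau> u v t = qbr B (wt u + wt v + 1) (qbr B (wt u) (f u) (f v)) (f t)" for u v t
  let ?T = "spsum w (\<lambda>u s. spsum s (\<lambda>v t. \<tau> u v t))"
  have half: "Modules.additive (smul B (1/2))"
    by (simp add: Modules.additive_def B.scale_right_distrib)
  have "spsum w (\<lambda>u v. qbr B (wt u + 1) (S u) (f v)) = spsum w (\<lambda>s t. smul B (1/2) (spsum s (\<lambda>u v. \<tau> u v t)))"
  proof (rule spsum_cong[OF refl])
    fix s t :: "'a gword"
    have "qbr B (wt s + 1) (S s) (f t) = smul B (1/2) (spsum s (\<lambda>u v. qbr B (wt s + 1) (qbr B (wt u) (f u) (f v)) (f t)))"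
      by (simp add: S_def B.qbr_scale_left additive_spsum[OF B.qbr_additive_left])
    also have "spsum s (\<lambda>u v. qbr B (wt s + 1) (qbr B (wt u) (f u) (f v)) (f t)) = spsum s (\<lambda>u v. \<tau> u v t)"
      unfolding \<tau>_def by (rule spsum_cong_strong) simp
    finally show "qbr B (wt s + 1) (S s) (f t) = smul B (1/2) (spsum s (\<lambda>u v. \<tau> u v t))" .
  qed
  also have "\<dots> = smul B (1/2) ?T"
    by (simp only: additive_spsum[OF half, symmetric] spsum_coassoc)
  also have "?T = 0"
  proof -
    have 2: "?T = spsum w (\<lambda>u s. spsum s (\<lambda>v t. sg (wt v * wt t) (\<tau> u t v)))"
      by (rule spsum_swap_right)
    have 3: "?T = spsum w (\<lambda>u s. spsum s (\<lambda>v t. sg (wt u * wt v + wt u * wt t) (\<tau> v t u)))"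
      unfolding 2 by (subst spsum_swap_left) (simp only: sg_sg)
    have "?T + ?T + ?T = spsum w (\<lambda>u s. spsum s (\<lambda>v t. \<tau> u v t + sg (wt v * wt t) (\<tau> u t v) +
        sg (wt u * wt v + wt u * wt t) (\<tau> v t u)))"
      using 2 3 by (simp only: spsum_add)
    also have "\<dots> = spsum w (\<lambda>u s. spsum s (\<lambda>v t. 0))"
      by (rule spsum_cong_gword[OF w], rule spsum_cong_gword, assumption, unfold \<tau>_def, rule B.qbr_jacobi)
        (rule f_grade, assumption)+
    finally have "?T + ?T + ?T = 0" by simp
    moreover have "smul B 3 ?T = ?T + ?T + ?T"
      using B.scale_left_distrib[of 1 2 ?T] B.scale_left_distrib[of 1 1 ?T] by simp
    ultimately have "smul B 3 ?T = 0" by simp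
    then show ?thesis by simp
  qed
  finally show ?thesis by simp
qed

lemma c_eq_0: "gword (shift A) w \<Longrightarrow> c w = 0"
proof (induction w rule: length_induct)
  case (1 w)
  note w = 1(2)
  have "c w = h (diff B (c w))"
    using homotopy[of "c w"] by (simp add: h_c p_c[OF w])
  also have "diff B (c w) = diff B (S w) - diff B (qsum (Qw A) w f)"
    by (simp add: c_def dB.diff B.diff_diff)
  also have "h \<dots> = h (diff B (S w)) - h (diff B (qsum (Qw A) w f))"
    by (simp only: h.diff)
  \<comment> \<open>Both \<open>h\<close> and the differential pass inside \<open>qsum\<close>,
    where \<open>h_diff_f\<close> replaces \<open>f\<close> by \<open>S\<close>.\<close>
  also have "h (diff B (qsum (Qw A) w f)) = h (qsum (Qw A) w S)"
    by (simp only: additive_qsum[OF additive_linear[OF B.diff_linear]] additive_qsum[OF additive_linear[OF h_linear]] h_diff_f)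
  also have "h (diff B (S w)) - h (qsum (Qw A) w S) = - h (qsum (Qw A) w S - diff B (S w))"
    by (simp add: h.diff)
  also have "qsum (Qw A) w S - diff B (S w) =
      spsum w (\<lambda>u v. qbr B (wt u + 1) (qsum (Qw A) u f + diff B (f u)) (f v))"
    by (simp only: qsum_S[OF w] diff_S[OF w] B.qbr_add_left spsum_add diff_minus_eq_add)
  also have "\<dots> = spsum w (\<lambda>u v. qbr B (wt u + 1) (S u) (f v))"
    using w
  proof (rule spsum_cong_gword)
    fix u v :: "'a gword" assume uv: "gword (shift A) u" "length u + length v = length w"
    show "qbr B (wt u + 1) (qsum (Qw A) u f + diff B (f u)) (f v) = qbr B (wt u + 1) (S u) (f v)"
    \<comment> \<open>The only term with \<open>u\<close> of full length has the factor
      \<open>f [] = 0\<close>; everywhere else the induction hypothesis applies to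
      \<open>u\<close>.\<close>
    proof (cases "v = []")
      case False
      then have "length u < length w" using uv(2) by (auto simp: neq_Nil_conv)
      with uv(1) have "c u = 0" using 1(1) by blast
      then have "qsum (Qw A) u f + diff B (f u) = S u" by (simp add: c_def algebra_simps)
      then show ?thesis by simp
    qed simp
  qed
  also have "\<dots> = 0" by (rule spsum_qbr_S[OF w])
  finally show ?case by simp
qed

lemma esum_Qw_eq_qsum: "gword (shift A) w \<Longrightarrow> esum f w (Qw B) = qsum (Qw A) w f"
  using c_eq_0[of w] by (simp add: esum_Qw c_def)

abbreviation I :: "('a list \<Rightarrow>\<^sub>0 'k) \<Rightarrow> ('b list \<Rightarrow>\<^sub>0 'k)" where
  "I \<equiv> exp_map (shift A) f"

lemma Linf_morphism_I: "Linf_morphism A B I"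
  by (rule Linf_morphism_exp_map[OF A.dgla_axioms B.dgla_axioms f.structure_maps_axioms esum_Qw_eq_qsum])

end

section \<open>Structure maps of the codifferential and uniqueness of the recursion\<close>

lemma linear_str_map:
  assumes "Vector_Spaces.linear fscale fscale F" "vector_space (smul W)"
  shows "Vector_Spaces.linear fscale (smul W) (str_map W F n)"
  unfolding str_map_def
  by (rule linear_compose_app[OF linear_sym_proj linear_compose_app[OF assms(1) linear_cogen[OF assms(2)]]])

lemma sym_proj_idem: "sym_proj n (sym_proj n t) = sym_proj n t"
  by (rule linear_mon_eqI[OF linear_compose_app[OF linear_sym_proj linear_sym_proj] linear_sym_proj])
    (simp add: sym_proj_mon module_hom.zero[OF linear_sym_proj[unfolded linear_iff_module_hom]])

lemma linear_apply_zero: "Vector_Spaces.linear s1 s2 f \<Longrightarrow> f 0 = 0"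
  by (simp add: linear_iff_module_hom module_hom.zero)

context dgla
begin

lemma str_map_codiff_2: "str_map V (codiff L) 2 (mon ys) = hsum V ys (Qw2 L)"
proof -
  have s': "vector_space (smul V)" ..
  have "cogen V (codiff L (mon ys)) = hsum V ys (\<lambda>w. qsum (Qw L) w (\<lambda>t. cogen V (mon (map snd t))))"
    by (rule codiff_eval[OF linear_cogen[OF s'] cogen_sym_rel[OF s']])
  then have "cogen V (codiff L (mon ys)) = hsum V ys (\<lambda>w. if w = [] then 0 else Qw L w)"
    by (simp only: cogen_mon[OF s'] qsum_single)
  moreover have "hsum V ys (\<lambda>w. if w = [] then 0 else Qw L w) = hsum V ys (Qw2 L)" if "length ys = 2"
    by (rule hsum_cong_len) (use that in \<open>auto simp: Qw_eq length_Suc_conv numeral_2_eq_2\<close>)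
  moreover have "hsum V ys (Qw2 L) = hsum V ys (\<lambda>w. 0)" if "length ys \<noteq> 2"
    by (rule hsum_cong_len) (use that in \<open>auto simp: Qw2_def split: list.split\<close>)
  ultimately show ?thesis
    by (auto simp: str_map_def sym_proj_mon linear_apply_zero[OF linear_codiff] linear_apply_zero[OF linear_cogen[OF s']])
qed

lemma linear_str_map_codiff: "Vector_Spaces.linear fscale (smul L) (str_map V (codiff L) n)"
  using linear_str_map[OF linear_codiff, of V] vector_space_axioms by simp

lemma str_map_codiff_2_sym_rel: "r \<in> sym_rel V \<Longrightarrow> str_map V (codiff L) 2 r = 0"
  by (rule V.sym_rel_kernel[OF linear_str_map_codiff gmsym_Qw2]) (simp_all add: str_map_codiff_2)

lemma str_map_codiff_component: "str_map V (codiff L) 2 (component F k 2 t) = str_map V (codiff L) 2 (F (sym_proj k t))"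
  by (simp add: str_map_def component_def sym_proj_idem)

end

text \<open>On words of length \<open>k\<close> the defect sees the morphism only through its
  component into \<open>Sym^2\<close>, which the comultiplication determines from shorter words, and
  through its structure map on words of length \<open>k - 1\<close>. So induction on the length
  determines the cogenerator component, and the comultiplication the remaining ones.\<close>

lemma transferred_unique:
  fixes A :: "('k::field_char_0, 'a::ab_group_add, 'm) dgla_data_scheme" and B :: "('k, 'b::ab_group_add, 'n) dgla_data_scheme"
  assumes "dgla A" "dgla B" and F: "transferred A B i h F" and G: "transferred A B i h G"
  shows "sym_eq (shift B) (F t) (G t)"
proof -
  interpret A: dgla A by fact
  interpret B: dgla B by fact
  have s: "vector_space (smul (shift B))" ..
  have cF: "coalg_morphism (shift A) (shift B) F" and cG: "coalg_morphism (shift A) (shift B) G"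
    using F G by (simp_all add: transferred_def)
  then have lF: "Vector_Spaces.linear fscale fscale F" and lG: "Vector_Spaces.linear fscale fscale G"
    by (simp_all add: coalg_morphism_iff)
  have cg: "cogen (shift B) a = cogen (shift B) b" if "symq (shift B) a = symq (shift B) b" for a b
    using that cogen_sym_rel[OF s, of "a - b"] module_hom.diff[OF linear_cogen[OF s, unfolded linear_iff_module_hom], of a b]
    by (simp add: quot_map_eq_iff[OF subspace_sym_rel])
  have q2: "str_map (shift B) (codiff B) 2 a = str_map (shift B) (codiff B) 2 b" if "symq (shift B) a = symq (shift B) b" for a b
    using that B.str_map_codiff_2_sym_rel[of "a - b"]
      module_hom.diff[OF B.linear_str_map_codiff[unfolded linear_iff_module_hom], of 2 a b]
    by (simp add: quot_map_eq_iff[OF subspace_sym_rel])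
  have words: "symq (shift B) (F (mon xs)) = symq (shift B) (G (mon xs))" for xs
  proof (induction xs rule: length_induct)
    case (1 xs)
    have IH: "symq (shift B) (F (mon ys)) = symq (shift B) (G (mon ys))" if "length ys < length xs" for ys
      using 1[rule_format, OF that] .
    have comp: "symq (shift B) (sym_proj j (F (mon xs))) = symq (shift B) (sym_proj j (G (mon xs)))" if "j \<ge> 2" for j
      by (rule symq_comult_components_unique[OF A.V.graded_space_axioms B.V.graded_space_axioms cF cG IH that])
    show ?case
    proof (cases "length xs \<ge> 1")
      case False
      then have "xs = []" by (cases xs) auto
      then show ?thesis using cF cG by (simp add: coalg_morphism_iff)
    next
      case True
      have "cogen (shift B) (F (mon xs)) = cogen (shift B) (G (mon xs))"
      proof (cases "length xs = 1")
        case True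
        then obtain x where x: "xs = [x]" by (auto simp: length_Suc_conv)
        have "first_map (shift B) F x = first_map (shift B) G x"
          using F G by (simp add: transferred_def)
        then show ?thesis by (simp add: str_map_def sym_proj_mon x)
      next
        case False
        let ?k = "length xs"
        have k: "?k \<ge> 2" using True False by linarith
        have lower: "str_map (shift B) F (?k - 1) t = str_map (shift B) G (?k - 1) t" for t
        proof (rule linear_mon_eqI[OF linear_str_map[OF lF s] linear_str_map[OF lG s]])
          fix ys
          have "cogen (shift B) (F (mon ys)) = cogen (shift B) (G (mon ys))" if "length ys = ?k - 1"
            by (rule cg, rule IH) (use that k in linarith)
          then show "str_map (shift B) F (?k - 1) (mon ys) = str_map (shift B) G (?k - 1) (mon ys)"
            by (simp add: str_map_def sym_proj_mon linear_apply_zero[OF lF] linear_apply_zero[OF lG])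
        qed
        have "symq (shift B) (component F ?k 2 (mon xs)) = symq (shift B) (component G ?k 2 (mon xs))"
          using comp[of 2] by (simp add: component_def sym_proj_mon)
        then have "Linf_defect A B F ?k (mon xs) = Linf_defect A B G ?k (mon xs)"
          unfolding Linf_defect_def lower by (simp only: q2[of "component F ?k 2 (mon xs)" "component G ?k 2 (mon xs)"])
        moreover have "str_map (shift B) F ?k (mon xs) = h (Linf_defect A B F ?k (mon xs))"
          "str_map (shift B) G ?k (mon xs) = h (Linf_defect A B G ?k (mon xs))"
          using F G k by (simp_all add: transferred_def)
        ultimately show ?thesis by (simp add: str_map_def sym_proj_mon)
      qed
      moreover have "counit (F (mon xs)) = counit (G (mon xs))"
        using cF cG by (simp add: coalg_morphism_iff)
      ultimately show ?thesis
        by (intro symq_eq_components[OF s _ _ comp])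
    qed
  qed
  show ?thesis
    unfolding sym_eq_iff
    by (rule linear_mon_eqI[OF linear_compose_app[OF lF linear_symq] linear_compose_app[OF lG linear_symq] words])
qed

section \<open>The structure maps of \<open>I\<close> and the two forms of the recursion\<close>

context dgla_retract
begin

lemma str_map_I: "str_map (shift B) I k (mon xs) = (if length xs = k then hsum (shift A) xs f else 0)"
proof -
  have s: "vector_space (smul (shift B))" ..
  have "cogen (shift B) (I 0) = 0"
    by (simp add: linear_apply_zero[OF linear_exp_map] linear_apply_zero[OF linear_cogen[OF s]])
  then show ?thesis by (simp add: str_map_def sym_proj_mon f.cogen_exp_map)
qed

lemma first_map_I: "first_map (shift B) I x = i x"
proof -
  have "first_map (shift B) I x = (\<Sum>d | hcomp (shift A) d x \<noteq> 0. i (hcomp (shift A) d x))"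
    by (simp add: str_map_I)
  then show ?thesis
    by (simp only: i.sum[symmetric] A.V.sum_hcomp)
qed

text \<open>This removes the term with the codifferential of \<open>A\<close> after \<open>h\<close>
  has been applied, so the recursion through \<open>Linf_defect\<close> and its simplified form
  coincide.\<close>

lemma h_str_map_I: "h (str_map (shift B) I k t) = 0"
proof (rule linear_mon_eqI)
  have s: "vector_space (smul (shift B))" ..
  show "Vector_Spaces.linear fscale (smul B) (\<lambda>t. h (str_map (shift B) I k t))"
    by (rule linear_compose_app[OF linear_str_map[OF linear_exp_map s, unfolded shift_simps(1)] h_linear])
  show "Vector_Spaces.linear fscale (smul B) (\<lambda>t. 0)"
    by (simp add: Vector_Spaces.linear_iff vector_space_fscale B.vector_space_axioms)
  show "h (str_map (shift B) I k (mon xs)) = 0" for xs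
    by (simp add: str_map_I additive_hsum[OF additive_linear[OF h_linear]])
qed

lemma str_map_codiff_I: "str_map (shift B) (codiff B) 2 (I (mon xs)) = hsum (shift A) xs S"
proof -
  have "str_map (shift B) (codiff B) 2 (I (mon xs)) = hsum (shift A) xs (\<lambda>w. esum f w (\<lambda>t. hsum (shift B) (map snd t) (Qw2 B)))"
    unfolding exp_map_eval[OF B.linear_str_map_codiff] B.str_map_codiff_2 ..
  also have "\<dots> = hsum (shift A) xs (\<lambda>w. esum f w (Qw2 B))"
    by (intro A.V.hsum_cong_hom f.esum_cong)
      (simp_all add: B.V.hsum_map_snd_gmult[OF conjunct1[OF B.gmsym_Qw2[unfolded gmsym_def]]])
  also have "\<dots> = hsum (shift A) xs S"
    by (rule A.V.hsum_cong_hom) (simp add: esum_Qw2)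
  finally show ?thesis .
qed

lemma str_map_I_recursion:
  assumes "k \<ge> 2"
  shows "str_map (shift B) I k t = h (str_map (shift B) (codiff B) 2 (component I k 2 t))"
  unfolding B.str_map_codiff_component
proof (rule linear_mon_eqI[where t = t])
  show "Vector_Spaces.linear fscale (smul B) (str_map (shift B) I k)"
    using linear_str_map[OF linear_exp_map B.V.vector_space_axioms] by simp
  show "Vector_Spaces.linear fscale (smul B) (\<lambda>t. h (str_map (shift B) (codiff B) 2 (I (sym_proj k t))))"
    by (rule linear_compose_app[OF linear_compose_app[OF linear_compose_app[OF linear_sym_proj linear_exp_map]
        B.linear_str_map_codiff] h_linear])
  fix xs :: "'a list"
  have "hsum (shift A) xs f = h (hsum (shift A) xs S)" if "length xs = k"
    unfolding additive_hsum[OF additive_linear[OF h_linear]]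
    by (rule hsum_cong_len) (use that assms in \<open>simp add: f_long\<close>)
  then show "str_map (shift B) I k (mon xs) = h (str_map (shift B) (codiff B) 2 (I (sym_proj k (mon xs))))"
    by (simp add: str_map_I sym_proj_mon str_map_codiff_I linear_apply_zero[OF linear_exp_map]
        linear_apply_zero[OF B.linear_str_map_codiff])
qed

lemma transferred_I: "transferred A B i h I"
  unfolding transferred_def
proof (intro conjI allI impI f.coalg_morphism_exp_map first_map_I)
  fix k :: nat and t assume "2 \<le> k"
  then show "str_map (shift B) I k t = h (Linf_defect A B I k t)"
    by (simp add: str_map_I_recursion Linf_defect_def h.diff h_str_map_I)
qed

end

section \<open>Strict morphisms\<close>

lemma hcomp_linear_deg_0:
  assumes "graded_space V" "graded_space W" and g: "linear_deg V W 0 g"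
  shows "hcomp W n (g x) = g (hcomp V n x)"
proof -
  interpret V: graded_space V by fact
  interpret W: graded_space W by fact
  interpret g: Vector_Spaces.linear "smul V" "smul W" g using g by (simp add: linear_deg_def)
  have gr: "g y \<in> grade W m" if "y \<in> grade V m" for y m
    using g that by (auto simp: linear_deg_def)
  have "g x = (\<Sum>m | hcomp V m x \<noteq> 0. g (hcomp V m x))"
    by (simp only: g.sum[symmetric] V.sum_hcomp)
  then show ?thesis
    by (intro W.hcomp_eqI W.hom_decompI[where S = "{m. hcomp V m x \<noteq> 0}"]) (auto simp: gr g.zero)
qed

lemma hsum_map:
  assumes "graded_space V" "graded_space W" and g: "linear_deg V W 0 g"
  shows "gmult W s F \<Longrightarrow> hsum W (map g xs) F = hsum V xs (\<lambda>w. F (map (apsnd g) w))"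
proof (induction xs arbitrary: F)
  case (Cons x xs)
  interpret V: graded_space V by fact
  interpret W: graded_space W by fact
  interpret g: Vector_Spaces.linear "smul V" "smul W" g using g by (simp add: linear_deg_def)
  have h: "hcomp W d (g x) = g (hcomp V d x)" for d
    by (rule hcomp_linear_deg_0[OF assms])
  have IH: "hsum W (map g xs) (\<lambda>w. F ((d, g (hcomp V d x)) # w)) = hsum V xs (\<lambda>w. F ((d, g (hcomp V d x)) # map (apsnd g) w))" for d
    by (rule Cons.IH, rule gmult_Cons[OF Cons.prems]) (simp flip: h)
  have "hsum W (map g (x # xs)) F = (\<Sum>d | g (hcomp V d x) \<noteq> 0. hsum W (map g xs) (\<lambda>w. F ((d, g (hcomp V d x)) # w)))"
    by (simp add: h)
  \<comment> \<open>Components killed by \<open>g\<close> are missing on the left. Adding them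
    changes nothing, as they put a zero letter into the multilinear \<open>F\<close>.\<close>
  also have "\<dots> = (\<Sum>d | hcomp V d x \<noteq> 0. hsum W (map g xs) (\<lambda>w. F ((d, g (hcomp V d x)) # w)))"
  proof (rule sum.mono_neutral_left)
    show "\<forall>d\<in>{d. hcomp V d x \<noteq> 0} - {d. g (hcomp V d x) \<noteq> 0}. hsum W (map g xs) (\<lambda>w. F ((d, g (hcomp V d x)) # w)) = 0"
    proof
      fix d assume "d \<in> {d. hcomp V d x \<noteq> 0} - {d. g (hcomp V d x) \<noteq> 0}"
      then have "hsum W (map g xs) (\<lambda>w. F ((d, g (hcomp V d x)) # w)) = hsum W (map g xs) (\<lambda>w. 0)"
        using W.gmult_zero[OF Cons.prems] by (intro W.hsum_cong_hom) simp
      then show "hsum W (map g xs) (\<lambda>w. F ((d, g (hcomp V d x)) # w)) = 0" by simp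
    qed
  qed (auto simp: g.zero)
  also have "\<dots> = hsum V (x # xs) (\<lambda>w. F (map (apsnd g) w))"
    by (simp add: IH)
  finally show ?case .
qed simp

lemma wt_map_apsnd [simp]: "wt (map (apsnd g) w) = wt w"
  by (induction w) simp_all

lemma map_snd_apsnd [simp]: "map snd (map (apsnd g) w) = map g (map snd w)"
  by (induction w) simp_all

lemma spsum_map_apsnd: "spsum (map (apsnd g) w) F = spsum w (\<lambda>u v. F (map (apsnd g) u) (map (apsnd g) v))"
  by (rule spsum_map) simp

lemma qsum_map_apsnd:
  assumes "\<And>u. q' (map (apsnd g) u) = g (q u)"
  shows "qsum q' (map (apsnd g) w) F = qsum q w (\<lambda>t. F (map (apsnd g) t))"
proof (induction w arbitrary: F)
  case (Cons x w)
  have *: "q' (apsnd g x # map (apsnd g) u) = g (q (x # u))" for u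
    using assms[of "x # u"] by simp
  show ?case
    by (simp add: Cons.IH spsum_map_apsnd *)
qed simp

lemma linear_strict_Linf: "Vector_Spaces.linear fscale fscale (strict_Linf g)"
  unfolding strict_Linf_def by (rule linear_lin_ext)

lemma strict_Linf_mon: "strict_Linf g (mon xs) = mon (map g xs)"
  by (simp add: strict_Linf_def)

lemma symq_strict_Linf:
  assumes g: "linear_deg V W 0 g" and "r \<in> sym_rel V"
  shows "symq W (strict_Linf g r) = 0"
proof (rule sym_rel_kernelI[OF linear_compose_app[OF linear_strict_Linf linear_symq] _ _ _ assms(2)])
  interpret g: Vector_Spaces.linear "smul V" "smul W" g using g by (simp add: linear_deg_def)
  have gr: "g y \<in> grade W m" if "y \<in> grade V m" for y m
    using g that by (auto simp: linear_deg_def)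
  show "symq W (strict_Linf g (mon (us @ (x + y) # vs))) =
      symq W (strict_Linf g (mon (us @ x # vs))) + symq W (strict_Linf g (mon (us @ y # vs)))" for us x y vs
    by (simp add: strict_Linf_mon g.add symq_add)
  show "symq W (strict_Linf g (mon (us @ smul V c x # vs))) = fscale c (symq W (strict_Linf g (mon (us @ x # vs))))" for us c x vs
    by (simp add: strict_Linf_mon g.scale symq_scale)
  show "symq W (strict_Linf g (mon (us @ x # y # vs))) = sg (m * n) (symq W (strict_Linf g (mon (us @ y # x # vs))))"
    if "x \<in> grade V m" "y \<in> grade V n" for us x y vs m n
    using symq_swap[OF gr[OF that(1)] gr[OF that(2)]] by (simp add: strict_Linf_mon)
qed

lemma coalg_morphism_strict_Linf:
  assumes V: "graded_space V" and W: "graded_space W" and g: "linear_deg V W 0 g"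
  shows "coalg_morphism V W (strict_Linf g)"
  unfolding coalg_morphism_iff
proof (intro conjI ballI allI linear_strict_Linf)
  interpret V: graded_space V by fact
  interpret W: graded_space W by fact
  have gr: "g y \<in> grade W m" if "y \<in> grade V m" for y m
    using g that by (auto simp: linear_deg_def)
  let ?P = "strict_Linf g"
  show kill: "symq W (?P r) = 0" if "r \<in> sym_rel V" for r
    by (rule symq_strict_Linf[OF g that])
  show "?P ` sym_grade V n \<subseteq> sym_grade W n" for n
  proof (rule sym_grade_image[OF linear_strict_Linf])
    show "?P r \<in> sym_rel W" if "r \<in> sym_rel V" for r
      using kill[OF that] by (simp only: symq_eq_0)
    fix w assume "gword V w"
    then have "gword W (map (apsnd g) w)" by (auto simp: gword_def gr)
    from mon_sym_grade[OF this] show "?P (mon (map snd w)) \<in> sym_grade W (wt w)"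
      by (simp only: strict_Linf_mon map_snd_apsnd wt_map_apsnd)
  qed
  show "symq2 W (comult W (?P t)) = symq2 W (tens_map ?P ?P (comult V t))" for t
  proof (rule linear_mon_eqI[where t = t])
    let ?G = "\<lambda>u v. symq2 W (mon (map snd u, map snd v))"
    show "Vector_Spaces.linear fscale fscale (\<lambda>t. symq2 W (comult W (?P t)))"
      by (rule linear_compose_app[OF linear_strict_Linf linear_compose_app[OF linear_comult linear_symq2]])
    show "Vector_Spaces.linear fscale fscale (\<lambda>t. symq2 W (tens_map ?P ?P (comult V t)))"
      by (rule linear_compose_app[OF linear_comult linear_compose_app[OF linear_tens_map linear_symq2]])
    fix xs
    have "gmult W fscale (\<lambda>w. spsum w ?G)"
      by (rule gmult_spsum[OF vector_space_fscale gmsym2_symq2])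
    from hsum_map[OF V W g this]
    have "symq2 W (comult W (?P (mon xs))) = hsum V xs (\<lambda>w. spsum (map (apsnd g) w) ?G)"
      by (simp only: strict_Linf_mon comult_eval[OF linear_symq2])
    also have "\<dots> = symq2 W (tens_map ?P ?P (comult V (mon xs)))"
      unfolding comult_eval[OF linear_compose_app[OF linear_tens_map linear_symq2]] tens_map_mon
      by (simp only: spsum_map_apsnd map_snd_apsnd strict_Linf_mon tens_mon)
    finally show "symq2 W (comult W (?P (mon xs))) = symq2 W (tens_map ?P ?P (comult V (mon xs)))" .
  qed
  show "counit (?P t) = counit t" for t
    by (rule linear_mon_eqI[OF linear_compose_app[OF linear_strict_Linf linear_counit] linear_counit])
      (simp add: strict_Linf_mon counit_mon)
  show "symq W (?P (mon [])) = symq W (mon [])"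
    by (simp add: strict_Linf_mon)
qed

lemma linear_deg_shift: "linear_deg V W 0 g \<Longrightarrow> linear_deg (shift V) (shift W) 0 g"
  by (simp add: linear_deg_def)

text \<open>The morphism acts letter by letter, so intertwining the maps \<open>Qw\<close> already
  intertwines \<open>qsum\<close> term by term; no sum over partitions is involved.\<close>

lemma Linf_morphism_strict_Linf:
  assumes "dgla L" "dgla M" and g: "dgla_morphism L M g"
  shows "Linf_morphism L M (strict_Linf g)"
proof -
  interpret L: dgla L by fact
  interpret M: dgla M by fact
  have g0: "linear_deg (shift L) (shift M) 0 g"
    using g by (intro linear_deg_shift) (simp add: dgla_morphism_def chain_map_def)
  have gl: "Vector_Spaces.linear (smul L) (smul M) g"
    using g by (simp add: dgla_morphism_def chain_map_def linear_deg_def)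
  interpret g: Vector_Spaces.linear "smul L" "smul M" g by (rule gl)
  have gd: "g (diff L x) = diff M (g x)" and gb: "g (bracket L x y) = bracket M (g x) (g y)" for x y
    using g by (simp_all add: dgla_morphism_def chain_map_def)
  have gq: "g (qbr L d x y) = qbr M d (g x) (g y)" for d x y
    by (simp add: qbr_def linear_sg[OF gl] gb)
  have Q: "Qw M (map (apsnd g) u) = g (Qw L u)" for u
    by (auto simp: L.Qw_eq M.Qw_eq Qw2_def g.add gd g.neg gq split: list.split)
  let ?P = "strict_Linf g" and ?W = "shift M"
  let ?g = "\<lambda>w. symq ?W (mon (map snd w))"
  have P: "Vector_Spaces.linear fscale fscale (\<lambda>t. symq ?W (?P t))"
    by (rule linear_compose_app[OF linear_strict_Linf linear_symq])
  have "symq ?W (?P (codiff L t)) = symq ?W (codiff M (?P t))" for t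
  proof (rule linear_mon_eqI[where t = t])
    show "Vector_Spaces.linear fscale fscale (\<lambda>t. symq ?W (?P (codiff L t)))"
      by (rule linear_compose_app[OF L.linear_codiff P])
    show "Vector_Spaces.linear fscale fscale (\<lambda>t. symq ?W (codiff M (?P t)))"
      by (rule linear_compose_app[OF linear_strict_Linf linear_compose_app[OF M.linear_codiff linear_symq]])
    fix xs
    have "gmult ?W fscale (\<lambda>w. qsum (Qw M) w ?g)"
      using M.gmsym_qsum[OF vector_space_fscale gmsym_symq] by (simp add: gmsym_def)
    from hsum_map[OF L.V.graded_space_axioms M.V.graded_space_axioms g0 this]
    have "symq ?W (codiff M (?P (mon xs))) = hsum (shift L) xs (\<lambda>w. qsum (Qw M) (map (apsnd g) w) ?g)"
      by (simp add: strict_Linf_mon M.codiff_eval[OF linear_symq] symq_eq_0)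
    also have "\<dots> = symq ?W (?P (codiff L (mon xs)))"
    proof -
      have "symq ?W (?P (codiff L (mon xs))) = hsum (shift L) xs (\<lambda>w. qsum (Qw L) w (\<lambda>t. symq ?W (?P (mon (map snd t)))))"
        by (rule L.codiff_eval[OF P symq_strict_Linf[OF g0]])
      then show ?thesis
        by (simp only: qsum_map_apsnd[where q' = "Qw M" and q = "Qw L", OF Q] strict_Linf_mon map_snd_apsnd)
    qed
    finally show "symq ?W (?P (codiff L (mon xs))) = symq ?W (codiff M (?P (mon xs)))" by (rule sym)
  qed
  then show ?thesis
    by (simp add: Linf_morphism_def sym_eq_iff coalg_morphism_strict_Linf[OF L.V.graded_space_axioms M.V.graded_space_axioms g0])
qed

section \<open>Cohomology\<close>

lemma cocycles_shift: "cocycles (shift V) n = cocycles V (n + 1)"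
  by (simp add: cocycles_def)

context cochain_complex
begin

lemma diff_add: "diff V (x + y) = diff V x + diff V y"
  and diff_minus: "diff V (- x) = - diff V x"
proof -
  interpret d: Vector_Spaces.linear "smul V" "smul V" "diff V"
    using diff_linear_deg by (simp add: linear_deg_def)
  show "diff V (x + y) = diff V x + diff V y" "diff V (- x) = - diff V x"
    by (simp_all add: d.add d.neg)
qed

lemma coboundaries_shift: "coboundaries (shift V) n = coboundaries V (n + 1)"
proof -
  have "(\<lambda>x. - diff V x) ` grade V n = diff V ` grade V n"
  proof (intro set_eqI iffI)
    fix y assume "y \<in> (\<lambda>x. - diff V x) ` grade V n"
    then obtain x where "x \<in> grade V n" "y = diff V (- x)" by (auto simp: diff_minus)
    then show "y \<in> diff V ` grade V n" using grade_minus by blast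
  next
    fix y assume "y \<in> diff V ` grade V n"
    then obtain x where "x \<in> grade V n" "y = - diff V (- x)" by (auto simp: diff_minus)
    then show "y \<in> (\<lambda>x. - diff V x) ` grade V n" using grade_minus by blast
  qed
  then show ?thesis by (simp add: coboundaries_def shift_def)
qed

lemma cohomologous_shift: "cohomologous (shift V) n = cohomologous V (n + 1)"
  by (simp add: cohomologous_def cocycles_shift coboundaries_shift)

lemma cohomology_shift: "cohomology (shift V) n = cohomology V (n + 1)"
  by (simp add: cohomology_def cocycles_shift cohomologous_shift)

lemma cohomology_map_shift: "cohomology_map (shift V) n g = cohomology_map V (n + 1) g"
  by (simp add: cohomology_map_def cohomologous_shift fun_eq_iff)

lemma coboundaries_closed:
  "0 \<in> coboundaries V n" "x \<in> coboundaries V n \<Longrightarrow> - x \<in> coboundaries V n"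
  "x \<in> coboundaries V n \<Longrightarrow> y \<in> coboundaries V n \<Longrightarrow> x + y \<in> coboundaries V n"
proof -
  have "diff V 0 = 0" using diff_add[of 0 0] by simp
  then show "0 \<in> coboundaries V n" unfolding coboundaries_def by (intro image_eqI[of _ _ 0]) simp_all
  show "x \<in> coboundaries V n \<Longrightarrow> - x \<in> coboundaries V n"
    unfolding coboundaries_def by (auto intro!: grade_minus simp flip: diff_minus)
  show "x \<in> coboundaries V n \<Longrightarrow> y \<in> coboundaries V n \<Longrightarrow> x + y \<in> coboundaries V n"
    unfolding coboundaries_def by (auto intro!: grade_add simp flip: diff_add)
qed

lemma equiv_cohomologous: "equiv (cocycles V n) (cohomologous V n)"
proof (rule equivI)
  show "cohomologous V n \<subseteq> cocycles V n \<times> cocycles V n" by (auto simp: cohomologous_def)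
  show "refl_on (cocycles V n) (cohomologous V n)"
    by (auto simp: refl_on_def cohomologous_def coboundaries_closed)
  show "sym (cohomologous V n)"
  proof (rule symI)
    fix x y assume "(x, y) \<in> cohomologous V n"
    then show "(y, x) \<in> cohomologous V n"
      using coboundaries_closed(2)[of "x - y" n] by (simp add: cohomologous_def)
  qed
  show "trans (cohomologous V n)"
  proof (rule transI)
    fix x y z assume "(x, y) \<in> cohomologous V n" "(y, z) \<in> cohomologous V n"
    then show "(x, z) \<in> cohomologous V n"
      using coboundaries_closed(3)[of "x - y" n "y - z"] by (simp add: cohomologous_def)
  qed
qed

end

lemma quasi_iso_shift:
  assumes "cochain_complex V" "cochain_complex W" "quasi_iso V W g"
  shows "quasi_iso (shift V) (shift W) g"
proof -
  interpret V: cochain_complex V by fact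
  interpret W: cochain_complex W by fact
  have g: "chain_map V W g" using assms(3) by (simp add: quasi_iso_def)
  then interpret g: Vector_Spaces.linear "smul V" "smul W" g by (simp add: chain_map_def linear_deg_def)
  have "chain_map (shift V) (shift W) g"
    using g linear_deg_shift[of V W g] by (simp add: chain_map_def g.neg)
  then show ?thesis
    using assms(3) by (simp add: quasi_iso_def V.cohomology_shift W.cohomology_shift W.cohomology_map_shift)
qed

lemma chain_map_cohomologous:
  assumes "chain_map V W g" "(x, y) \<in> cohomologous V n"
  shows "(g x, g y) \<in> cohomologous W n"
proof -
  interpret g: Vector_Spaces.linear "smul V" "smul W" g using assms(1) by (simp add: chain_map_def linear_deg_def)
  have gr: "g z \<in> grade W m" if "z \<in> grade V m" for z m
    using assms(1) that by (auto simp: chain_map_def linear_deg_def)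
  have d: "diff W (g z) = g (diff V z)" for z
    using assms(1) by (simp add: chain_map_def)
  have cocycle: "g z \<in> cocycles W n" if "z \<in> cocycles V n" for z
    using that by (simp add: cocycles_def gr d g.zero)
  obtain z where "z \<in> grade V (n - 1)" "x - y = diff V z"
    using assms(2) by (auto simp: cohomologous_def coboundaries_def)
  then have "g x - g y = diff W (g z)" "g z \<in> grade W (n - 1)"
    by (simp_all add: d gr flip: g.diff)
  then show ?thesis
    using assms(2) cocycle by (auto simp: cohomologous_def coboundaries_def)
qed

text \<open>\<open>cohomology_map\<close> takes a union over all representatives. For a chain map
  they all give the same class, so the union collapses to the class of one image.\<close>

lemma cohomology_map_class:
  assumes "cochain_complex V" "cochain_complex W" "chain_map V W g" "x \<in> cocycles V n"
  shows "cohomology_map W n g (cohomologous V n `` {x}) = cohomologous W n `` {g x}"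
proof -
  interpret V: cochain_complex V by fact
  interpret W: cochain_complex W by fact
  have "cohomologous W n `` {g y} = cohomologous W n `` {g x}" if "y \<in> cohomologous V n `` {x}" for y
    using chain_map_cohomologous[OF assms(3), of x y n] that equiv_class_eq[OF W.equiv_cohomologous] by blast
  moreover have "x \<in> cohomologous V n `` {x}"
    using equiv_class_self[OF V.equiv_cohomologous assms(4)] .
  ultimately show ?thesis
    unfolding cohomology_map_def by blast
qed

context dgla_retract
begin

lemma cohomology_map_p_i:
  assumes "cl \<in> cohomology A n"
  shows "cohomology_map A n p (cohomology_map B n i cl) = cl"
proof -
  have pc: "chain_map B A p" using p by (simp add: dgla_morphism_def)
  obtain x where x: "x \<in> cocycles A n" "cl = cohomologous A n `` {x}"
    using assms by (auto simp: cohomology_def elim: quotientE)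
  then have ix: "i x \<in> cocycles B n" using i_grade by (simp add: cocycles_def i_diff[symmetric])
  show ?thesis
    by (simp add: x(2) cohomology_map_class[OF A.cochain_complex_axioms B.cochain_complex_axioms i x(1)]
        cohomology_map_class[OF B.cochain_complex_axioms A.cochain_complex_axioms pc ix])
qed

lemma cohomology_map_i_p:
  assumes "cl \<in> cohomology B n"
  shows "cohomology_map B n i (cohomology_map A n p cl) = cl"
proof -
  have pc: "chain_map B A p" using p by (simp add: dgla_morphism_def)
  obtain x where x: "x \<in> cocycles B n" "cl = cohomologous B n `` {x}"
    using assms by (auto simp: cohomology_def elim: quotientE)
  then have px: "p x \<in> cocycles A n" using p_grade by (simp add: cocycles_def p_diff[symmetric])
  have ipx: "i (p x) \<in> cocycles B n" using px i_grade by (simp add: cocycles_def i_diff[symmetric])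
  \<comment> \<open>On a cocycle the other term of the homotopy identity vanishes, so
    \<open>h x\<close> is a primitive of the difference.\<close>
  have "x - i (p x) = diff B (h x)"
    using homotopy[of x] x(1) by (simp add: cocycles_def)
  moreover have "h x \<in> grade B (n - 1)"
    using h_grade[of x "n - 1"] x(1) by (simp add: cocycles_def)
  ultimately have "(x, i (p x)) \<in> cohomologous B n"
    using x(1) ipx by (simp add: cohomologous_def coboundaries_def)
  then have "cohomologous B n `` {i (p x)} = cohomologous B n `` {x}"
    by (rule equiv_class_eq[OF B.equiv_cohomologous, symmetric])
  then show ?thesis
    by (simp add: x(2) cohomology_map_class[OF A.cochain_complex_axioms B.cochain_complex_axioms i px]
        cohomology_map_class[OF B.cochain_complex_axioms A.cochain_complex_axioms pc x(1)])
qed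

end

text \<open>The recursion fixes a map on \<open>Sym\<close>, and such a map is represented by a lift
  to free spaces; hence existence is a statement about one lift, and uniqueness is asserted modulo
  \<open>sym_eq\<close>.\<close>

theorem proposition3p3:
  fixes A :: "('k::field_char_0, 'a::ab_group_add) dgla_data"
    and B :: "('k, 'b::ab_group_add) dgla_data"
    and i :: "'a \<Rightarrow> 'b" and p :: "'b \<Rightarrow> 'a" and h :: "'b \<Rightarrow> 'b"
  assumes "dgla A" and "dgla B"
    and "quasi_iso A B i" and "quasi_iso B A p"
    and "linear_deg B B (-1) h"
    and "\<And>x. h (diff B x) + diff B (h x) = x - i (p x)"
    and "\<And>x. p (i x) = x"
    and "\<And>x. h (h x) = 0"
    and "\<And>x. h (i x) = 0"
    and "\<And>x. p (h x) = 0"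
    and "dgla_morphism B A p"
  shows "\<exists>I. transferred A B i h I
           \<and> (\<forall>I'. transferred A B i h I' \<longrightarrow> (\<forall>t. sym_eq (shift B) (I' t) (I t)))
           \<and> Linf_quasi_inverse B A (strict_Linf p) I
           \<and> (\<forall>k\<ge>2. \<forall>t. str_map (shift B) I k t
                 = h (str_map (shift B) (codiff B) 2 (component I k 2 t)))"
proof -
  interpret A: dgla A by fact
  interpret B: dgla B by fact
  interpret R: dgla_retract A B i p h
    by unfold_locales (use assms in \<open>simp_all add: quasi_iso_def\<close>)
  have p1: "first_map (shift A) (strict_Linf p) = p"
    using str_map_strict_Linf_1[of "shift A" p] A.vector_space_axioms by (simp add: fun_eq_iff)
  have i1: "first_map (shift B) R.I = i"
    by (rule ext) (rule R.first_map_I)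
  have "Linf_quasi_inverse B A (strict_Linf p) R.I"
    unfolding Linf_quasi_inverse_def Linf_quasi_iso_def p1 i1
    using Linf_morphism_strict_Linf[OF assms(2,1,11)] R.Linf_morphism_I
      quasi_iso_shift[OF A.cochain_complex_axioms B.cochain_complex_axioms assms(3)]
      quasi_iso_shift[OF B.cochain_complex_axioms A.cochain_complex_axioms assms(4)]
    by (simp add: A.cohomology_map_shift B.cohomology_map_shift A.cohomology_shift B.cohomology_shift
        R.cohomology_map_p_i R.cohomology_map_i_p)
  then show ?thesis
    using R.transferred_I transferred_unique[OF assms(1,2) _ R.transferred_I] R.str_map_I_recursion by blast
qed

end
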